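(* Let $\alpha$ and $\beta$ be real numbers. Then $$\left(F_\beta^{\infty,0}\right)^*=F_\alpha^1$$ with equivalent norms under the pairing $\langle\ ,\ \rangle_{\alpha+\beta}$. That is, for each $g\in F_\alpha^1$ the functional $f\mapsto\langle f,g\rangle_{\alpha+\beta}$ is well defined and bounded on $F_\beta^{\infty,0}$; every bounded linear functional on $F_\beta^{\infty,0}$ is of this form for a unique $g\in F_\alpha^1$; and the functional norm is equivalent to $\|g\|_{F_\alpha^1}$.
   Context: Fix an integer $n\ge1$. $dV$ is Lebesgue volume measure on $\mathbb{C}^n$ normalized so that $\int_{\mathbb{C}^n}e^{-|z|^2}dV(z)=1$. For $\alpha$ real, $F_\alpha^1$ is the space of entire functions $f$ on $\mathbb{C}^n$ with $\|f\|_{F_\alpha^1}=\int_{\mathbb{C}^n}|f(z)|e^{-|z|^2/2}(1+|z|)^{-\alpha}dV(z)<\infty$. $F_\beta^\infty$ is the space of entire $f$ with $\|f\|_{F_\beta^\infty}=\sup_z\frac{|f(z)|e^{-|z|^2/2}}{(1+|z|)^\beta}<\infty$, and $F_\beta^{\infty,0}$ is its closed subspace of those $f$ with $\lim_{|z|\to\infty}\frac{|f(z)|e^{-|z|^2/2}}{(1+|z|)^\beta}=0$, with the norm of $F_\beta^\infty$. For an entire $f$ with homogeneous expansion $f=\sum_{k\ge0}f_k$ ($f_k$ a homogeneous polynomial of degree $k$) and $s$ real, $f_s^-=\sum_{k\le|s|}f_k$ and $f_s^+=\sum_{k>|s|}f_k$. For $\sigma$ real put $(f,g)_\sigma=\int_{\mathbb{C}^n}f(z)\overline{g(z)}e^{-|z|^2}|z|^{-\sigma}dV(z)$,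 and define the pairing $\langle f,g\rangle_\sigma=(f,g)_\sigma$ if $\sigma<2n$, and $\langle f,g\rangle_\sigma=(f_{\sigma/2}^-,g_{\sigma/2}^-)_0+(f_{\sigma/2}^+,g_{\sigma/2}^+)_\sigma$ if $\sigma\ge2n$. *)

theory Defs
  imports "HOL-Analysis.Analysis" "HOL-Probability.Distributions"
begin

text \<open>\<open>\<complex>\<^sup>n\<close> is the type \<open>complex^'n\<close> with \<open>n = CARD('n) \<ge> 1\<close>; \<open>norm\<close> is the Euclidean norm and
  \<open>*s\<close> is multiplication by complex scalars.\<close>

definition entire :: "(complex^'n \<Rightarrow> complex) \<Rightarrow> bool" where
  "entire f \<longleftrightarrow> (\<forall>z. \<exists>D. (f has_derivative D) (at z) \<and> (\<forall>c v. D (c *s v) = c * D v))"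

definition gauss_volume :: "(complex^'n) measure" where
  "gauss_volume = scale_measure (1 / (\<integral>\<^sup>+z. ennreal (exp (- (norm (z::complex^'n))\<^sup>2)) \<partial>lborel)) lborel"

definition fock_one :: "real \<Rightarrow> (complex^'n \<Rightarrow> complex) set" where
  "fock_one \<alpha> = {f. entire f \<and>
     integrable gauss_volume (\<lambda>z. norm (f z) * exp (- (norm z)\<^sup>2 / 2) * (1 + norm z) powr (- \<alpha>))}"

definition fock_one_norm :: "real \<Rightarrow> (complex^'n \<Rightarrow> complex) \<Rightarrow> real" where
  "fock_one_norm \<alpha> f =
     (\<integral>z. norm (f z) * exp (- (norm z)\<^sup>2 / 2) * (1 + norm z) powr (- \<alpha>) \<partial>gauss_volume)"

definition fock_weighted :: "real \<Rightarrow> (complex^'n \<Rightarrow> complex) \<Rightarrow> complex^'n \<Rightarrow> real" where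
  "fock_weighted \<beta> f z = norm (f z) * exp (- (norm z)\<^sup>2 / 2) / (1 + norm z) powr \<beta>"

definition fock_inf :: "real \<Rightarrow> (complex^'n \<Rightarrow> complex) set" where
  "fock_inf \<beta> = {f. entire f \<and> bdd_above (range (fock_weighted \<beta> f))}"

definition fock_inf_norm :: "real \<Rightarrow> (complex^'n \<Rightarrow> complex) \<Rightarrow> real" where
  "fock_inf_norm \<beta> f = (SUP z. fock_weighted \<beta> f z)"

definition fock_inf0 :: "real \<Rightarrow> (complex^'n \<Rightarrow> complex) set" where
  "fock_inf0 \<beta> = {f \<in> fock_inf \<beta>. (fock_weighted \<beta> f \<longlongrightarrow> 0) at_infinity}"

definition homogeneous_poly :: "nat \<Rightarrow> (complex^'n \<Rightarrow> complex) \<Rightarrow> bool" where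
  "homogeneous_poly k p \<longleftrightarrow>
     (\<exists>c. \<forall>z. p z = (\<Sum>m | (\<Sum>i\<in>UNIV. m i) = k. c m * (\<Prod>i\<in>UNIV. (z $ i) ^ m i)))"

definition is_homogeneous_expansion ::
    "(complex^'n \<Rightarrow> complex) \<Rightarrow> (nat \<Rightarrow> complex^'n \<Rightarrow> complex) \<Rightarrow> bool" where
  "is_homogeneous_expansion f F \<longleftrightarrow>
     (\<forall>k. homogeneous_poly k (F k)) \<and> (\<forall>z. (\<lambda>k. F k z) sums f z)"

definition homogeneous_part :: "(complex^'n \<Rightarrow> complex) \<Rightarrow> nat \<Rightarrow> complex^'n \<Rightarrow> complex" where
  "homogeneous_part f = (THE F. is_homogeneous_expansion f F)"

definition low_part :: "real \<Rightarrow> (complex^'n \<Rightarrow> complex) \<Rightarrow> complex^'n \<Rightarrow> complex" where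
  "low_part s f z = (\<Sum>k | real k \<le> \<bar>s\<bar>. homogeneous_part f k z)"

definition high_part :: "real \<Rightarrow> (complex^'n \<Rightarrow> complex) \<Rightarrow> complex^'n \<Rightarrow> complex" where
  "high_part s f z = (\<Sum>k. if real k > \<bar>s\<bar> then homogeneous_part f k z else 0)"

definition form_integrand ::
    "real \<Rightarrow> (complex^'n \<Rightarrow> complex) \<Rightarrow> (complex^'n \<Rightarrow> complex) \<Rightarrow> complex^'n \<Rightarrow> complex" where
  "form_integrand \<sigma> f g z =
     f z * cnj (g z) * of_real (exp (- (norm z)\<^sup>2) * norm z powr (- \<sigma>))"

definition form ::
    "real \<Rightarrow> (complex^'n \<Rightarrow> complex) \<Rightarrow> (complex^'n \<Rightarrow> complex) \<Rightarrow> complex" where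
  "form \<sigma> f g = (\<integral>z. form_integrand \<sigma> f g z \<partial>gauss_volume)"

definition pairing ::
    "real \<Rightarrow> (complex^'n \<Rightarrow> complex) \<Rightarrow> (complex^'n \<Rightarrow> complex) \<Rightarrow> complex" where
  "pairing \<sigma> f g =
     (if \<sigma> < 2 * real CARD('n) then form \<sigma> f g
      else form 0 (low_part (\<sigma> / 2) f) (low_part (\<sigma> / 2) g)
         + form \<sigma> (high_part (\<sigma> / 2) f) (high_part (\<sigma> / 2) g))"

text \<open>The Bochner integral is total (it is 0 for non-integrable functions), so absolute convergence
  of the integrals in \<open>pairing\<close> is a separate predicate.\<close>

definition pairing_well_defined ::
    "real \<Rightarrow> (complex^'n \<Rightarrow> complex) \<Rightarrow> (complex^'n \<Rightarrow> complex) \<Rightarrow> bool" where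
  "pairing_well_defined \<sigma> f g \<longleftrightarrow>
     (if \<sigma> < 2 * real CARD('n) then integrable gauss_volume (form_integrand \<sigma> f g)
      else integrable gauss_volume (form_integrand 0 (low_part (\<sigma> / 2) f) (low_part (\<sigma> / 2) g))
         \<and> integrable gauss_volume (form_integrand \<sigma> (high_part (\<sigma> / 2) f) (high_part (\<sigma> / 2) g)))"

text \<open>Functionals on a normed space of functions with carrier \<open>X\<close> and norm \<open>N\<close>; the values of \<open>L\<close>
  outside \<open>X\<close> play no role.\<close>

definition bounded_functional ::
    "('a \<Rightarrow> complex) set \<Rightarrow> (('a \<Rightarrow> complex) \<Rightarrow> real) \<Rightarrow> (('a \<Rightarrow> complex) \<Rightarrow> complex) \<Rightarrow> bool" where
  "bounded_functional X N L \<longleftrightarrow>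
     (\<forall>f\<in>X. \<forall>h\<in>X. L (\<lambda>z. f z + h z) = L f + L h) \<and>
     (\<forall>c. \<forall>f\<in>X. L (\<lambda>z. c * f z) = c * L f) \<and>
     (\<exists>C. \<forall>f\<in>X. norm (L f) \<le> C * N f)"

definition functional_norm ::
    "('a \<Rightarrow> complex) set \<Rightarrow> (('a \<Rightarrow> complex) \<Rightarrow> real) \<Rightarrow> (('a \<Rightarrow> complex) \<Rightarrow> complex) \<Rightarrow> real" where
  "functional_norm X N L = (SUP f \<in> {f \<in> X. N f \<le> 1}. norm (L f))"

text \<open>Sanity checks: the normalization of the volume, and uniqueness of the homogeneous expansion.\<close>

lemma nn_integral_gauss:
  "(\<integral>\<^sup>+z. ennreal (exp (- (norm (z::complex^'n))\<^sup>2)) \<partial>lborel) = ennreal (pi ^ CARD('n))"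
proof -
  have 1: "(\<integral>\<^sup>+x. ennreal (exp (- x\<^sup>2)) \<partial>lborel) = ennreal (sqrt pi)"
  proof -
    have "has_bochner_integral lborel (\<lambda>x::real. exp (- x\<^sup>2)) (2 *\<^sub>R (sqrt pi / 2))"
      by (rule has_bochner_integral_even_function) (use gaussian_moment_0 in simp_all)
    thus ?thesis
      by (subst nn_integral_eq_integral) (auto simp: has_bochner_integral_iff)
  qed
  have "(\<integral>\<^sup>+z. ennreal (exp (- (norm (z::complex^'n))\<^sup>2)) \<partial>lborel)
      = (\<integral>\<^sup>+z. (\<Prod>b\<in>Basis. ennreal (exp (- ((z::complex^'n) \<bullet> b)\<^sup>2))) \<partial>lborel)"
  proof (rule nn_integral_cong)
    fix z :: "complex^'n"
    have "(norm z)\<^sup>2 = (\<Sum>b\<in>Basis. (z \<bullet> b)\<^sup>2)"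
      unfolding power2_norm_eq_inner by (subst euclidean_inner) (simp add: power2_eq_square)
    thus "ennreal (exp (- (norm z)\<^sup>2)) = (\<Prod>b\<in>Basis. ennreal (exp (- (z \<bullet> b)\<^sup>2)))"
      by (simp add: prod_ennreal exp_sum flip: sum_negf)
  qed
  also have "\<dots> = (\<Prod>b\<in>(Basis :: (complex^'n) set). \<integral>\<^sup>+x. ennreal (exp (- x\<^sup>2)) \<partial>lborel)"
    by (rule nn_integral_lborel_prod) auto
  also have "\<dots> = ennreal (sqrt pi ^ (CARD('n) * 2))"
    unfolding 1 by (simp add: ennreal_power)
  also have "sqrt pi ^ (CARD('n) * 2) = pi ^ CARD('n)"
    by (subst mult.commute) (simp add: power_mult)
  finally show ?thesis .
qed

lemma gauss_volume_normalized:
  "(\<integral>\<^sup>+z. ennreal (exp (- (norm (z::complex^'n))\<^sup>2)) \<partial>gauss_volume) = 1"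
proof -
  have "(\<integral>\<^sup>+z. ennreal (exp (- (norm (z::complex^'n))\<^sup>2)) \<partial>gauss_volume)
      = 1 / ennreal (pi ^ CARD('n)) * ennreal (pi ^ CARD('n))"
    unfolding gauss_volume_def
    by (subst nn_integral_scale_measure) (simp_all add: nn_integral_gauss)
  also have "\<dots> = 1"
    by (simp add: ennreal_divide_times ennreal_divide_self)
  finally show ?thesis .
qed

lemma homogeneous_poly_scale:
  assumes "homogeneous_poly k p"
  shows "p (t *s z) = t ^ k * p z"
proof -
  from assms obtain c where
    c: "\<And>z. p z = (\<Sum>m | (\<Sum>i\<in>UNIV. m i) = k. c m * (\<Prod>i\<in>UNIV. (z $ i) ^ m i))"
    unfolding homogeneous_poly_def by blast
  show ?thesis
    unfolding c sum_distrib_left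
  proof (rule sum.cong)
    fix m :: "'a \<Rightarrow> nat" assume "m \<in> {m. sum m UNIV = k}"
    hence "(\<Prod>i\<in>UNIV. t ^ m i) = t ^ k" by (simp flip: power_sum)
    thus "c m * (\<Prod>i\<in>UNIV. ((t *s z) $ i) ^ m i) = t ^ k * (c m * (\<Prod>i\<in>UNIV. (z $ i) ^ m i))"
      by (simp add: power_mult_distrib prod.distrib)
  qed simp
qed

lemma homogeneous_expansion_unique:
  assumes "is_homogeneous_expansion f F" "is_homogeneous_expansion f G"
  shows "F = G"
proof (intro ext)
  fix k z
  have *: "(\<lambda>k. H k z * t ^ k) sums f (t *s z)" if "is_homogeneous_expansion f H" for H t
  proof -
    have "(\<lambda>k. H k (t *s z)) sums f (t *s z)" "\<And>k. H k (t *s z) = t ^ k * H k z"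
      using that homogeneous_poly_scale unfolding is_homogeneous_expansion_def by blast+
    thus ?thesis by (simp add: mult.commute)
  qed
  define A where "A = Abs_fps (\<lambda>k. F k z - G k z)"
  have "(\<lambda>k. fps_nth A k * t ^ k) sums 0" for t
    using sums_diff[OF *[OF assms(1)] *[OF assms(2)], of t t] by (simp add: A_def algebra_simps)
  note A = this
  have "fps_conv_radius A \<ge> norm (1::complex)"
    unfolding fps_conv_radius_def by (rule conv_radius_geI) (use A sums_summable in blast)
  hence "fps_conv_radius A > 0"
    by (metis less_le_trans norm_one zero_less_one zero_ereal_def less_ereal.simps(1))
  moreover have "eval_fps A t = eval_fps 0 t" for t
    using A[of t] by (simp add: eval_fps_def sums_iff)
  ultimately have "A = 0"
    by (intro eval_fps_eqD) simp_all
  hence "fps_nth A k = 0" by simp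
  thus "F k z = G k z" by (simp add: A_def)
qed

end

theory Submission
  imports Defs "HOL-Complex_Analysis.Complex_Analysis"
begin

text \<open>
  Let \<open>\<sigma> = \<alpha> + \<beta> = 2 \<kappa>\<close>. On homogeneous polynomials of degree \<open>k\<close> the pairing is a positive multiple
  \<open>1 / \<mu>\<^sub>k\<close> of the Gaussian inner product, where \<open>\<mu>\<^sub>k = \<Gamma>(n + k) / \<Gamma>(n + k - \<kappa>)\<close> up to finitely many \<open>k\<close>, so
  \<open>Q\<^sub>z(w) = \<Sum>\<^sub>k \<mu>\<^sub>k <w, z>\<^sup>k / k!\<close> satisfies \<open>\<langle>Q\<^sub>z, g\<rangle>\<^sub>\<sigma> = cnj (g z)\<close>. Hence \<open>g z = cnj (L Q\<^sub>z)\<close> is the only candidate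
  to represent a functional \<open>L\<close>. No pointwise estimate of \<open>Q\<^sub>z\<close> is needed to place \<open>g\<close> in \<open>F\<^sub>\<alpha>\<^sup>1\<close>: restricted to a complex
  line, the multiplier \<open>\<mu>\<close> is a product of first-order operators \<open>k + c\<close> (Cauchy's estimate) and a Beta
  multiplier \<open>f \<mapsto> \<integral> t\<^sup>n\<^sup>-\<^sup>1 (1 - t)\<^sup>p\<^sup>-\<^sup>1 f(t z) dt\<close> (Laplace's method), so it maps functions of growth
  \<open>(1 + |z|)\<^sup>-\<^sup>\<alpha> exp (|z|\<^sup>2 / 2)\<close> to functions of growth \<open>(1 + |z|)\<^sup>\<beta> exp (|z|\<^sup>2 / 2)\<close>. A combination of the \<open>Q\<^sub>z\<close> is the image
  of the same combination of the kernels \<open>exp <w, z>\<close>, whose size is explicit: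
  \<open>|exp <w, z>| exp (- |w|\<^sup>2 / 2 - |z|\<^sup>2 / 2) = exp (- |w - z|\<^sup>2 / 2)\<close>.
\<close>

section \<open>Growth and multipliers of entire power series\<close>

text \<open>A squared component of degree k has a finite integral against |z|^(-2\<kappa>)
  exp(-|z|^2) only if n + k > \<kappa>, and the value is then a multiple of \<Gamma>(n + k -
  \<kappa>). This is why the pairing separates low from high degrees, and the quotient by the
  unweighted \<Gamma>(n + k) is the origin of \<mu>. As \<mu> grows like k^\<kappa> and degree k
  concentrates where |z|^2 is about k, the multiplier costs |z|^(2\<kappa>): exactly the passage
  from the exponent -\<alpha> to \<beta> = 2\<kappa> - \<alpha>. The obstacle is to show that the
  candidate g is integrable. A functional on a space of sup type is a priori given by a measure
  only, and projecting that measure would need weighted bounds for the kernels. Instead L is tested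
  on finite sums of kernels at sample points, with coefficients made of a phase, a cell volume and
  the weight of the norm of F^1; the norm of such a sum is a Riemann sum of shifted Gaussians.
  Vanishing at infinity enters where L is shown to be determined by the kernels: dilates f(r z)
  approximate f in norm because f is small outside a large ball.\<close>

definition Phi :: "real \<Rightarrow> real \<Rightarrow> real" where
  "Phi b r = (1 + r) powr b * exp (r\<^sup>2 / 2)"

lemma Phi_pos [simp]: "r \<ge> 0 \<Longrightarrow> Phi b r > 0"
  by (simp add: Phi_def)

lemma Phi_nonneg [simp]: "Phi b r \<ge> 0"
  by (simp add: Phi_def)

lemma one_plus_powr_le_exp:
  fixes r :: real assumes "r \<ge> 0" shows "(1 + r) powr A \<le> exp (\<bar>A\<bar> * r)"
proof -
  have "A * ln (1 + r) \<le> \<bar>A\<bar> * ln (1 + r)"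
    using assms by (intro mult_right_mono) auto
  also have "\<dots> \<le> \<bar>A\<bar> * r"
    using assms by (intro mult_left_mono ln_add_one_self_le_self) auto
  finally show ?thesis using assms by (simp add: powr_def)
qed

lemma linear_le_square:
  fixes c r \<epsilon> :: real assumes "\<epsilon> > 0"
  shows "c * r \<le> \<epsilon> * r\<^sup>2 + c\<^sup>2 / (4 * \<epsilon>)"
proof -
  have "0 \<le> (2 * \<epsilon> * r - c)\<^sup>2 / (4 * \<epsilon>)" using assms by simp
  also have "\<dots> = \<epsilon> * r\<^sup>2 - c * r + c\<^sup>2 / (4 * \<epsilon>)"
    using assms by (simp add: field_simps power2_eq_square)
  finally show ?thesis by simp
qed

text \<open>Polynomial and exponential factors are absorbed into an arbitrarily small part of a
  Gaussian. Below, \<epsilon> is the share of exp(r^2/2) that an estimate can afford to give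
  away.\<close>

lemma powr_exp_le_gauss:
  fixes r :: real
  assumes "r \<ge> 0" "\<epsilon> > 0"
  shows "(1 + r) powr A * exp (B * r) \<le> exp ((\<bar>A\<bar> + \<bar>B\<bar>)\<^sup>2 / (4 * \<epsilon>)) * exp (\<epsilon> * r\<^sup>2)"
proof -
  have "B * r \<le> \<bar>B\<bar> * r" using assms by (intro mult_right_mono) auto
  hence "(1 + r) powr A * exp (B * r) \<le> exp (\<bar>A\<bar> * r) * exp (\<bar>B\<bar> * r)"
    using assms one_plus_powr_le_exp by (intro mult_mono) auto
  also have "\<dots> = exp ((\<bar>A\<bar> + \<bar>B\<bar>) * r)" by (simp add: algebra_simps flip: exp_add)
  also have "\<dots> \<le> exp (\<epsilon> * r\<^sup>2 + (\<bar>A\<bar> + \<bar>B\<bar>)\<^sup>2 / (4 * \<epsilon>))"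
    using linear_le_square[OF assms(2)] by simp
  finally show ?thesis by (simp add: exp_add mult.commute)
qed

lemma powr_exp_le_Phi:
  "\<exists>C>0. \<forall>r\<ge>0::real. (1 + r) powr A * exp (B * r) \<le> C * Phi b r"
proof (intro exI conjI allI impI)
  let ?C = "exp ((\<bar>A - b\<bar> + \<bar>B\<bar>)\<^sup>2 / (4 * (1/2)))"
  fix r :: real assume r: "r \<ge> 0"
  have "(1 + r) powr A * exp (B * r) = (1 + r) powr b * ((1 + r) powr (A - b) * exp (B * r))"
    using r by (simp flip: powr_add mult.assoc)
  also have "\<dots> \<le> (1 + r) powr b * (?C * exp (1/2 * r\<^sup>2))"
    using r by (intro mult_left_mono powr_exp_le_gauss) auto
  finally show "(1 + r) powr A * exp (B * r) \<le> ?C * Phi b r" by (simp add: Phi_def mult_ac)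
qed auto

lemma power_le_Phi: "\<exists>C>0. \<forall>r\<ge>0. r ^ k \<le> C * Phi b r"
proof -
  obtain C where C: "C > 0" "\<forall>r\<ge>0. (1 + r) powr real k * exp (0 * r) \<le> C * Phi b r"
    using powr_exp_le_Phi by blast
  have "r ^ k \<le> C * Phi b r" if r: "r \<ge> 0" for r
  proof -
    have "r ^ k \<le> (1 + r) ^ k" using r by (intro power_mono) auto
    also have "\<dots> = (1 + r) powr real k" using r by (simp add: powr_realpow)
    finally show ?thesis using C(2) r by fastforce
  qed
  thus ?thesis using C(1) by blast
qed

text \<open>A Peetre type inequality: moving the base point of the weight costs only a power of the
  distance. It comes from 1 + x \<le> (1 + y)(1 + |x - y|); for negative b the roles of x and y are
  exchanged.\<close>

lemma one_plus_powr_moderate: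
  fixes x y :: real
  assumes "x \<ge> 0" "y \<ge> 0"
  shows "(1 + x) powr b \<le> (1 + y) powr b * (1 + \<bar>x - y\<bar>) powr \<bar>b\<bar>"
proof -
  have *: "1 + x \<le> (1 + y) * (1 + \<bar>x - y\<bar>)" if "x \<ge> 0" "y \<ge> 0" for x y :: real
  proof -
    have "1 + x \<le> 1 + y + \<bar>x - y\<bar>" by simp
    also have "\<dots> \<le> 1 + y + \<bar>x - y\<bar> + y * \<bar>x - y\<bar>" using that by simp
    finally show ?thesis by (simp add: algebra_simps)
  qed
  have pos: "(1 + x) powr c \<le> (1 + y) powr c * (1 + \<bar>x - y\<bar>) powr c"
    if "x \<ge> 0" "y \<ge> 0" "c \<ge> 0" for x y c :: real
    using powr_mono2[OF that(3) _ *[OF that(1,2)]] that by (simp add: powr_mult)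
  show ?thesis
  proof (cases "b \<ge> 0")
    case True thus ?thesis using pos assms by simp
  next
    case False
    hence "(1 + y) powr (-b) \<le> (1 + x) powr (-b) * (1 + \<bar>x - y\<bar>) powr (-b)"
      using pos[of y x "-b"] assms by (simp add: abs_minus_commute)
    hence "(1 + x) powr b * (1 + y) powr b * (1 + y) powr (-b)
        \<le> (1 + x) powr b * (1 + y) powr b * ((1 + x) powr (-b) * (1 + \<bar>x - y\<bar>) powr (-b))"
      by (intro mult_left_mono) auto
    also have "\<dots> = (1 + y) powr b * (1 + \<bar>x - y\<bar>) powr \<bar>b\<bar>"
      using assms False by (simp add: powr_minus field_simps)
    finally show ?thesis using assms by (simp add: powr_minus field_simps)
  qed
qed

text \<open>For negative b the function is not monotone. Moving the weight from x to y costs exp((x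
  - y)^2/2), and the Gaussian pays for it because x^2 + (x - y)^2 \<le> y^2 for 0 \<le> x \<le>
  y.\<close>

lemma Phi_mono_up_to:
  assumes "0 \<le> x" "x \<le> y"
  shows "Phi b x \<le> exp (b\<^sup>2 / 2) * Phi b y"
proof -
  have "Phi b x \<le> ((1 + y) powr b * (1 + \<bar>x - y\<bar>) powr \<bar>b\<bar>) * exp (x\<^sup>2 / 2)"
    unfolding Phi_def using assms by (intro mult_right_mono one_plus_powr_moderate) auto
  also have "(1 + \<bar>x - y\<bar>) powr \<bar>b\<bar> \<le> exp (b\<^sup>2 / 2) * exp ((x - y)\<^sup>2 / 2)"
    using powr_exp_le_gauss[of "\<bar>x - y\<bar>" "1/2" "\<bar>b\<bar>" 0] by simp
  also have "(1 + y) powr b * (exp (b\<^sup>2 / 2) * exp ((x - y)\<^sup>2 / 2)) * exp (x\<^sup>2 / 2)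
      = exp (b\<^sup>2 / 2) * ((1 + y) powr b * exp ((x - y)\<^sup>2 / 2 + x\<^sup>2 / 2))"
    by (simp add: exp_add mult_ac)
  also have "(x - y)\<^sup>2 / 2 + x\<^sup>2 / 2 \<le> y\<^sup>2 / 2"
  proof -
    have "x * x \<le> x * y" using assms by (intro mult_left_mono) auto
    thus ?thesis by (simp add: power2_eq_square field_simps)
  qed
  finally show ?thesis using assms by (simp add: Phi_def mult_left_mono mult_right_mono)
qed

text \<open>At distance 1/(1 + r) from r the exponent r^2/2 changes by at most 3/2. This is the
  radius on which Cauchy's estimate is applied below.\<close>

lemma Phi_near:
  assumes "x \<ge> 0" "r \<ge> 0" "\<bar>x - r\<bar> \<le> 1 / (1 + r)"
  shows "Phi b x \<le> 2 powr \<bar>b\<bar> * exp (3/2) * Phi b r"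
proof -
  let ?d = "1 / (1 + r)"
  have d: "?d \<le> 1" "r * ?d \<le> 1" "?d \<ge> 0" using assms by (auto simp: field_simps)
  have dd: "?d\<^sup>2 \<le> 1" using d(1,3) by (simp add: abs_square_le_1)
  have "x \<le> r + ?d" using assms(3) by linarith
  hence "x\<^sup>2 \<le> (r + ?d)\<^sup>2" using assms by (intro power_mono) auto
  also have "\<dots> = r\<^sup>2 + 2 * (r * ?d) + ?d\<^sup>2" by (simp only: power2_sum mult.assoc)
  also have "\<dots> \<le> r\<^sup>2 + 3" using d dd by linarith
  finally have "x\<^sup>2 / 2 \<le> 3/2 + r\<^sup>2 / 2" by simp
  hence 1: "exp (x\<^sup>2 / 2) \<le> exp (3/2) * exp (r\<^sup>2 / 2)" by (simp flip: exp_add)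
  have "(1 + x) powr b \<le> (1 + r) powr b * (1 + \<bar>x - r\<bar>) powr \<bar>b\<bar>"
    using assms by (intro one_plus_powr_moderate)
  also have "(1 + \<bar>x - r\<bar>) powr \<bar>b\<bar> \<le> 2 powr \<bar>b\<bar>"
    using assms(3) d by (intro powr_mono2) auto
  finally have "(1 + x) powr b \<le> (1 + r) powr b * 2 powr \<bar>b\<bar>" by (simp add: mult_left_mono)
  from mult_mono[OF this 1] show ?thesis by (simp add: Phi_def mult_ac)
qed

section \<open>Multipliers on one-variable entire functions of prescribed growth\<close>

text \<open>An entire function is represented by its coefficient sequence, with the sum function
  hidden in the existential, so that a multiplier is just pointwise multiplication of
  sequences.\<close>

definition grow :: "real \<Rightarrow> real \<Rightarrow> (nat \<Rightarrow> complex) \<Rightarrow> bool" where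
  "grow b M a \<longleftrightarrow>
     (\<exists>\<phi>. \<forall>\<zeta>. (\<lambda>k. a k * \<zeta> ^ k) sums \<phi> \<zeta> \<and> norm (\<phi> \<zeta>) \<le> M * Phi b (norm \<zeta>))"

lemma growI:
  "(\<And>\<zeta>. (\<lambda>k. a k * \<zeta> ^ k) sums \<phi> \<zeta>) \<Longrightarrow> (\<And>\<zeta>. norm (\<phi> \<zeta>) \<le> M * Phi b (norm \<zeta>)) \<Longrightarrow> grow b M a"
  unfolding grow_def by blast

lemma growE:
  assumes "grow b M a"
  obtains \<phi> where "\<And>\<zeta>. (\<lambda>k. a k * \<zeta> ^ k) sums \<phi> \<zeta>" "\<And>\<zeta>. norm (\<phi> \<zeta>) \<le> M * Phi b (norm \<zeta>)"
  using assms unfolding grow_def by blast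

lemma grow_nonneg: assumes "grow b M a" shows "M \<ge> 0"
proof -
  from assms obtain \<phi> :: "complex \<Rightarrow> complex" where "norm (\<phi> 0) \<le> M * Phi b (norm (0::complex))"
    by (elim growE) blast
  hence "0 \<le> M * Phi b 0" by (smt (verit) norm_ge_zero norm_zero)
  thus ?thesis by (simp add: Phi_def)
qed

lemma grow_add:
  assumes "grow b M a" "grow b N c" shows "grow b (M + N) (\<lambda>k. a k + c k)"
proof -
  from assms obtain \<phi> \<psi> where
    \<phi>: "\<And>\<zeta>. (\<lambda>k. a k * \<zeta> ^ k) sums \<phi> \<zeta>" "\<And>\<zeta>. norm (\<phi> \<zeta>) \<le> M * Phi b (norm \<zeta>)" and
    \<psi>: "\<And>\<zeta>. (\<lambda>k. c k * \<zeta> ^ k) sums \<psi> \<zeta>" "\<And>\<zeta>. norm (\<psi> \<zeta>) \<le> N * Phi b (norm \<zeta>)"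
    by (elim growE) blast
  show ?thesis
  proof (rule growI)
    show "(\<lambda>k. (a k + c k) * \<zeta> ^ k) sums (\<phi> \<zeta> + \<psi> \<zeta>)" for \<zeta>
      using sums_add[OF \<phi>(1) \<psi>(1)] by (simp add: algebra_simps)
    show "norm (\<phi> \<zeta> + \<psi> \<zeta>) \<le> (M + N) * Phi b (norm \<zeta>)" for \<zeta>
      using norm_triangle_le[OF add_mono[OF \<phi>(2) \<psi>(2)]] by (simp add: algebra_simps)
  qed
qed

lemma grow_cmult:
  assumes "grow b M a" shows "grow b (norm c * M) (\<lambda>k. c * a k)"
proof -
  from assms obtain \<phi> where
    \<phi>: "\<And>\<zeta>. (\<lambda>k. a k * \<zeta> ^ k) sums \<phi> \<zeta>" "\<And>\<zeta>. norm (\<phi> \<zeta>) \<le> M * Phi b (norm \<zeta>)"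
    by (elim growE) blast
  show ?thesis
  proof (rule growI)
    show "(\<lambda>k. (c * a k) * \<zeta> ^ k) sums (c * \<phi> \<zeta>)" for \<zeta>
      using sums_mult[OF \<phi>(1)] by (simp add: mult.assoc)
    show "norm (c * \<phi> \<zeta>) \<le> norm c * M * Phi b (norm \<zeta>)" for \<zeta>
      using mult_left_mono[OF \<phi>(2)] by (simp add: norm_mult mult.assoc)
  qed
qed

lemma grow_mono:
  assumes "grow b M a" "b \<le> b'" "M \<le> M'" shows "grow b' M' a"
proof -
  from assms obtain \<phi> where
    \<phi>: "\<And>\<zeta>. (\<lambda>k. a k * \<zeta> ^ k) sums \<phi> \<zeta>" "\<And>\<zeta>. norm (\<phi> \<zeta>) \<le> M * Phi b (norm \<zeta>)"
    by (elim growE) blast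
  have "M * Phi b (norm \<zeta>) \<le> M' * Phi b' (norm \<zeta>)" for \<zeta> :: complex
    using assms grow_nonneg[OF assms(1)] unfolding Phi_def
    by (intro mult_mono powr_mono) auto
  thus ?thesis using \<phi> by (intro growI[OF \<phi>(1)]) (meson order_trans)
qed

text \<open>Convergence at every point forces an infinite radius. The formula for the derivatives at
  0 shows that the sum determines the coefficients; all later identifications of homogeneous
  components rest on it.\<close>

lemma power_series_entire:
  assumes "\<And>\<zeta>::complex. (\<lambda>k. a k * \<zeta> ^ k) sums \<phi> \<zeta>"
  shows "\<phi> holomorphic_on UNIV" "(deriv ^^ k) \<phi> 0 = fact k * a k"
        "summable (\<lambda>k. norm (a k * \<zeta> ^ k))"
proof -
  have rad: "fps_conv_radius (Abs_fps a) = \<infinity>"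
  proof (rule ccontr)
    assume "fps_conv_radius (Abs_fps a) \<noteq> \<infinity>"
    then obtain R where R: "fps_conv_radius (Abs_fps a) < ereal R"
      by (metis PInfty_neq_ereal(1) ereal_dense2 ereal_infty_less(1) less_ereal.simps(2))
    moreover have "fps_conv_radius (Abs_fps a) \<ge> norm (of_real (max R 0) :: complex)"
      unfolding fps_conv_radius_def using sums_summable[OF assms[of "of_real (max R 0)"]]
      by (intro conv_radius_geI) simp
    ultimately show False
      by (smt (verit) ereal_less_eq(3) norm_of_real order_less_le_trans not_less)
  qed
  have \<phi>: "\<phi> = eval_fps (Abs_fps a)"
    using assms by (auto simp: eval_fps_def sums_iff)
  show "\<phi> holomorphic_on UNIV"
    unfolding \<phi> by (rule holomorphic_on_eval_fps) (auto simp: rad)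
  have "\<phi> has_fps_expansion Abs_fps a"
    unfolding \<phi> has_fps_expansion_def by (simp add: rad)
  from fps_nth_fps_expansion[OF this, of k] show "(deriv ^^ k) \<phi> 0 = fact k * a k"
    by simp
  show "summable (\<lambda>k. norm (a k * \<zeta> ^ k))"
    using abs_summable_in_conv_radius[of \<zeta> a] rad by (simp add: fps_conv_radius_def)
qed

lemma grow_coeff:
  assumes "grow b M a" "R > 0" shows "norm (a k) \<le> M * Phi b R / R ^ k"
proof -
  from assms obtain \<phi> where
    \<phi>: "\<And>\<zeta>. (\<lambda>k. a k * \<zeta> ^ k) sums \<phi> \<zeta>" "\<And>\<zeta>. norm (\<phi> \<zeta>) \<le> M * Phi b (norm \<zeta>)"
    by (elim growE) blast
  note hol = power_series_entire(1)[OF \<phi>(1)]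
  have "norm ((deriv ^^ k) \<phi> 0) \<le> fact k * (M * Phi b R) / R ^ k"
  proof (rule Cauchy_inequality)
    show "\<phi> holomorphic_on ball 0 R" "continuous_on (cball 0 R) \<phi>"
      using hol holomorphic_on_subset holomorphic_on_imp_continuous_on by blast+
    show "norm (\<phi> x) \<le> M * Phi b R" if "norm (0 - x) = R" for x
      using \<phi>(2)[of x] that by simp
  qed fact
  hence "fact k * norm (a k) \<le> fact k * (M * Phi b R / R ^ k)"
    by (simp add: power_series_entire(2)[OF \<phi>(1)] norm_mult)
  thus ?thesis by (subst (asm) mult_le_cancel_left_pos) auto
qed

lemma grow_single:
  "\<exists>C\<ge>0. \<forall>M a. grow b M a \<longrightarrow> grow b' (C * M) (\<lambda>j. if j = k then a j else 0)"
proof -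
  obtain C where C: "C > 0" "\<forall>r\<ge>0. r ^ k \<le> C * Phi b' r" using power_le_Phi by blast
  have "grow b' (C * Phi b 1 * M) (\<lambda>j. if j = k then a j else 0)" if g: "grow b M a" for M a
  proof (rule growI)
    show "(\<lambda>j. (if j = k then a j else 0) * \<zeta> ^ j) sums (a k * \<zeta> ^ k)" for \<zeta>
      using sums_single[of k "\<lambda>j. a j * \<zeta> ^ j"] by (simp add: if_distrib[of "\<lambda>x. x * _"] cong: if_cong)
    have a: "norm (a k) \<le> M * Phi b 1" using grow_coeff[OF g, of 1 k] by simp
    show "norm (a k * \<zeta> ^ k) \<le> C * Phi b 1 * M * Phi b' (norm \<zeta>)" for \<zeta>
    proof -
      have "norm (a k * \<zeta> ^ k) \<le> (M * Phi b 1) * (C * Phi b' (norm \<zeta>))"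
        unfolding norm_mult norm_power using a C grow_nonneg[OF g]
        by (intro mult_mono) auto
      thus ?thesis by (simp add: mult_ac)
    qed
  qed
  thus ?thesis using C(1) by (intro exI[of _ "C * Phi b 1"]) auto
qed

text \<open>The target exponent \<open>b'\<close> is arbitrary because a single monomial is bounded
  by a multiple of every \<open>Phi b'\<close>. A multiplier can therefore be altered in finitely
  many degrees at no cost in the exponent.\<close>

lemma grow_initial:
  "\<exists>C\<ge>0. \<forall>M a. grow b M a \<longrightarrow> grow b' (C * M) (\<lambda>j. if j < K then of_real (d j) * a j else 0)"
proof (induction K)
  case 0
  have "grow b' (0 * M) (\<lambda>j. 0)" for M
    by (rule growI[of _ "\<lambda>_. 0"]) auto
  thus ?case by (intro exI[of _ 0]) simp
next
  case (Suc K)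
  then obtain C where C: "C \<ge> 0"
    "\<And>M a. grow b M a \<Longrightarrow> grow b' (C * M) (\<lambda>j. if j < K then of_real (d j) * a j else 0)" by blast
  obtain D where D: "D \<ge> 0"
    "\<And>M a. grow b M a \<Longrightarrow> grow b' (D * M) (\<lambda>j. if j = K then a j else 0)" using grow_single by meson
  have "grow b' ((C + \<bar>d K\<bar> * D) * M) (\<lambda>j. if j < Suc K then of_real (d j) * a j else 0)"
    if "grow b M a" for M a
  proof -
    have "grow b' (C * M + norm (of_real (d K) :: complex) * (D * M))
      (\<lambda>j. (if j < K then of_real (d j) * a j else 0) + of_real (d K) * (if j = K then a j else 0))"
      by (intro grow_add grow_cmult C D that)
    moreover have "(\<lambda>j. (if j < K then of_real (d j) * a j else 0) + of_real (d K) * (if j = K then a j else 0))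
      = (\<lambda>j. if j < Suc K then of_real (d j) * a j else 0)" by (auto simp: fun_eq_iff less_Suc_eq)
    ultimately show ?thesis by (simp add: algebra_simps)
  qed
  thus ?case using C(1) D(1) by (intro exI[of _ "C + \<bar>d K\<bar> * D"]) auto
qed

text \<open>The factor k corresponds to \<zeta> \<phi>'(\<zeta>). Cauchy's estimate on a disc of
  radius 1/(1 + |\<zeta>|) loses one factor 1 + |\<zeta>| and the multiplication by \<zeta> another,
  hence the exponent b + 2.\<close>

lemma grow_linear_factor:
  fixes c :: real
  shows "\<exists>C\<ge>0. \<forall>M a. grow b M a \<longrightarrow> grow (b + 2) (C * M) (\<lambda>k. of_real (real k + c) * a k)"
proof (intro exI[of _ "2 powr \<bar>b\<bar> * exp (3/2) + \<bar>c\<bar>"] conjI allI impI)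
  let ?D = "2 powr \<bar>b\<bar> * exp (3/2)"
  fix M a assume g: "grow b M a"
  note M = grow_nonneg[OF g]
  from g obtain \<phi> where
    \<phi>: "\<And>\<zeta>. (\<lambda>k. a k * \<zeta> ^ k) sums \<phi> \<zeta>" "\<And>\<zeta>. norm (\<phi> \<zeta>) \<le> M * Phi b (norm \<zeta>)"
    by (elim growE) blast
  note hol = power_series_entire(1)[OF \<phi>(1)]
  have eq: "\<phi> = (\<lambda>x. \<Sum>n. a n * x ^ n)" using \<phi>(1) by (auto simp: sums_iff)
  have "grow (b + 2) (?D * M) (\<lambda>k. of_nat k * a k)"
  proof (rule growI)
    fix \<zeta> :: complex
    let ?r = "norm \<zeta>" and ?d = "1 / (1 + norm \<zeta>)"
    have d: "?d > 0" by (simp add: add_pos_nonneg)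
    have sm: "\<And>y. summable (\<lambda>n. a n * y ^ n)" using \<phi>(1) sums_summable by blast
    have "(\<phi> has_field_derivative (\<Sum>n. diffs a n * \<zeta> ^ n)) (at \<zeta>)"
      unfolding eq by (rule termdiffs_strong_converges_everywhere) (rule sm)
    hence der: "deriv \<phi> \<zeta> = (\<Sum>n. diffs a n * \<zeta> ^ n)" by (rule DERIV_imp_deriv)
    have "(\<lambda>n. of_nat n * a n * \<zeta> ^ (n - Suc 0)) sums deriv \<phi> \<zeta>"
      unfolding der by (intro diffs_equiv termdiff_converges_all sm)
    from sums_mult[OF this, of \<zeta>] have "(\<lambda>n. \<zeta> * (of_nat n * a n * \<zeta> ^ (n - Suc 0))) sums (\<zeta> * deriv \<phi> \<zeta>)" .
    moreover have "\<zeta> * (of_nat n * a n * \<zeta> ^ (n - Suc 0)) = of_nat n * a n * \<zeta> ^ n" for n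
      by (cases n) auto
    ultimately show "(\<lambda>k. of_nat k * a k * \<zeta> ^ k) sums (\<zeta> * deriv \<phi> \<zeta>)" by simp
    have "norm ((deriv ^^ 1) \<phi> \<zeta>) \<le> fact 1 * (M * (?D * Phi b ?r)) / ?d ^ 1"
    proof (rule Cauchy_inequality)
      show "\<phi> holomorphic_on ball \<zeta> ?d" "continuous_on (cball \<zeta> ?d) \<phi>"
        using hol holomorphic_on_subset holomorphic_on_imp_continuous_on by blast+
      show "norm (\<phi> x) \<le> M * (?D * Phi b ?r)" if "norm (\<zeta> - x) = ?d" for x
      proof -
        have "\<bar>norm x - ?r\<bar> \<le> ?d" using that norm_triangle_ineq3[of x \<zeta>] by (simp add: norm_minus_commute)
        hence "M * Phi b (norm x) \<le> M * (?D * Phi b ?r)"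
          using M by (intro mult_left_mono Phi_near) auto
        thus ?thesis using \<phi>(2)[of x] by linarith
      qed
    qed (rule d)
    hence "norm (deriv \<phi> \<zeta>) \<le> M * (?D * Phi b ?r) * (1 + ?r)" by simp
    hence "?r * norm (deriv \<phi> \<zeta>) \<le> (1 + ?r) * (M * (?D * Phi b ?r) * (1 + ?r))"
      using M by (intro mult_mono) auto
    also have "\<dots> = ?D * M * Phi (b + 2) ?r"
      by (simp add: Phi_def powr_add power2_eq_square mult_ac add_pos_nonneg powr_numeral)
    finally show "norm (\<zeta> * deriv \<phi> \<zeta>) \<le> ?D * M * Phi (b + 2) ?r" by (simp add: norm_mult)
  qed
  moreover have "grow (b + 2) (\<bar>c\<bar> * M) (\<lambda>k. of_real c * a k)"
    using grow_mono[OF grow_cmult[OF g, of "of_real c"], of "b + 2"] by simp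
  ultimately have "grow (b + 2) (?D * M + \<bar>c\<bar> * M) (\<lambda>k. of_nat k * a k + of_real c * a k)"
    by (rule grow_add)
  thus "grow (b + 2) ((?D + \<bar>c\<bar>) * M) (\<lambda>k. of_real (real k + c) * a k)"
    by (simp add: algebra_simps)
qed auto

lemma grow_pochhammer:
  fixes c :: real
  shows "\<exists>C\<ge>0. \<forall>M a. grow b M a \<longrightarrow>
    grow (b + 2 * real N) (C * M) (\<lambda>k. of_real (pochhammer (real k + c) N) * a k)"
proof (induction N)
  case 0
  show ?case by (intro exI[of _ 1]) simp
next
  case (Suc N)
  then obtain C where C: "C \<ge> 0" "\<And>M a. grow b M a \<Longrightarrow>
    grow (b + 2 * real N) (C * M) (\<lambda>k. of_real (pochhammer (real k + c) N) * a k)" by blast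
  obtain D where D: "D \<ge> 0" "\<And>M a. grow (b + 2 * real N) M a \<Longrightarrow>
    grow (b + 2 * real N + 2) (D * M) (\<lambda>k. of_real (real k + (c + real N)) * a k)"
    using grow_linear_factor by meson
  show ?case
  proof (intro exI[of _ "D * C"] conjI allI impI)
    show "D * C \<ge> 0" using C D by simp
    fix M a assume "grow b M a"
    from D(2)[OF C(2)[OF this]]
    show "grow (b + 2 * real (Suc N)) (D * C * M) (\<lambda>k. of_real (pochhammer (real k + c) (Suc N)) * a k)"
      by (simp add: pochhammer_Suc algebra_simps)
  qed
qed

section \<open>Gamma and Beta integrals and the Beta multiplier\<close>

lemma Gamma_scaled_nn_integral:
  assumes "p > 0" "c > (0::real)"
  shows "(\<integral>\<^sup>+u. ennreal (indicator {0..} u * u powr (p - 1) * exp (- c * u)) \<partial>lborel)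
    = ennreal (Gamma p / c powr p)"
proof -
  have "ennreal (Gamma p) = (\<integral>\<^sup>+t. ennreal (indicator {0..} t * t powr (p - 1) / exp t) \<partial>lborel)"
    using assms by (intro Gamma_conv_nn_integral_real) auto
  also have "\<dots> = c * (\<integral>\<^sup>+u. ennreal (indicator {0..} (c * u) * (c * u) powr (p - 1) / exp (c * u)) \<partial>lborel)"
    using assms by (subst nn_integral_real_affine[where c = c and t = 0]) auto
  also have "\<dots> = c * (\<integral>\<^sup>+u. ennreal (c powr (p - 1)) * ennreal (indicator {0..} u * u powr (p - 1) * exp (- c * u)) \<partial>lborel)"
    using assms by (intro arg_cong2[of _ _ _ _ "(*)"] nn_integral_cong refl)
      (auto simp: indicator_def zero_le_mult_iff powr_mult exp_minus field_simps simp flip: ennreal_mult)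
  also have "\<dots> = c * (ennreal (c powr (p - 1)) * (\<integral>\<^sup>+u. ennreal (indicator {0..} u * u powr (p - 1) * exp (- c * u)) \<partial>lborel))"
    by (subst nn_integral_cmult) auto
  also have "\<dots> = ennreal (c powr p) * (\<integral>\<^sup>+u. ennreal (indicator {0..} u * u powr (p - 1) * exp (- c * u)) \<partial>lborel)"
    using assms by (simp flip: mult.assoc ennreal_mult add: powr_mult_base)
  finally have *: "ennreal (Gamma p) = \<dots>" .
  have "ennreal (Gamma p / c powr p) = ennreal (Gamma p) * ennreal (1 / c powr p)"
    using assms by (subst ennreal_mult' [symmetric]) auto
  also have "\<dots> = ennreal (c powr p) * ennreal (1 / c powr p) * (\<integral>\<^sup>+u. ennreal (indicator {0..} u * u powr (p - 1) * exp (- c * u)) \<partial>lborel)"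
    unfolding * by (simp add: mult_ac)
  also have "ennreal (c powr p) * ennreal (1 / c powr p) = 1"
    using assms by (subst ennreal_mult' [symmetric]) auto
  finally show ?thesis by simp
qed

lemma Gamma_scaled_integral:
  assumes "p > 0" "c > (0::real)"
  shows "has_bochner_integral lborel (\<lambda>u. indicator {0..} u * u powr (p - 1) * exp (- c * u)) (Gamma p / c powr p)"
proof (rule has_bochner_integral_nn_integral)
  show "0 \<le> Gamma p / c powr p" using assms by (simp add: Gamma_real_nonneg)
qed (use Gamma_scaled_nn_integral[OF assms] in auto)

lemma Beta_moment_integral:
  assumes "a > 0" "p > (0::real)"
  shows "has_bochner_integral lborel
    (\<lambda>t. indicator {0<..<1} t * t powr (a - 1) * (1 - t) powr (p - 1) * t ^ k) (Beta (a + real k) p)"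
proof (rule has_bochner_integral_nn_integral)
  have "0 < Beta (a + real k) p" unfolding Beta_def using assms by (simp add: Gamma_real_pos)
  thus "0 \<le> Beta (a + real k) p" by simp
  have "(\<integral>\<^sup>+t. ennreal (indicator {0..1} t * (t powr (a + real k - 1) * (1 - t) powr (p - 1))) \<partial>lborel)
      = ennreal (Beta (a + real k) p)"
    using assms by (intro nn_integral_has_integral_lebesgue has_integral_Beta_real) auto
  also have "(\<integral>\<^sup>+t. ennreal (indicator {0..1} t * (t powr (a + real k - 1) * (1 - t) powr (p - 1))) \<partial>lborel)
    = (\<integral>\<^sup>+t. ennreal (indicator {0<..<1} t * t powr (a - 1) * (1 - t) powr (p - 1) * t ^ k) \<partial>lborel)"
  proof (rule nn_integral_cong_AE)
    have "AE t in lborel. t \<noteq> (0::real)" "AE t in lborel. t \<noteq> (1::real)"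
      by (auto intro!: AE_lborel_singleton)
    thus "AE t in lborel. ennreal (indicator {0..1} t * (t powr (a + real k - 1) * (1 - t) powr (p - 1)))
       = ennreal (indicator {0<..<1} t * t powr (a - 1) * (1 - t) powr (p - 1) * t ^ k)"
    proof eventually_elim
      case (elim t)
      have "t powr (a + real k - 1) = t powr (a - 1) * t ^ k" if "t > 0"
        using that by (simp flip: powr_realpow powr_add add: algebra_simps)
      thus ?case using elim by (auto simp: indicator_def)
    qed
  qed
  finally show "(\<integral>\<^sup>+t. ennreal (indicator {0<..<1} t * t powr (a - 1) * (1 - t) powr (p - 1) * t ^ k) \<partial>lborel)
    = ennreal (Beta (a + real k) p)" .
qed (use assms in \<open>auto simp: indicator_def\<close>)

text \<open>The pointwise input to Laplace's method at t = 1. With u = 1 - t, the exponent (t r)^2/2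
  equals r^2/2 - u r^2 + u^2 r^2/2. A further u^2 r^2/4 is spent on moving the polynomial weight
  from t r to r, and since u^2 \<le> u a decay of u r^2/4 remains.\<close>

lemma Phi_contract:
  fixes t r :: real assumes "0 < t" "t < 1" "r \<ge> 0"
  shows "Phi b (t * r) \<le> exp (b\<^sup>2 + 1/4) * Phi b r * exp (- ((1 + r\<^sup>2) / 4) * (1 - t))"
proof -
  define u where "u = 1 - t"
  have u: "0 < u" "u < 1" and t: "t = 1 - u" using assms by (auto simp: u_def)
  have "(1 + t * r) powr b \<le> (1 + r) powr b * (1 + \<bar>t * r - r\<bar>) powr \<bar>b\<bar>"
    using assms by (intro one_plus_powr_moderate) auto
  also have "\<bar>t * r - r\<bar> = u * r"
  proof -
    have "t * r - r = - (u * r)" by (simp add: t algebra_simps)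
    thus ?thesis using u assms by simp
  qed
  also have "(1 + u * r) powr \<bar>b\<bar> \<le> exp (b\<^sup>2) * exp (1/4 * (u * r)\<^sup>2)"
    using powr_exp_le_gauss[of "u * r" "1/4" "\<bar>b\<bar>" 0] u assms by simp
  finally have 1: "(1 + t * r) powr b \<le> (1 + r) powr b * (exp (b\<^sup>2) * exp (1/4 * (u * r)\<^sup>2))"
    by (simp add: mult_left_mono)
  have "u * u * r\<^sup>2 \<le> u * r\<^sup>2" using u by (intro mult_right_mono) auto
  moreover have "(t * r)\<^sup>2 / 2 = r\<^sup>2 / 2 - u * r\<^sup>2 + u * u * r\<^sup>2 / 2"
    by (simp add: t power2_eq_square field_simps)
  moreover have "(u * r)\<^sup>2 = u * u * r\<^sup>2" by (simp add: power2_eq_square)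
  ultimately have "(t * r)\<^sup>2 / 2 + 1/4 * (u * r)\<^sup>2 \<le> r\<^sup>2 / 2 - u * r\<^sup>2 / 4"
    by linarith
  \<comment> \<open>The constant 1/4 pays for raising the decay rate from r^2/4 to (1 + r^2)/4,
    which stays positive at r = 0.\<close>
  also have "\<dots> \<le> r\<^sup>2 / 2 + 1/4 - (1 + r\<^sup>2) / 4 * u" using u by (simp add: algebra_simps)
  finally have 2: "exp (1/4 * (u * r)\<^sup>2) * exp ((t * r)\<^sup>2 / 2)
      \<le> exp (r\<^sup>2 / 2) * exp (1/4) * exp (- ((1 + r\<^sup>2) / 4) * u)"
    by (simp flip: exp_add)
  have "Phi b (t * r) \<le> (1 + r) powr b * (exp (b\<^sup>2) * exp (1/4 * (u * r)\<^sup>2)) * exp ((t * r)\<^sup>2 / 2)"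
    unfolding Phi_def using 1 by (intro mult_right_mono) auto
  also have "\<dots> = (1 + r) powr b * exp (b\<^sup>2) * (exp (1/4 * (u * r)\<^sup>2) * exp ((t * r)\<^sup>2 / 2))"
    by (simp add: mult_ac)
  also have "\<dots> \<le> (1 + r) powr b * exp (b\<^sup>2) * (exp (r\<^sup>2 / 2) * exp (1/4) * exp (- ((1 + r\<^sup>2) / 4) * u))"
    by (intro mult_left_mono 2) auto
  finally show ?thesis by (simp add: Phi_def u_def exp_add mult_ac)
qed

text \<open>The Beta numbers are the moments of t^(n-1) (1-t)^(p-1), so the multiplier averages the
  values \<phi>(t \<zeta>). By \<open>Phi_contract\<close> only 1 - t of order 1/(1 + r^2) matters,
  where the weight has mass of order (1 + r^2)^(-p); this lowers the exponent by 2 p.\<close>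

lemma grow_Beta:
  assumes n: "n \<ge> (1::nat)" and p: "p > 0"
  shows "\<exists>C\<ge>0. \<forall>M a. grow b M a \<longrightarrow> grow (b - 2 * p) (C * M) (\<lambda>k. of_real (Beta (real (k + n)) p) * a k)"
proof (intro exI[of _ "exp (b\<^sup>2 + 1/4) * Gamma p * 8 powr p"] conjI allI impI)
  let ?C = "exp (b\<^sup>2 + 1/4) * Gamma p * 8 powr p"
  show "?C \<ge> 0" using p by (simp add: Gamma_real_nonneg)
  fix M a assume g: "grow b M a"
  note M = grow_nonneg[OF g]
  from g obtain \<phi> where
    \<phi>: "\<And>\<zeta>. (\<lambda>k. a k * \<zeta> ^ k) sums \<phi> \<zeta>" "\<And>\<zeta>. norm (\<phi> \<zeta>) \<le> M * Phi b (norm \<zeta>)"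
    by (elim growE) blast
  define w where "w = (\<lambda>t::real. indicator {0<..<1} t * t powr (real n - 1) * (1 - t) powr (p - 1))"
  have w0: "w t \<ge> 0" for t by (simp add: w_def indicator_def)
  have moment: "has_bochner_integral lborel (\<lambda>t. w t * t ^ k) (Beta (real (k + n)) p)" for k
    using Beta_moment_integral[of "real n" p k] n p by (simp add: w_def add.commute)
  have Bpos: "Beta (real (k + n)) p \<ge> 0" for k
    unfolding Beta_def using n p by (intro divide_nonneg_nonneg mult_nonneg_nonneg Gamma_real_nonneg) auto
  \<comment> \<open>The moments decrease in k since 0 < t < 1 on the support of w. Together with
    absolute convergence of the series of \<phi> this justifies summing under the integral.\<close>
  have Bdec: "Beta (real (k + n)) p \<le> Beta (real n) p" for k
  proof -
    have "(\<integral>t. w t * t ^ k \<partial>lborel) \<le> (\<integral>t. w t * t ^ 0 \<partial>lborel)"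
    proof (rule integral_mono)
      show "integrable lborel (\<lambda>t. w t * t ^ k)" "integrable lborel (\<lambda>t. w t * t ^ 0)"
        using moment[of k] moment[of 0] by (simp_all add: has_bochner_integral_iff)
    show "w t * t ^ k \<le> w t * t ^ 0" for t
      using w0[of t] by (cases "0 < t \<and> t < 1") (auto simp: w_def intro!: mult_left_le power_le_one)
    qed
    thus ?thesis using moment[of k] moment[of 0] by (simp add: has_bochner_integral_iff)
  qed
  show "grow (b - 2 * p) (?C * M) (\<lambda>k. of_real (Beta (real (k + n)) p) * a k)"
  proof (rule growI)
    fix \<zeta> :: complex
    define f where "f = (\<lambda>k t. complex_of_real (w t * t ^ k) * (a k * \<zeta> ^ k))"
    have mom: "has_bochner_integral lborel (f k) (of_real (Beta (real (k + n)) p) * (a k * \<zeta> ^ k))" for k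
      unfolding f_def by (intro has_bochner_integral_mult_left has_bochner_integral_of_real moment)
    have nmom: "has_bochner_integral lborel (\<lambda>t. norm (f k t)) (Beta (real (k + n)) p * norm (a k * \<zeta> ^ k))" for k
    proof -
      have "norm (f k t) = w t * t ^ k * norm (a k * \<zeta> ^ k)" for t
        using w0[of t] by (cases "t > 0") (auto simp: f_def norm_mult norm_power w_def)
      thus ?thesis using has_bochner_integral_mult_left[OF moment[of k], of "norm (a k * \<zeta> ^ k)"] by simp
    qed
    have fsum: "(\<lambda>k. f k t) sums (of_real (w t) * \<phi> (of_real t * \<zeta>))" for t
    proof -
      have "(\<lambda>k. of_real (w t) * (a k * (of_real t * \<zeta>) ^ k)) sums (of_real (w t) * \<phi> (of_real t * \<zeta>))"
        by (intro sums_mult \<phi>)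
      thus ?thesis by (simp add: f_def power_mult_distrib mult_ac)
    qed
    have s1: "AE t in lborel. summable (\<lambda>k. norm (f k t))"
    proof (rule AE_I2)
      fix t :: real
      have "summable (\<lambda>k. \<bar>w t\<bar> * norm (a k * (of_real t * \<zeta>) ^ k))"
        by (intro summable_mult power_series_entire(3)[OF \<phi>(1)])
      thus "summable (\<lambda>k. norm (f k t))" by (simp add: f_def norm_mult norm_power power_mult_distrib mult_ac abs_mult power_abs)
    qed
    have s2: "summable (\<lambda>k. \<integral>t. norm (f k t) \<partial>lborel)"
    proof (rule summable_comparison_test')
      show "summable (\<lambda>k. Beta (real n) p * norm (a k * \<zeta> ^ k))"
        by (intro summable_mult power_series_entire(3)[OF \<phi>(1)])
      show "norm (\<integral>t. norm (f k t) \<partial>lborel) \<le> Beta (real n) p * norm (a k * \<zeta> ^ k)" if "k \<ge> 0" for k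
        unfolding has_bochner_integral_integral_eq[OF nmom]
        using Bdec[of k] Bpos[of k] by (simp add: abs_mult mult_right_mono)
    qed
    have int: "integrable lborel (f k)" for k using mom by (auto simp: has_bochner_integral_iff)
    have Fi: "integrable lborel (\<lambda>t. of_real (w t) * \<phi> (of_real t * \<zeta>))"
      using integrable_suminf[OF int s1 s2] fsum by (simp add: sums_iff)
    have "(\<lambda>k. integral\<^sup>L lborel (f k)) sums (\<integral>t. of_real (w t) * \<phi> (of_real t * \<zeta>) \<partial>lborel)"
      using sums_integral[OF int s1 s2] fsum by (simp add: sums_iff)
    thus "(\<lambda>k. of_real (Beta (real (k + n)) p) * a k * \<zeta> ^ k) sums (\<integral>t. of_real (w t) * \<phi> (of_real t * \<zeta>) \<partial>lborel)"
      by (simp add: has_bochner_integral_integral_eq[OF mom] mult.assoc)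
    let ?r = "norm \<zeta>"
    let ?c = "(1 + ?r\<^sup>2) / 4"
    have c: "?c > 0" by (simp add: add_pos_nonneg)
    \<comment> \<open>Reflection of the Gamma integral under t \<mapsto> 1 - t.\<close>
    have "has_bochner_integral lborel
       (\<lambda>t. indicator {0..} (1 + -1 * t) * (1 + -1 * t) powr (p - 1) * exp (- ?c * (1 + -1 * t)))
       ((Gamma p / ?c powr p) /\<^sub>R \<bar>-1::real\<bar>)"
      by (subst lborel_has_bochner_integral_real_affine_iff[symmetric]) (use Gamma_scaled_integral[OF p c] in auto)
    hence G: "has_bochner_integral lborel
       (\<lambda>t. indicator {0..} (1 - t) * (1 - t) powr (p - 1) * exp (- ?c * (1 - t))) (Gamma p / ?c powr p)"
      by simp
    \<comment> \<open>The majorant lives on all t \<le> 1, not only on the unit interval, so that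
      its integral is a complete Gamma integral with a closed form.\<close>
    let ?G = "\<lambda>t. M * (exp (b\<^sup>2 + 1/4) * Phi b ?r) * (indicator {0..} (1 - t) * (1 - t) powr (p - 1) * exp (- ?c * (1 - t)))"
    have "norm (\<integral>t. of_real (w t) * \<phi> (of_real t * \<zeta>) \<partial>lborel) \<le> (\<integral>t. ?G t \<partial>lborel)"
    proof (rule Bochner_Integration.integral_norm_bound_integral[OF Fi])
      show "integrable lborel ?G" using G by (intro integrable_mult_right) (auto simp: has_bochner_integral_iff)
      fix t :: real
      show "norm (of_real (w t) * \<phi> (of_real t * \<zeta>)) \<le> ?G t"
      proof (cases "0 < t \<and> t < 1")
        case False
        hence "w t = 0" by (auto simp: w_def indicator_def)
        thus ?thesis using M by simp
      next
        case True
        have "norm (of_real (w t) * \<phi> (of_real t * \<zeta>)) \<le> w t * (M * Phi b (t * ?r))"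
          using True w0[of t] \<phi>(2)[of "of_real t * \<zeta>"] by (simp add: norm_mult mult_left_mono)
        also have "\<dots> \<le> (1 - t) powr (p - 1) * (M * (exp (b\<^sup>2 + 1/4) * Phi b ?r * exp (- ?c * (1 - t))))"
        proof (intro mult_mono mult_left_mono Phi_contract)
          have "t powr (real n - 1) \<le> 1" using True n by (intro powr_le1) auto
          thus "w t \<le> (1 - t) powr (p - 1)" using True by (simp add: w_def mult_left_le_one_le)
        qed (use True M in auto)
        finally show ?thesis using True by (simp add: mult_ac)
      qed
    qed
    also have "\<dots> = M * (exp (b\<^sup>2 + 1/4) * Phi b ?r) * (Gamma p / ?c powr p)"
      using G by (simp add: has_bochner_integral_iff)
    also have "\<dots> \<le> M * (exp (b\<^sup>2 + 1/4) * Phi b ?r) * (Gamma p * (8 powr p * (1 + ?r) powr (-2 * p)))"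
    proof (intro mult_left_mono)
      \<comment> \<open>From (1 + r)^2 \<le> 2 (1 + r^2); this is the origin of the factor
        \<open>8 powr p\<close>.\<close>
      have "(1 + ?r)\<^sup>2 / 8 \<le> ?c"
        using sum_squares_bound[of 1 ?r] by (simp add: power2_eq_square algebra_simps)
      hence "((1 + ?r)\<^sup>2 / 8) powr p \<le> ?c powr p" using p by (intro powr_mono2) auto
      hence "Gamma p / ?c powr p \<le> Gamma p / ((1 + ?r)\<^sup>2 / 8) powr p"
      proof (intro divide_left_mono mult_pos_pos)
        have "1 + ?r > 0" by (simp add: add_pos_nonneg)
        thus "0 < ((1 + ?r)\<^sup>2 / 8) powr p" by simp
        show "0 < ?c powr p" using c by (simp only: powr_gt_zero)
      qed (use p in \<open>auto simp: Gamma_real_nonneg\<close>)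
      also have "((1 + ?r)\<^sup>2 / 8) powr p = (1 + ?r) powr (2 * p) / 8 powr p"
        by (simp add: powr_divide flip: powr_powr powr_numeral)
      also have "Gamma p / \<dots> = Gamma p * (8 powr p * (1 + ?r) powr (-2 * p))"
        by (simp add: powr_minus field_simps)
      finally show "Gamma p / ?c powr p \<le> Gamma p * (8 powr p * (1 + ?r) powr (-2 * p))" .
    qed (use M in auto)
    also have "\<dots> = ?C * M * Phi (b - 2 * p) ?r"
      by (simp add: Phi_def powr_diff powr_minus field_simps)
    finally show "norm (\<integral>t. of_real (w t) * \<phi> (of_real t * \<zeta>) \<partial>lborel) \<le> ?C * M * Phi (b - 2 * p) ?r" .
  qed
qed

text \<open>\<open>1 / mu n K \<kappa> k\<close> is the ratio between the pairing and the Gaussian inner product in degree \<open>k\<close>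
  (see \<open>split_pairing_homogeneous\<close>); the degrees below \<open>K\<close> are paired without the weight.\<close>

definition mu :: "nat \<Rightarrow> nat \<Rightarrow> real \<Rightarrow> nat \<Rightarrow> real" where
  "mu n K \<kappa> k = (if k < K then 1 else Gamma (real (n + k)) / Gamma (real (n + k) - \<kappa>))"

lemma mu_pos:
  assumes "n \<ge> 1" "real (K + n) > \<kappa>"
  shows "mu n K \<kappa> k > 0"
  using assms by (auto simp: mu_def intro!: divide_pos_pos Gamma_real_pos)

text \<open>Both Gamma values are compared with \<Gamma>(n + k - \<kappa> + N): the rising factorial
  climbs to it from \<Gamma>(n + k - \<kappa>) in N unit steps, and the Beta function joins it to
  \<Gamma>(n + k). Its second parameter N - \<kappa> must be positive, whence the choice of
  N.\<close>

lemma mu_Beta_pochhammer: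
  assumes n: "n \<ge> 1" and K: "real (K + n) > \<kappa>" and N: "real N > \<kappa>" and k: "k \<ge> K"
  shows "mu n K \<kappa> k = Beta (real (k + n)) (real N - \<kappa>) * pochhammer (real k + (real n - \<kappa>)) N / Gamma (real N - \<kappa>)"
proof -
  let ?x = "real k + (real n - \<kappa>)"
  have x: "?x > 0" using K k by simp
  hence "?x \<notin> \<int>\<^sub>\<le>\<^sub>0" by (meson nonpos_Ints_nonpos not_le)
  hence 1: "pochhammer ?x N = Gamma (?x + real N) / Gamma ?x"
    using pochhammer_Gamma by blast
  have 2: "?x + real N = real (k + n) + (real N - \<kappa>)" "real (n + k) - \<kappa> = ?x" by simp_all
  have "Gamma (real (k + n) + (real N - \<kappa>)) > 0" "Gamma (real N - \<kappa>) > 0" "Gamma ?x > 0"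
    using n x N by (auto intro!: Gamma_real_pos)
  thus ?thesis using k unfolding mu_def Beta_def 1 2 by (simp add: add.commute)
qed

text \<open>The Beta multiplier lowers the exponent by 2 (N - \<kappa>) and the N linear factors
  raise it by 2 N, a net gain of 2 \<kappa> of either sign. In degrees below K the factorization
  does not apply; there the difference 1 - m is added as a finite correction.\<close>

lemma grow_mu:
  assumes n: "n \<ge> 1" and K: "real (K + n) > \<kappa>"
  shows "\<exists>C\<ge>0. \<forall>M a. grow b M a \<longrightarrow> grow (b + 2 * \<kappa>) (C * M) (\<lambda>k. of_real (mu n K \<kappa> k) * a k)"
proof -
  define N where "N = nat \<lceil>\<kappa>\<rceil> + 1"
  define p where "p = real N - \<kappa>"
  have N: "real N > \<kappa>" unfolding N_def by linarith
  hence p: "p > 0" by (simp add: p_def)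
  define m where "m = (\<lambda>k. Beta (real (k + n)) p * pochhammer (real k + (real n - \<kappa>)) N / Gamma p)"
  have mu_m: "mu n K \<kappa> k = m k" if "k \<ge> K" for k
    using mu_Beta_pochhammer[OF n K N that] by (simp add: m_def p_def)
  have b': "b + 2 * \<kappa> = b - 2 * p + 2 * real N" by (simp add: p_def)
  obtain C1 where C1: "C1 \<ge> 0" "\<And>M a. grow b M a \<Longrightarrow> grow (b - 2 * p) (C1 * M) (\<lambda>k. of_real (Beta (real (k + n)) p) * a k)"
    using grow_Beta[OF n p] by blast
  obtain C2 where C2: "C2 \<ge> 0" "\<And>M a. grow (b - 2 * p) M a \<Longrightarrow>
     grow (b + 2 * \<kappa>) (C2 * M) (\<lambda>k. of_real (pochhammer (real k + (real n - \<kappa>)) N) * a k)"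
    using grow_pochhammer[of "b - 2 * p" N] unfolding b' by blast
  obtain C3 where C3: "C3 \<ge> 0" "\<And>M a. grow b M a \<Longrightarrow>
     grow (b + 2 * \<kappa>) (C3 * M) (\<lambda>j. if j < K then of_real (1 - m j) * a j else 0)"
    using grow_initial[of b "b + 2 * \<kappa>" K "\<lambda>j. 1 - m j"] by blast
  let ?D = "norm (complex_of_real (1 / Gamma p))"
  show ?thesis
  proof (intro exI[of _ "?D * (C2 * C1) + C3"] conjI allI impI)
    show "?D * (C2 * C1) + C3 \<ge> 0" using C1 C2 C3 by simp
    fix M a assume g: "grow b M a"
    have "grow (b + 2 * \<kappa>) (?D * (C2 * (C1 * M)) + C3 * M)
      (\<lambda>k. of_real (1 / Gamma p) * (of_real (pochhammer (real k + (real n - \<kappa>)) N) * (of_real (Beta (real (k + n)) p) * a k))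
         + (if k < K then of_real (1 - m k) * a k else 0))"
      by (intro grow_add grow_cmult C1 C2 C3 g)
    moreover have "of_real (1 / Gamma p) * (of_real (pochhammer (real k + (real n - \<kappa>)) N) * (of_real (Beta (real (k + n)) p) * a k))
         + (if k < K then of_real (1 - m k) * a k else 0) = of_real (mu n K \<kappa> k) * a k" for k
    proof -
      have "of_real (1 / Gamma p) * (of_real (pochhammer (real k + (real n - \<kappa>)) N) * (of_real (Beta (real (k + n)) p) * a k))
         = of_real (m k) * a k" by (simp add: m_def)
      moreover have "mu n K \<kappa> k = (if k < K then 1 else m k)"
        using mu_m[of k] by (simp add: mu_def)
      ultimately show ?thesis by (simp add: algebra_simps)
    qed
    ultimately show "grow (b + 2 * \<kappa>) ((?D * (C2 * C1) + C3) * M) (\<lambda>k. of_real (mu n K \<kappa> k) * a k)"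
      by (simp add: algebra_simps)
  qed
qed

text \<open>The growth bound for \<open>grow_mu\<close> applied to a monomial and evaluated where
  \<open>r\<^sup>k exp (-r\<^sup>2/2)\<close> is maximal, namely at \<open>r = sqrt k\<close>, bounds the multiplier itself.\<close>

lemma mu_le_power2:
  assumes "n \<ge> 1" "real (K + n) > \<kappa>"
  shows "\<exists>C>0. \<forall>k. mu n K \<kappa> k \<le> C * 2 ^ k"
proof -
  obtain C where C: "C \<ge> 0" "\<And>M a. grow 0 M a \<Longrightarrow> grow (2 * \<kappa>) (C * M) (\<lambda>k. of_real (mu n K \<kappa> k) * a k)"
    using grow_mu[OF assms, of 0] by auto
  have bd: "mu n K \<kappa> k \<le> C * exp (2 * \<kappa>\<^sup>2) * 2 ^ k" if k: "k \<ge> 1" for k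
  proof -
    define R where "R = sqrt (real k)"
    have R: "R > 0" "R\<^sup>2 = real k" using k by (auto simp: R_def)
    define M where "M = R ^ k * exp (- real k / 2)"
    have le: "r ^ k \<le> M * exp (r\<^sup>2 / 2)" if r: "r \<ge> 0" for r
    proof (rule power2_le_imp_le)
      \<comment> \<open>The inequality x \<le> exp(x - 1) at x = r^2/k, raised to the power k, is
        the maximum property of r^k exp(-r^2/2) at r^2 = k.\<close>
      have "r\<^sup>2 / real k \<le> exp (r\<^sup>2 / real k - 1)" using exp_ge_add_one_self[of "r\<^sup>2 / real k - 1"] by simp
      hence "(r\<^sup>2 / real k) ^ k \<le> exp (r\<^sup>2 / real k - 1) ^ k" by (intro power_mono) auto
      also have "\<dots> = exp (r\<^sup>2 - real k)" using k by (simp add: algebra_simps flip: exp_of_nat_mult)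
      finally have "(r\<^sup>2) ^ k \<le> real k ^ k * exp (r\<^sup>2 - real k)"
        using k by (simp add: power_divide field_simps)
      thus "(r ^ k)\<^sup>2 \<le> (M * exp (r\<^sup>2 / 2))\<^sup>2"
        unfolding M_def power_mult_distrib exp_double[symmetric] power_even_eq[symmetric] R(2)[symmetric]
        by (simp add: power_mult mult.commute[of k] flip: power_mult exp_add exp_double)
           (simp add: exp_diff exp_minus field_simps R(2) power_mult)
      show "0 \<le> M * exp (r\<^sup>2 / 2)" using R by (simp add: M_def)
    qed
    have "grow 0 M (\<lambda>j. if j = k then 1 else 0)"
    proof (rule growI)
      show "(\<lambda>j. (if j = k then 1 else 0) * \<zeta> ^ j) sums (\<zeta> ^ k)" for \<zeta> :: complex
      proof -
        have "(\<lambda>j. (if j = k then 1 else 0) * \<zeta> ^ j) = (\<lambda>j. if j = k then \<zeta> ^ j else 0)" by (intro ext) auto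
        thus ?thesis using sums_single[of k "\<lambda>j. \<zeta> ^ j"] by simp
      qed
      show "norm (\<zeta> ^ k) \<le> M * Phi 0 (norm \<zeta>)" for \<zeta> :: complex
      proof -
        have "1 + norm \<zeta> \<noteq> 0" using norm_ge_zero[of \<zeta>] by linarith
        thus ?thesis using le[of "norm \<zeta>"] by (simp add: Phi_def norm_power)
      qed
    qed
    from grow_coeff[OF C(2)[OF this] R(1), of k]
    have "mu n K \<kappa> k \<le> C * M * Phi (2 * \<kappa>) R / R ^ k"
      using mu_pos[OF assms, of k] by simp
    also have "\<dots> = C * (1 + R) powr (2 * \<kappa>)" using R by (simp add: M_def Phi_def R(2) exp_minus field_simps)
    \<comment> \<open>The remaining polynomial factor is absorbed into exp(R^2/2) = exp(1/2)^k, and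
      exp(1/2) \<le> 2 yields the base 2.\<close>
    also have "(1 + R) powr (2 * \<kappa>) \<le> exp ((\<bar>2 * \<kappa>\<bar> + \<bar>0\<bar>)\<^sup>2 / (4 * (1/2))) * exp (1/2 * R\<^sup>2)"
      using powr_exp_le_gauss[of R "1/2" "2 * \<kappa>" 0] R by simp
    also have "\<dots> = exp (2 * \<kappa>\<^sup>2) * exp (1/2) ^ k" by (simp add: R(2) power_mult_distrib flip: exp_of_nat_mult)
    also have "exp (1/2 :: real) ^ k \<le> 2 ^ k"
    proof (rule power_mono)
      have "(exp (1/2 :: real))\<^sup>2 \<le> 2\<^sup>2" using exp_le by (simp flip: exp_double)
      thus "exp (1/2 :: real) \<le> 2" by (rule power2_le_imp_le) simp
    qed simp
    finally show ?thesis using C(1) by (simp add: mult_left_mono mult.assoc)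
  qed
  show ?thesis
  proof (intro exI[of _ "C * exp (2 * \<kappa>\<^sup>2) + mu n K \<kappa> 0"] conjI allI)
    show "C * exp (2 * \<kappa>\<^sup>2) + mu n K \<kappa> 0 > 0" using C(1) mu_pos[OF assms, of 0] by (simp add: add_nonneg_pos)
    show "mu n K \<kappa> k \<le> (C * exp (2 * \<kappa>\<^sup>2) + mu n K \<kappa> 0) * 2 ^ k" for k
    proof (cases "k = 0")
      case True thus ?thesis using C(1) by simp
    next
      case False
      have "mu n K \<kappa> 0 * 2 ^ k \<ge> 0" using mu_pos[OF assms, of 0] by simp
      with bd[of k] False show ?thesis by (simp add: distrib_right)
    qed
  qed
qed

lemma power_fact_le_exp: assumes "x \<ge> 0" shows "x ^ k / fact k \<le> exp (x::real)"
proof -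
  have "(\<lambda>k. x ^ k / fact k) sums exp x" using exp_converges[of x] by (simp add: field_simps)
  moreover have "sum (\<lambda>k. x ^ k / fact k) {k} \<le> (\<Sum>k. x ^ k / fact k)"
    using calculation assms by (intro sum_le_suminf) (auto simp: sums_iff)
  ultimately show ?thesis by (simp add: sums_iff)
qed

text \<open>The exponential series modified by the multiplier; the kernel \<open>Q_z\<close> is this
  function of <w, z>.\<close>

definition Psi :: "nat \<Rightarrow> nat \<Rightarrow> real \<Rightarrow> complex \<Rightarrow> complex" where
  "Psi n K \<kappa> x = (\<Sum>k. of_real (mu n K \<kappa> k) / fact k * x ^ k)"

text \<open>Writing 2^k = (1/2)^k 4^k leaves a geometric factor for the summation over k, uniform in
  x, while 4^k goes into exp(4 |x|). Finite exponential type is all that is asked of the kernels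
  individually.\<close>

lemma Psi_term_bound:
  assumes "n \<ge> 1" "real (K + n) > \<kappa>"
  shows "\<exists>C>0. \<forall>k x. norm (of_real (mu n K \<kappa> k) / fact k * x ^ k :: complex) \<le> C * (1/2) ^ k * exp (4 * norm x)"
proof -
  obtain C where C: "C > 0" "\<And>k. mu n K \<kappa> k \<le> C * 2 ^ k" using mu_le_power2[OF assms] by blast
  have "norm (of_real (mu n K \<kappa> k) / fact k * x ^ k :: complex) \<le> C * (1/2) ^ k * exp (4 * norm x)" for k x
  proof -
    have "norm (of_real (mu n K \<kappa> k) / fact k * x ^ k :: complex) = mu n K \<kappa> k * (norm x ^ k / fact k)"
      using mu_pos[OF assms, of k] by (simp add: norm_mult norm_divide norm_power)
    also have "\<dots> \<le> C * 2 ^ k * (norm x ^ k / fact k)" by (intro mult_right_mono C) auto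
    also have "\<dots> = C * (1/2) ^ k * ((4 * norm x) ^ k / fact k)"
    proof -
      have "(2::real) ^ k = (1/2) ^ k * 4 ^ k" by (simp flip: power_mult_distrib)
      thus ?thesis by (simp add: power_mult_distrib)
    qed
    also have "\<dots> \<le> C * (1/2) ^ k * exp (4 * norm x)"
      using C(1) by (intro mult_left_mono power_fact_le_exp) auto
    finally show ?thesis .
  qed
  thus ?thesis using C(1) by blast
qed

lemma Psi_sums:
  assumes "n \<ge> 1" "real (K + n) > \<kappa>"
  shows "(\<lambda>k. of_real (mu n K \<kappa> k) / fact k * x ^ k) sums Psi n K \<kappa> x"
proof -
  obtain C where C: "C > 0" "\<And>k x. norm (of_real (mu n K \<kappa> k) / fact k * x ^ k :: complex) \<le> C * (1/2) ^ k * exp (4 * norm x)"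
    using Psi_term_bound[OF assms] by blast
  have "summable (\<lambda>k. C * (1/2) ^ k * exp (4 * norm x))"
    by (intro summable_mult2 summable_mult summable_geometric) simp
  from summable_comparison_test'[OF this C(2)] show ?thesis
    unfolding Psi_def by (simp add: summable_sums)
qed

lemma Psi_holomorphic:
  assumes "n \<ge> 1" "real (K + n) > \<kappa>"
  shows "Psi n K \<kappa> holomorphic_on A"
  using power_series_entire(1)[OF Psi_sums[OF assms]] by (rule holomorphic_on_subset) simp

lemma Psi_bound:
  assumes "n \<ge> 1" "real (K + n) > \<kappa>"
  shows "\<exists>C>0. \<forall>x. norm (Psi n K \<kappa> x) \<le> C * exp (4 * norm x)"
proof -
  obtain C where C: "C > 0" "\<And>k x. norm (of_real (mu n K \<kappa> k) / fact k * x ^ k :: complex) \<le> C * (1/2) ^ k * exp (4 * norm x)"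
    using Psi_term_bound[OF assms] by blast
  have "norm (Psi n K \<kappa> x) \<le> C * 2 * exp (4 * norm x)" for x
  proof -
    have s: "(\<lambda>k. C * (1/2) ^ k * exp (4 * norm x)) sums (C * (1 / (1 - 1/2)) * exp (4 * norm x))"
      by (intro sums_mult2 sums_mult geometric_sums) simp
    have "norm (Psi n K \<kappa> x) \<le> (\<Sum>k. C * (1/2) ^ k * exp (4 * norm x))"
      unfolding Psi_def by (intro norm_suminf_le C(2)) (use s in \<open>simp add: sums_iff\<close>)
    thus ?thesis using s by (simp add: sums_iff)
  qed
  thus ?thesis using C(1) by (intro exI[of _ "C * 2"]) auto
qed

section \<open>Entire functions on \<open>\<complex>\<^sup>n\<close> and invariance of the volume\<close>

definition hip :: "complex^'n \<Rightarrow> complex^'n \<Rightarrow> complex" where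
  "hip z w = (\<Sum>i\<in>UNIV. z $ i * cnj (w $ i))"

lemma hip_add_left: "hip (z + w) v = hip z v + hip w v"
  by (simp add: hip_def distrib_right sum.distrib)

lemma hip_add_right: "hip v (z + w) = hip v z + hip v w"
  by (simp add: hip_def distrib_left sum.distrib)

lemma hip_smult_left: "hip (c *s z) w = c * hip z w"
  by (simp add: hip_def sum_distrib_left mult.assoc)

lemma hip_smult_right: "hip z (c *s w) = cnj c * hip z w"
  by (simp add: hip_def sum_distrib_left mult_ac)

lemma cnj_hip: "cnj (hip z w) = hip w z"
  by (simp add: hip_def mult.commute)

lemma Re_hip: "Re (hip z w) = z \<bullet> w"
  by (simp add: hip_def inner_vec_def inner_complex_def)

lemma norm_hip_le: "norm (hip z w) \<le> norm z * norm w"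
proof -
  have "norm (hip z w) \<le> (\<Sum>i\<in>UNIV. \<bar>norm (z $ i)\<bar> * \<bar>norm (w $ i)\<bar>)"
    unfolding hip_def by (rule order_trans[OF norm_sum]) (simp add: norm_mult)
  also have "\<dots> \<le> L2_set (\<lambda>i. norm (z $ i)) UNIV * L2_set (\<lambda>i. norm (w $ i)) UNIV"
    by (rule L2_set_mult_ineq)
  finally show ?thesis by (simp add: norm_vec_def)
qed

lemma norm_smult_complex: "norm (c *s z) = norm c * norm (z :: complex^'n)"
  by (simp add: norm_vec_def norm_mult L2_set_right_distrib)

lemma scaleR_eq_smult: "r *\<^sub>R z = complex_of_real r *s (z :: complex^'n)"
  by (simp add: vec_eq_iff) (simp add: scaleR_conv_of_real)

lemma bounded_linear_hip: "bounded_linear (\<lambda>z. hip z w)"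
proof (rule bounded_linear_intro)
  show "norm (hip z w) \<le> norm z * norm w" for z by (rule norm_hip_le)
qed (simp_all add: hip_add_left scaleR_eq_smult hip_smult_left scaleR_conv_of_real)

lemma hip_zero_left [simp]: "hip 0 w = 0"
  by (simp add: hip_def)

lemma entireI:
  assumes "\<And>z. (f has_derivative D z) (at z)" "\<And>z c v. D z (c *s v) = c * D z v"
  shows "entire f"
  using assms unfolding entire_def by blast

lemma entireE:
  assumes "entire f"
  obtains D where "\<And>z. (f has_derivative D z) (at z)" "\<And>z c v. D z (c *s v) = c * D z v"
  using assms unfolding entire_def by metis

lemma entire_const: "entire (\<lambda>z. c)"
  by (rule entireI[of _ "\<lambda>_ _. 0"]) auto

lemma entire_hip: "entire (\<lambda>z. hip z w)"
  by (rule entireI[OF bounded_linear_imp_has_derivative[OF bounded_linear_hip]])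
     (simp add: hip_smult_left)

lemma entire_nth: "entire (\<lambda>z. z $ i)"
  by (rule entireI[OF bounded_linear_imp_has_derivative[OF bounded_linear_vec_nth]]) simp

lemma entire_add: assumes "entire f" "entire g" shows "entire (\<lambda>z. f z + g z)"
proof -
  from assms obtain D E where
    "\<And>z. (f has_derivative D z) (at z)" "\<And>z c v. D z (c *s v) = c * D z v"
    "\<And>z. (g has_derivative E z) (at z)" "\<And>z c v. E z (c *s v) = c * E z v"
    by (elim entireE) blast
  thus ?thesis by (intro entireI[of _ "\<lambda>z v. D z v + E z v"] has_derivative_add)
      (auto simp: distrib_left)
qed

lemma entire_mult: assumes "entire f" "entire g" shows "entire (\<lambda>z. f z * g z)"
proof -
  from assms obtain D E where
    "\<And>z. (f has_derivative D z) (at z)" "\<And>z c v. D z (c *s v) = c * D z v"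
    "\<And>z. (g has_derivative E z) (at z)" "\<And>z c v. E z (c *s v) = c * E z v"
    by (elim entireE) blast
  thus ?thesis by (intro entireI[of _ "\<lambda>z v. f z * E z v + D z v * g z"] has_derivative_mult)
      (auto simp: algebra_simps)
qed

lemma entire_cmult: "entire f \<Longrightarrow> entire (\<lambda>z. c * f z)"
  by (intro entire_mult entire_const)

lemma entire_diff: assumes "entire f" "entire g" shows "entire (\<lambda>z. f z - g z)"
  using entire_add[OF assms(1) entire_cmult[OF assms(2), of "-1"]] by simp

lemma entire_sum: "(\<And>i. i \<in> I \<Longrightarrow> entire (f i)) \<Longrightarrow> entire (\<lambda>z. \<Sum>i\<in>I. f i z)"
  by (induction I rule: infinite_finite_induct) (auto intro: entire_const entire_add)

lemma entire_prod: "(\<And>i. i \<in> I \<Longrightarrow> entire (f i)) \<Longrightarrow> entire (\<lambda>z. \<Prod>i\<in>I. f i z)"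
  by (induction I rule: infinite_finite_induct) (auto intro: entire_const entire_mult)

lemma entire_power: "entire f \<Longrightarrow> entire (\<lambda>z. f z ^ k)"
  by (induction k) (auto intro: entire_const entire_mult)

lemma entire_compose: assumes "\<Psi> holomorphic_on UNIV" "entire f" shows "entire (\<lambda>z. \<Psi> (f z))"
proof -
  from assms obtain D where D:
    "\<And>z. (f has_derivative D z) (at z)" "\<And>z c v. D z (c *s v) = c * D z v"
    by (elim entireE) blast
  have "(\<Psi> has_derivative (*) (deriv \<Psi> x)) (at x)" for x
    using assms(1) by (simp add: holomorphic_derivI flip: has_field_derivative_def)
  hence "((\<lambda>z. \<Psi> (f z)) has_derivative (\<lambda>v. deriv \<Psi> (f z) * D z v)) (at z)" for z
    using has_derivative_compose[OF D(1)] by fastforce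
  thus ?thesis by (rule entireI) (simp add: D(2))
qed

lemma entire_affine:
  fixes f :: "complex^'n \<Rightarrow> complex"
  assumes "entire f" shows "entire (\<lambda>z. f (c *s z + a))"
proof -
  from assms obtain D where D:
    "\<And>z. (f has_derivative D z) (at z)" "\<And>z c v. D z (c *s v) = c * D z v"
    by (elim entireE) blast
  have "bounded_linear (\<lambda>z::complex^'n. c *s z)"
    by (rule bounded_linear_intro[of _ "norm c"])
       (auto simp: norm_smult_complex vec_eq_iff algebra_simps)
  hence "((\<lambda>z. c *s z + a) has_derivative (\<lambda>v. c *s v)) (at z)" for z :: "complex^'n"
    by (intro has_derivative_add_const bounded_linear_imp_has_derivative)
  hence "((\<lambda>z. f (c *s z + a)) has_derivative (\<lambda>v. D (c *s z + a) (c *s v))) (at z)" for z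
    using has_derivative_compose[OF _ D(1)] by fastforce
  thus ?thesis by (rule entireI) (simp add: D(2))
qed

lemma entire_smult: "entire f \<Longrightarrow> entire (\<lambda>z. f (c *s z))"
  using entire_affine[of f c 0] by simp

lemma entire_translate: "entire f \<Longrightarrow> entire (\<lambda>z. f (z + a))"
  using entire_affine[of f 1 a] by simp

lemma entire_continuous: "entire f \<Longrightarrow> continuous_on A f"
  by (elim entireE) (meson continuous_at_imp_continuous_on has_derivative_continuous)

lemma entire_borel [measurable_dest]: "entire f \<Longrightarrow> f \<in> borel_measurable borel"
  by (intro borel_measurable_continuous_onI entire_continuous)

lemma entire_line: assumes "entire f" shows "(\<lambda>t. f (t *s z)) holomorphic_on A"
proof -
  from assms obtain D where D:
    "\<And>z. (f has_derivative D z) (at z)" "\<And>z c v. D z (c *s v) = c * D z v"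
    by (elim entireE) blast
  have "bounded_linear (\<lambda>t. t *s z)"
    by (rule bounded_linear_intro[of _ "norm z"])
       (auto simp: norm_smult_complex vec_eq_iff algebra_simps)
  hence "((\<lambda>t. t *s z) has_derivative (\<lambda>v. v *s z)) (at t)" for t
    by (rule bounded_linear_imp_has_derivative)
  hence "((\<lambda>t. f (t *s z)) has_derivative (\<lambda>v. D (t *s z) (v *s z))) (at t)" for t
    using has_derivative_compose[OF _ D(1)] by fastforce
  hence "((\<lambda>t. f (t *s z)) has_field_derivative D (t *s z) z) (at t)" for t
  proof -
    have "(\<lambda>v. v * D (t *s z) z) = (*) (D (t *s z) z)" by (simp add: fun_eq_iff mult.commute)
    thus ?thesis using \<open>\<And>t. ((\<lambda>t. f (t *s z)) has_derivative (\<lambda>v. D (t *s z) (v *s z))) (at t)\<close>[of t]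
      unfolding has_field_derivative_def D(2) by simp
  qed
  thus ?thesis by (meson DERIV_subset UNIV_I holomorphic_onI field_differentiable_def has_field_derivative_at_within)
qed

section \<open>Homogeneous components along complex lines\<close>

text \<open>The component of degree k is read off from the one-variable function t \<mapsto> f(t z),
  so no power series in several variables is needed. That it is a polynomial in z is obtained later
  from an integral formula.\<close>

definition taylor_part :: "(complex^'n \<Rightarrow> complex) \<Rightarrow> nat \<Rightarrow> complex^'n \<Rightarrow> complex" where
  "taylor_part f k z = (deriv ^^ k) (\<lambda>t. f (t *s z)) 0 / fact k"

lemma taylor_part_sums:
  assumes "entire f" shows "(\<lambda>k. taylor_part f k z * t ^ k) sums f (t *s z)"
proof -
  have "(\<lambda>n. (deriv ^^ n) (\<lambda>t. f (t *s z)) 0 / fact n * (t - 0) ^ n) sums f (t *s z)"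
    by (rule holomorphic_power_series[of "\<lambda>t. f (t *s z)" 0 "norm t + 1"])
       (auto intro: entire_line[OF assms] simp: dist_norm)
  thus ?thesis by (simp add: taylor_part_def)
qed

lemma taylor_part_sums_self:
  assumes "entire f" shows "(\<lambda>k. taylor_part f k z) sums f z"
  using taylor_part_sums[OF assms, of z 1] by simp

text \<open>Identities between components are proved by exhibiting a convergent series in t; nothing
  has to be differentiated.\<close>

lemma taylor_part_unique:
  assumes "\<And>t. (\<lambda>k. a k * t ^ k) sums f (t *s z)"
  shows "taylor_part f k z = a k"
  unfolding taylor_part_def power_series_entire(2)[of a "\<lambda>t. f (t *s z)", OF assms] by simp

lemma taylor_part_smult:
  assumes "entire f" shows "taylor_part f k (c *s z) = c ^ k * taylor_part f k z"
proof (rule taylor_part_unique)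
  show "(\<lambda>k. c ^ k * taylor_part f k z * t ^ k) sums f (t *s (c *s z))" for t
    using taylor_part_sums[OF assms, of z "t * c"] by (simp add: power_mult_distrib mult_ac)
qed

lemma taylor_part_add:
  assumes "entire f" "entire g"
  shows "taylor_part (\<lambda>z. f z + g z) k z = taylor_part f k z + taylor_part g k z"
  by (rule taylor_part_unique)
     (use sums_add[OF taylor_part_sums[OF assms(1)] taylor_part_sums[OF assms(2)]] in \<open>simp add: distrib_right\<close>)

lemma taylor_part_cmult:
  assumes "entire f"
  shows "taylor_part (\<lambda>z. c * f z) k z = c * taylor_part f k z"
  by (rule taylor_part_unique)
     (use sums_mult[OF taylor_part_sums[OF assms]] in \<open>simp add: mult.assoc\<close>)

lemma taylor_part_0: "taylor_part f 0 z = f 0"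
  by (simp add: taylor_part_def)

lemma taylor_part_homogeneous:
  assumes "\<And>t z. p (t *s z) = t ^ k * p z"
  shows "taylor_part p j z = (if j = k then p z else 0)"
proof (rule taylor_part_unique)
  fix t :: complex
  have "(\<lambda>j. (if j = k then p z else 0) * t ^ j) = (\<lambda>j. if j = k then t ^ j * p z else 0)" by auto
  thus "(\<lambda>j. (if j = k then p z else 0) * t ^ j) sums p (t *s z)"
    using sums_single[of k "\<lambda>j. t ^ j * p z"] by (simp add: assms)
qed

lemma taylor_part_Cauchy:
  assumes "entire f" "R > 0" "\<And>t. norm t = R \<Longrightarrow> norm (f (t *s z)) \<le> B"
  shows "norm (taylor_part f k z) \<le> B / R ^ k"
proof -
  have "norm ((deriv ^^ k) (\<lambda>t. f (t *s z)) 0) \<le> fact k * B / R ^ k"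
    using assms by (intro Cauchy_inequality entire_line)
       (auto intro!: holomorphic_on_imp_continuous_on entire_line)
  hence "fact k * norm (taylor_part f k z) \<le> fact k * (B / R ^ k)"
    by (simp add: taylor_part_def norm_divide)
  thus ?thesis by (subst (asm) mult_le_cancel_left_pos) auto
qed

section \<open>Invariance of Lebesgue measure under unimodular scalars\<close>

text \<open>Separating real from imaginary parts turns multiplication by a complex scalar into a
  planar linear map acting on two copies of \<open>real^'n\<close>, to which shears and Fubini
  apply.\<close>

definition complex_vec :: "(real^'n) \<times> (real^'n) \<Rightarrow> complex^'n" where
  "complex_vec p = (\<chi> i. Complex (fst p $ i) (snd p $ i))"

lemma complex_vec_inner:
  "complex_vec p \<bullet> z = p \<bullet> ((\<chi> i. Re (z $ i)), (\<chi> i. Im (z $ i)))"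
  by (cases p) (simp add: complex_vec_def inner_vec_def inner_complex_def sum.distrib)

lemma complex_vec_inner_complex_vec: "complex_vec p \<bullet> complex_vec q = p \<bullet> q"
  by (subst complex_vec_inner) (cases q, simp add: complex_vec_def)

lemma complex_vec_measurable [measurable]:
  "(complex_vec :: (real^'n) \<times> (real^'n) \<Rightarrow> complex^'n) \<in> borel_measurable borel"
proof (rule borel_measurable_continuous_onI)
  have "continuous_on UNIV (\<lambda>p. Complex ((fst p :: real^'n) $ i) ((snd p :: real^'n) $ i))" for i
    unfolding Complex_eq by (intro continuous_intros)
  thus "continuous_on UNIV (complex_vec :: (real^'n) \<times> (real^'n) \<Rightarrow> _)"
    unfolding complex_vec_def[abs_def] by (intro continuous_intros)
qed

lemma complex_vec_Basis: "complex_vec ` (Basis :: ((real^'n) \<times> (real^'n)) set) = Basis"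
proof -
  have 1: "complex_vec (axis i 1, 0) = axis i 1" "complex_vec (0, axis i 1) = axis i \<i>" for i :: 'n
    by (auto simp: complex_vec_def axis_def vec_eq_iff complex_eq_iff)
  have "(Basis :: ((real^'n) \<times> (real^'n)) set) = (\<Union>i. {(axis i 1, 0), (0, axis i 1)})"
    unfolding Basis_prod_def Basis_vec_def by auto
  moreover have "complex_vec ` (\<Union>i::'n. {(axis i 1, 0), (0, axis i 1)}) = (\<Union>i. {axis i 1, axis i \<i>})"
    by (simp add: image_UN 1)
  ultimately have "complex_vec ` (Basis :: ((real^'n) \<times> (real^'n)) set) = (\<Union>i. {axis i 1, axis i \<i>})"
    by simp
  also have "\<dots> = Basis"
    unfolding Basis_vec_def Basis_complex_def by auto
  finally show ?thesis .
qed

lemma inj_complex_vec: "inj complex_vec"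
  by (auto simp: inj_def complex_vec_def vec_eq_iff complex_eq_iff prod_eq_iff)

text \<open>The standard basis is mapped bijectively onto the standard basis, so boxes pull back to
  boxes with the same side lengths.\<close>

lemma distr_complex_vec: "distr lborel borel (complex_vec :: _ \<Rightarrow> complex^'n) = lborel"
proof (rule lborel_eqI[symmetric])
  fix l u :: "complex^'n"
  assume lu: "\<And>b. b \<in> Basis \<Longrightarrow> l \<bullet> b \<le> u \<bullet> b"
  let ?R = "\<lambda>z::complex^'n. ((\<chi> i. Re (z $ i)), (\<chi> i. Im (z $ i)))"
  have R: "z \<bullet> complex_vec p = ?R z \<bullet> p" for z p
    by (metis complex_vec_inner inner_commute)
  have "complex_vec -` box l u = box (?R l) (?R u)"
    unfolding box_def complex_vec_Basis[symmetric] ball_simps vimage_Collect_eq complex_vec_inner_complex_vec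
    unfolding R ..
  hence "emeasure (distr lborel borel complex_vec) (box l u) = emeasure lborel (box (?R l) (?R u))"
    by (subst emeasure_distr) auto
  also have "\<dots> = (\<Prod>b\<in>Basis. (?R u - ?R l) \<bullet> b)"
    using lu by (intro emeasure_lborel_box) (simp flip: complex_vec_Basis R)
  also have "(\<Prod>b\<in>Basis. (?R u - ?R l) \<bullet> b) = (\<Prod>b\<in>Basis. (u - l) \<bullet> complex_vec b)"
  proof (rule prod.cong)
    have "?R (u - l) = ?R u - ?R l" by (simp add: vec_eq_iff prod_eq_iff)
    thus "(?R u - ?R l) \<bullet> b = (u - l) \<bullet> complex_vec b" for b using R[of "u - l" b] by simp
  qed simp
  also have "\<dots> = (\<Prod>b\<in>Basis. (u - l) \<bullet> b)"
    unfolding complex_vec_Basis[symmetric]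
    by (subst prod.reindex) (use inj_complex_vec in \<open>auto intro: inj_on_subset\<close>)
  finally show "emeasure (distr lborel borel complex_vec) (box l u) = ennreal (\<Prod>b\<in>Basis. (u - l) \<bullet> b)"
    by simp
qed simp

lemma emeasure_lborel_translate:
  fixes c :: "'a::euclidean_space"
  assumes "B \<in> sets borel"
  shows "emeasure lborel ((\<lambda>x. x + c) -` B) = emeasure lborel B"
proof -
  have "emeasure lborel B = emeasure (distr lborel borel ((+) c)) B" by (simp add: lborel_distr_plus)
  also have "\<dots> = emeasure lborel ((+) c -` B)" using assms by (subst emeasure_distr) simp_all
  also have "(+) c = (\<lambda>x. x + c)" by (simp add: fun_eq_iff add.commute)
  finally show ?thesis by simp
qed

text \<open>For fixed y the shear is a translation in x, so by Fubini every horizontal slice keeps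
  its measure.\<close>

lemma distr_shear_fst:
  "distr lborel borel (\<lambda>(x, y). (x + a *\<^sub>R y, y)) = (lborel :: ((real^'n) \<times> (real^'n)) measure)"
    (is "distr lborel borel ?T = _")
proof (rule measure_eqI)
  fix A :: "((real^'n) \<times> (real^'n)) set"
  assume "A \<in> sets (distr lborel borel ?T)"
  hence A: "A \<in> sets borel" by simp
  have T: "?T \<in> borel_measurable borel"
    unfolding split_def by (intro borel_measurable_continuous_onI continuous_intros)
  have m: "?T -` A \<in> sets borel" using measurable_sets[OF T A] by simp
  have pair: "emeasure lborel B = (\<integral>\<^sup>+y. emeasure lborel ((\<lambda>x. (x, y)) -` B) \<partial>lborel)"
    if "B \<in> sets borel" for B :: "((real^'n) \<times> (real^'n)) set"
    using lborel_pair.emeasure_pair_measure_alt2[of B] that by (simp only: lborel_prod sets_lborel)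
  have s: "(\<lambda>x. (x, y)) -` A \<in> sets borel" for y
    by (intro measurable_sets_borel[OF _ A] borel_measurable_continuous_onI continuous_intros)
  have "emeasure (distr lborel borel ?T) A = emeasure lborel (?T -` A)"
    using T A by (subst emeasure_distr) simp_all
  also have "\<dots> = (\<integral>\<^sup>+y. emeasure lborel ((\<lambda>x. x + a *\<^sub>R y) -` ((\<lambda>x. (x, y)) -` A)) \<partial>lborel)"
    unfolding pair[OF m] by (simp add: vimage_def)
  also have "\<dots> = emeasure lborel A"
    unfolding emeasure_lborel_translate[OF s] pair[OF A] ..
  finally show "emeasure (distr lborel borel ?T) A = emeasure lborel A" .
qed simp

lemma distr_shear_snd:
  "distr lborel borel (\<lambda>(x, y). (x, y + a *\<^sub>R x)) = (lborel :: ((real^'n) \<times> (real^'n)) measure)"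
    (is "distr lborel borel ?T = _")
proof (rule measure_eqI)
  fix A :: "((real^'n) \<times> (real^'n)) set"
  assume "A \<in> sets (distr lborel borel ?T)"
  hence A: "A \<in> sets borel" by simp
  have T: "?T \<in> borel_measurable borel"
    unfolding split_def by (intro borel_measurable_continuous_onI continuous_intros)
  have m: "?T -` A \<in> sets borel" using measurable_sets[OF T A] by simp
  have pair: "emeasure lborel B = (\<integral>\<^sup>+x. emeasure lborel (Pair x -` B) \<partial>lborel)"
    if "B \<in> sets borel" for B :: "((real^'n) \<times> (real^'n)) set"
    using lborel.emeasure_pair_measure_alt[of B lborel] that by (simp only: lborel_prod sets_lborel)
  have s: "Pair x -` A \<in> sets borel" for x
    by (intro measurable_sets_borel[OF _ A] borel_measurable_continuous_onI continuous_intros)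
  have "emeasure (distr lborel borel ?T) A = emeasure lborel (?T -` A)"
    using T A by (subst emeasure_distr) simp_all
  also have "\<dots> = (\<integral>\<^sup>+x. emeasure lborel ((\<lambda>y. y + a *\<^sub>R x) -` (Pair x -` A)) \<partial>lborel)"
    unfolding pair[OF m] by (simp add: vimage_def)
  also have "\<dots> = emeasure lborel A"
    unfolding emeasure_lborel_translate[OF s] pair[OF A] ..
  finally show "emeasure (distr lborel borel ?T) A = emeasure lborel A" .
qed simp

lemma smult_measurable [measurable]: "(\<lambda>z. c *s z) \<in> borel_measurable (borel :: (complex^'n) measure)"
proof (rule borel_measurable_continuous_onI)
  have "bounded_linear (\<lambda>z::complex^'n. c *s z)"
    by (rule bounded_linear_intro[of _ "norm c"])
       (auto simp: norm_smult_complex vec_eq_iff algebra_simps)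
  thus "continuous_on UNIV (\<lambda>z::complex^'n. c *s z)"
    by (rule linear_continuous_on)
qed

text \<open>A rotation of the plane by an angle with nonzero sine is a product of three shears.\<close>

lemma distr_lborel_rotation:
  assumes "norm \<omega> = 1"
  shows "distr lborel borel (\<lambda>z. \<omega> *s z) = (lborel :: (complex^'n) measure)"
proof -
  have comp: "distr lborel borel (\<lambda>z. (c * d) *s z) = (lborel :: (complex^'n) measure)"
    if "distr lborel borel (\<lambda>z. c *s z) = (lborel :: (complex^'n) measure)"
       "distr lborel borel (\<lambda>z. d *s z) = (lborel :: (complex^'n) measure)" for c d
  proof -
    have "distr lborel borel (\<lambda>z. (c * d) *s z)
       = distr (distr lborel borel (\<lambda>z. d *s z)) borel (\<lambda>z::complex^'n. c *s z)"
      by (subst distr_distr) (auto simp: comp_def)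
    thus ?thesis by (simp add: that)
  qed
  have main: "distr lborel borel (\<lambda>z. \<omega> *s z) = (lborel :: (complex^'n) measure)"
    if w: "norm \<omega> = 1" and s: "Im \<omega> \<noteq> 0" for \<omega>
  proof -
    \<comment> \<open>With \<omega> = exp(i \<theta>) this is -tan(\<theta>/2), the coefficient of
      the two outer shears; the middle one has coefficient sin \<theta>.\<close>
    define a where "a = (Re \<omega> - 1) / Im \<omega>"
    define F where "F = (\<lambda>(x::real^'n, y::real^'n). (x + a *\<^sub>R y, y))"
    define G where "G = (\<lambda>(x::real^'n, y::real^'n). (x, y + Im \<omega> *\<^sub>R x))"
    have [measurable]: "F \<in> borel_measurable borel" "G \<in> borel_measurable borel"
      unfolding F_def G_def by (auto intro!: borel_measurable_continuous_onI continuous_intros simp: split_def)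
    have cs: "Re \<omega> ^ 2 + Im \<omega> ^ 2 = 1" using w by (metis cmod_power2 one_power2)
    have as: "a * Im \<omega> = Re \<omega> - 1" using s by (simp add: a_def)
    have ac: "a + a * Re \<omega> = - Im \<omega>"
    proof -
      have "(a + a * Re \<omega>) * Im \<omega> = (a * Im \<omega>) * (1 + Re \<omega>)" by (simp add: algebra_simps)
      also have "\<dots> = - Im \<omega> * Im \<omega>" unfolding as using cs by (simp add: algebra_simps power2_eq_square)
      finally show ?thesis using s mult_right_cancel by blast
    qed
    have eq: "\<omega> *s complex_vec p = complex_vec (F (G (F p)))" for p
    proof -
      obtain x y where p: "p = (x, y)" by (cases p)
      have "Re \<omega> * u - Im \<omega> * v = u + a * v + a * (v + Im \<omega> * (u + a * v))"
           "Re \<omega> * v + Im \<omega> * u = v + Im \<omega> * (u + a * v)" for u v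
      proof -
        have "v + Im \<omega> * (u + a * v) = v + Im \<omega> * u + (a * Im \<omega>) * v" by (simp add: algebra_simps)
        thus 1: "Re \<omega> * v + Im \<omega> * u = v + Im \<omega> * (u + a * v)" unfolding as by (simp add: algebra_simps)
        have "u + a * v + a * (Re \<omega> * v + Im \<omega> * u) = u + (a * Im \<omega>) * u + (a + a * Re \<omega>) * v" by (simp add: algebra_simps)
        thus "Re \<omega> * u - Im \<omega> * v = u + a * v + a * (v + Im \<omega> * (u + a * v))"
          unfolding 1[symmetric] as ac by (simp add: algebra_simps)
      qed
      thus ?thesis by (simp add: p F_def G_def complex_vec_def vec_eq_iff complex_eq_iff)
    qed
    have "distr lborel borel (\<lambda>z. \<omega> *s z) = distr (distr lborel borel complex_vec) borel (\<lambda>z::complex^'n. \<omega> *s z)"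
      by (simp add: distr_complex_vec)
    also have "\<dots> = distr lborel borel (\<lambda>p. complex_vec (F (G (F p))))"
      by (subst distr_distr) (auto simp: comp_def eq)
    also have "\<dots> = distr (distr (distr (distr lborel borel F) borel G) borel F) borel complex_vec"
      by (simp add: distr_distr comp_def)
    also have "\<dots> = lborel"
      unfolding F_def G_def by (simp add: distr_complex_vec distr_shear_fst distr_shear_snd)
    finally show ?thesis .
  qed
  show ?thesis
  proof (cases "Im \<omega> = 0")
    case False thus ?thesis using main assms by simp
  next
    \<comment> \<open>Here \<omega> is 1 or -1. It factors as (\<omega>/i) i, and both factors have
      nonzero imaginary part.\<close>
    case True
    hence "norm (\<omega> / \<i>) = 1" "Im (\<omega> / \<i>) \<noteq> 0"
      using assms by (auto simp: norm_divide cmod_def)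
    from comp[OF main[OF this] main[of \<i>]]
    have "distr lborel borel (\<lambda>z. (\<omega> / \<i> * \<i>) *s z) = (lborel :: (complex^'n) measure)" by simp
    moreover have "\<omega> / \<i> * \<i> = \<omega>" by (simp add: complex_eq_iff)
    ultimately show ?thesis by (simp only:)
  qed
qed

section \<open>Transformation rules and Gaussian integrability for the normalized volume\<close>

lemma sets_gauss_volume [simp, measurable_cong]: "sets (gauss_volume :: (complex^'n) measure) = sets borel"
  by (simp add: gauss_volume_def)

lemma space_gauss_volume [simp]: "space (gauss_volume :: (complex^'n) measure) = UNIV"
  by (simp add: gauss_volume_def space_scale_measure)

lemma nn_integral_gauss_volume:
  fixes f :: "complex^'n \<Rightarrow> ennreal"
  assumes "f \<in> borel_measurable borel"
  shows "(\<integral>\<^sup>+z. f z \<partial>gauss_volume) = ennreal (1 / pi ^ CARD('n)) * (\<integral>\<^sup>+z. f z \<partial>lborel)"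
proof -
  have "1 / ennreal (pi ^ CARD('n)) = ennreal (1 / pi ^ CARD('n))"
    using divide_ennreal[of 1 "pi ^ CARD('n)"] by simp
  thus ?thesis unfolding gauss_volume_def nn_integral_gauss
    using assms by (subst nn_integral_scale_measure) auto
qed

lemma distr_gauss_volume:
  fixes T :: "complex^'n \<Rightarrow> complex^'n"
  assumes [measurable]: "T \<in> borel_measurable borel" and T: "distr lborel borel T = lborel"
  shows "distr gauss_volume borel T = gauss_volume"
proof (rule measure_eqI)
  fix A assume "A \<in> sets (distr gauss_volume borel T)"
  hence A [measurable]: "A \<in> sets borel" by simp
  have "emeasure (distr gauss_volume borel T) A = (\<integral>\<^sup>+z. indicator A (T z) \<partial>gauss_volume)"
    by (subst nn_integral_indicator[symmetric], simp) (subst nn_integral_distr, auto)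
  also have "\<dots> = ennreal (1 / pi ^ CARD('n)) * (\<integral>\<^sup>+z. indicator A z \<partial>distr lborel borel T)"
    by (subst nn_integral_gauss_volume) (auto simp: nn_integral_distr simp del: nn_integral_indicator)
  also have "\<dots> = emeasure gauss_volume A"
    unfolding T by (subst nn_integral_gauss_volume[symmetric]) auto
  finally show "emeasure (distr gauss_volume borel T) A = emeasure gauss_volume A" .
qed simp

lemma gauss_volume_rotation:
  "norm \<omega> = 1 \<Longrightarrow> distr gauss_volume borel (\<lambda>z. \<omega> *s z) = (gauss_volume :: (complex^'n) measure)"
  by (intro distr_gauss_volume distr_lborel_rotation) auto

lemma gauss_volume_translation:
  "distr gauss_volume borel (\<lambda>z. z + a) = (gauss_volume :: (complex^'n) measure)"
  by (intro distr_gauss_volume) (auto simp: lborel_distr_plus add.commute[of _ a])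

lemma integral_gauss_rotation:
  fixes f :: "complex^'n \<Rightarrow> complex"
  assumes "norm \<omega> = 1" "f \<in> borel_measurable borel"
  shows "(\<integral>z. f (\<omega> *s z) \<partial>gauss_volume) = (\<integral>z. f z \<partial>gauss_volume)"
proof -
  have "(\<integral>z. f z \<partial>gauss_volume) = (\<integral>z. f z \<partial>distr gauss_volume borel (\<lambda>z. \<omega> *s z))"
    by (simp add: gauss_volume_rotation assms)
  also have "\<dots> = (\<integral>z. f (\<omega> *s z) \<partial>gauss_volume)"
    using assms by (subst integral_distr) auto
  finally show ?thesis by simp
qed

lemma integral_gauss_translate:
  fixes f :: "complex^'n \<Rightarrow> 'b::{banach, second_countable_topology}"
  assumes "f \<in> borel_measurable borel"
  shows "(\<integral>z. f (z + a) \<partial>gauss_volume) = (\<integral>z. f z \<partial>gauss_volume)"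
proof -
  have "(\<integral>z. f z \<partial>gauss_volume) = (\<integral>z. f z \<partial>distr gauss_volume borel (\<lambda>z. z + a))"
    by (simp add: gauss_volume_translation)
  also have "\<dots> = (\<integral>z. f (z + a) \<partial>gauss_volume)"
    using assms by (subst integral_distr) auto
  finally show ?thesis by simp
qed

lemma integrable_gauss_translate:
  fixes f :: "complex^'n \<Rightarrow> 'b::{banach, second_countable_topology}"
  assumes "integrable gauss_volume f"
  shows "integrable gauss_volume (\<lambda>z. f (z + a))"
proof -
  have "integrable (distr gauss_volume borel (\<lambda>z. z + a)) f" by (simp add: gauss_volume_translation assms)
  moreover have "f \<in> borel_measurable borel" using borel_measurable_integrable[OF assms] by simp
  ultimately show ?thesis by (subst (asm) integrable_distr_eq) auto
qed

lemma nn_integral_gauss_scale: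
  fixes f :: "complex^'n \<Rightarrow> ennreal"
  assumes [measurable]: "f \<in> borel_measurable borel" and t: "t > 0"
  shows "(\<integral>\<^sup>+z. f z \<partial>gauss_volume) = ennreal (t ^ (2 * CARD('n))) * (\<integral>\<^sup>+z. f (t *\<^sub>R z) \<partial>gauss_volume)"
proof -
  have "(\<integral>\<^sup>+z. f z \<partial>lborel)
      = (\<integral>\<^sup>+z. f z \<partial>density (distr lborel borel (\<lambda>x::complex^'n. 0 + t *\<^sub>R x)) (\<lambda>_. ennreal (\<bar>t\<bar> ^ DIM(complex^'n))))"
    using t by (subst lborel_affine[of t 0]) (auto simp: ennreal_power)
  also have "\<dots> = ennreal (t ^ (2 * CARD('n))) * (\<integral>\<^sup>+z. f (t *\<^sub>R z) \<partial>lborel)"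
    using t by (subst nn_integral_density) (auto simp: nn_integral_distr nn_integral_cmult mult.commute[of _ 2])
  finally show ?thesis by (simp add: nn_integral_gauss_volume mult_ac)
qed

lemma emeasure_gauss_cball: "emeasure gauss_volume (cball (a::complex^'n) r) < \<infinity>"
proof -
  have "emeasure gauss_volume (cball a r) = ennreal (1 / pi ^ CARD('n)) * emeasure lborel (cball a r)"
    using nn_integral_gauss_volume[OF borel_measurable_indicator, of "cball a r"] by simp
  also have "\<dots> < \<infinity>"
    using emeasure_lborel_cball_finite[of a r] by (simp add: ennreal_mult_less_top)
  finally show ?thesis .
qed

lemma gauss_volume_sigma_finite: "sigma_finite_measure (gauss_volume :: (complex^'n) measure)"
proof -
  let ?A = "\<lambda>k::nat. cball (0::complex^'n) (real k)"
  have "emeasure gauss_volume (?A k) \<noteq> \<infinity>" for k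
    using emeasure_gauss_cball[of "0::complex^'n" "real k"] by simp
  moreover have "\<Union>(range ?A) = UNIV" using real_arch_simple by (auto simp: dist_norm)
  ultimately show ?thesis
    by unfold_locales (intro exI[of _ "range ?A"], auto)
qed

lemma gaussian_integrable:
  assumes "\<epsilon> > 0" shows "integrable gauss_volume (\<lambda>z::complex^'n. exp (- \<epsilon> * (norm z)\<^sup>2))"
proof (rule integrableI_nonneg)
  let ?t = "sqrt \<epsilon>"
  have "1 = (\<integral>\<^sup>+z. ennreal (exp (- (norm (z::complex^'n))\<^sup>2)) \<partial>gauss_volume)"
    by (simp add: gauss_volume_normalized)
  also have "\<dots> = ennreal (?t ^ (2 * CARD('n))) * (\<integral>\<^sup>+z. ennreal (exp (- (norm (?t *\<^sub>R (z::complex^'n)))\<^sup>2)) \<partial>gauss_volume)"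
    using assms by (intro nn_integral_gauss_scale) auto
  also have "(\<integral>\<^sup>+z. ennreal (exp (- (norm (?t *\<^sub>R (z::complex^'n)))\<^sup>2)) \<partial>gauss_volume)
     = (\<integral>\<^sup>+z. ennreal (exp (- \<epsilon> * (norm (z::complex^'n))\<^sup>2)) \<partial>gauss_volume)"
    using assms by (simp add: power_mult_distrib)
  finally have "ennreal (?t ^ (2 * CARD('n))) * (\<integral>\<^sup>+z. ennreal (exp (- \<epsilon> * (norm (z::complex^'n))\<^sup>2)) \<partial>gauss_volume) = 1"
    by simp
  hence "(\<integral>\<^sup>+z. ennreal (exp (- \<epsilon> * (norm (z::complex^'n))\<^sup>2)) \<partial>gauss_volume) \<noteq> \<infinity>"
    using assms by (auto simp: ennreal_mult_top)
  thus "(\<integral>\<^sup>+z. ennreal (exp (- \<epsilon> * (norm (z::complex^'n))\<^sup>2)) \<partial>gauss_volume) < \<infinity>"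
    by (simp add: less_top)
qed auto

lemma gauss_weight_integrable:
  assumes "\<epsilon> > 0"
  shows "integrable gauss_volume (\<lambda>z::complex^'n. (1 + norm z) powr A * exp (B * norm z) * exp (- \<epsilon> * (norm z)\<^sup>2))"
proof (rule Bochner_Integration.integrable_bound)
  let ?C = "exp ((\<bar>A\<bar> + \<bar>B\<bar>)\<^sup>2 / (4 * (\<epsilon> / 2)))"
  show "integrable gauss_volume (\<lambda>z::complex^'n. ?C * exp (- (\<epsilon> / 2) * (norm z)\<^sup>2))"
    using assms by (intro integrable_mult_right gaussian_integrable) auto
  show "AE z in gauss_volume. norm ((1 + norm z) powr A * exp (B * norm z) * exp (- \<epsilon> * (norm z)\<^sup>2))
      \<le> norm (?C * exp (- (\<epsilon> / 2) * (norm (z::complex^'n))\<^sup>2))"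
  proof (rule AE_I2)
    fix z :: "complex^'n"
    have "(1 + norm z) powr A * exp (B * norm z) * exp (- \<epsilon> * (norm z)\<^sup>2)
       \<le> ?C * exp (\<epsilon> / 2 * (norm z)\<^sup>2) * exp (- \<epsilon> * (norm z)\<^sup>2)"
      using assms by (intro mult_right_mono powr_exp_le_gauss) auto
    also have "\<dots> = ?C * exp (- (\<epsilon> / 2) * (norm z)\<^sup>2)"
      by (simp add: field_simps flip: exp_add)
    finally show "norm ((1 + norm z) powr A * exp (B * norm z) * exp (- \<epsilon> * (norm z)\<^sup>2))
      \<le> norm (?C * exp (- (\<epsilon> / 2) * (norm z)\<^sup>2))" by simp
  qed
qed measurable

section \<open>Homogeneous components as averages over rotations\<close>

text \<open>Discrete orthogonality: c l is the factor by which averaging against the k-th character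
  multiplies the component of degree l. Degrees from N on may alias, and for these only the trivial
  bound 1 is kept.\<close>

lemma root_of_unity_average:
  assumes N: "N > 0" and \<omega>: "\<omega> = cis (2 * pi / real N)" and k: "k < N"
  defines "c \<equiv> \<lambda>l. (\<Sum>j<N. (\<omega> ^ l * cnj \<omega> ^ k) ^ j) / of_nat N"
  shows "c k = 1" "l < N \<Longrightarrow> l \<noteq> k \<Longrightarrow> c l = 0" "norm (c l) \<le> 1"
proof -
  have n1: "norm \<omega> = 1" by (simp add: \<omega>)
  have inv: "\<omega> ^ l * cnj \<omega> ^ l = 1" for l
    using n1 by (simp add: complex_norm_square[symmetric] flip: power_mult_distrib)
  show "c k = 1" using N by (simp add: c_def inv)
  have pw: "\<omega> ^ l = cis (2 * pi * real l / real N)" for l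
    by (simp add: \<omega> Complex.DeMoivre mult_ac)
  have N1: "\<omega> ^ N = 1" using N by (simp add: pw)
  show "c l = 0" if "l < N" "l \<noteq> k"
  proof -
    let ?r = "\<omega> ^ l * cnj \<omega> ^ k"
    have "\<omega> ^ l \<noteq> \<omega> ^ k"
      using Complex.bij_betw_roots_unity[OF N] that k unfolding pw bij_betw_def by (auto dest: inj_onD)
    moreover have "?r * \<omega> ^ k = \<omega> ^ l" using inv[of k] by (simp add: mult_ac)
    ultimately have r: "?r \<noteq> 1" by (metis mult_1)
    have "?r ^ N = (\<omega> ^ N) ^ l * cnj (\<omega> ^ N) ^ k"
      by (simp add: power_mult_distrib flip: power_mult) (simp add: mult.commute)
    hence "?r ^ N = 1" by (simp add: N1)
    thus ?thesis using r by (simp add: c_def geometric_sum)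
  qed
  have "norm (\<Sum>j<N. (\<omega> ^ l * cnj \<omega> ^ k) ^ j) \<le> (\<Sum>j<N. 1)"
    by (intro order_trans[OF norm_sum] sum_mono) (simp add: norm_mult norm_power n1)
  thus "norm (c l) \<le> 1" using N by (simp add: c_def norm_divide)
qed

lemma measurable_cnj: "cnj \<in> borel_measurable borel"
  by (intro borel_measurable_continuous_onI continuous_intros)

text \<open>By \<open>root_of_unity_average\<close> the error consists of aliased degrees above N
  only, hence is at most a tail of an absolutely convergent series. Finite averages replace the
  circle integral: they commute with integration over z without Fubini, and they exhibit the
  component as a limit of measurable functions.\<close>

lemma taylor_part_rotation_limit:
  fixes h :: "complex^'n \<Rightarrow> complex"
  assumes h: "entire h"
  defines "\<omega> \<equiv> \<lambda>N. cis (2 * pi / real (Suc N))"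
  shows "(\<lambda>N. (\<Sum>j<Suc N. h (\<omega> N ^ j *s z) * (cnj (\<omega> N) ^ k) ^ j) / of_nat (Suc N)) \<longlonglongrightarrow> taylor_part h k z"
proof -
  let ?h = "\<lambda>l. taylor_part h l z"
  define c where "c = (\<lambda>N l. (\<Sum>j<Suc N. (\<omega> N ^ l * cnj (\<omega> N) ^ k) ^ j) / of_nat (Suc N))"
  have A: "(\<lambda>l. ?h l * c N l) sums ((\<Sum>j<Suc N. h (\<omega> N ^ j *s z) * (cnj (\<omega> N) ^ k) ^ j) / of_nat (Suc N))" for N
  proof -
    have "(\<lambda>l. \<Sum>j<Suc N. ?h l * (\<omega> N ^ j) ^ l * (cnj (\<omega> N) ^ k) ^ j)
       sums (\<Sum>j<Suc N. h (\<omega> N ^ j *s z) * (cnj (\<omega> N) ^ k) ^ j)"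
      by (intro sums_sum sums_mult2 taylor_part_sums h)
    hence "(\<lambda>l. (\<Sum>j<Suc N. ?h l * (\<omega> N ^ j) ^ l * (cnj (\<omega> N) ^ k) ^ j) / of_nat (Suc N))
       sums ((\<Sum>j<Suc N. h (\<omega> N ^ j *s z) * (cnj (\<omega> N) ^ k) ^ j) / of_nat (Suc N))"
      by (rule sums_divide)
    moreover have "(\<Sum>j<Suc N. ?h l * (\<omega> N ^ j) ^ l * (cnj (\<omega> N) ^ k) ^ j) / of_nat (Suc N) = ?h l * c N l" for l
    proof -
      have "(\<omega> N ^ j) ^ l * (cnj (\<omega> N) ^ k) ^ j = (\<omega> N ^ l * cnj (\<omega> N) ^ k) ^ j" for j
        by (simp add: power_mult_distrib mult.commute flip: power_mult)
      thus ?thesis by (simp only: c_def times_divide_eq_right sum_distrib_left mult.assoc)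
    qed
    ultimately show ?thesis by simp
  qed
  have abs: "summable (\<lambda>l. norm (?h l))"
    using power_series_entire(3)[OF taylor_part_sums[OF h], of z 1] by simp
  have tail: "(\<lambda>N. \<Sum>l. norm (?h (l + Suc N))) \<longlonglongrightarrow> 0"
    using suminf_exist_split2[OF abs] by (rule LIMSEQ_Suc)
  show ?thesis
  proof (rule Lim_null[THEN iffD2], rule tendsto_norm_zero_cancel,
         rule tendsto_sandwich[OF _ _ tendsto_const tail])
    show "\<forall>\<^sub>F N in sequentially. 0 \<le> norm ((\<Sum>j<Suc N. h (\<omega> N ^ j *s z) * (cnj (\<omega> N) ^ k) ^ j) / of_nat (Suc N) - ?h k)"
      by simp
    show "\<forall>\<^sub>F N in sequentially. norm ((\<Sum>j<Suc N. h (\<omega> N ^ j *s z) * (cnj (\<omega> N) ^ k) ^ j) / of_nat (Suc N) - ?h k)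
       \<le> (\<Sum>l. norm (?h (l + Suc N)))"
    proof (rule eventually_sequentiallyI)
      fix N assume "k \<le> N"
      hence k: "k < Suc N" by simp
      have root: "c N k = 1" "\<And>l. l < Suc N \<Longrightarrow> l \<noteq> k \<Longrightarrow> c N l = 0" "\<And>l. norm (c N l) \<le> 1"
        unfolding c_def \<omega>_def by (rule root_of_unity_average[OF zero_less_Suc refl k]; assumption)+
      let ?S = "(\<Sum>j<Suc N. h (\<omega> N ^ j *s z) * (cnj (\<omega> N) ^ k) ^ j) / of_nat (Suc N)"
      have "(\<Sum>l<Suc N. ?h l * c N l) = (\<Sum>l<Suc N. if l = k then ?h k else 0)"
        using root(1,2) by (intro sum.cong) auto
      hence init: "(\<Sum>l<Suc N. ?h l * c N l) = ?h k" using k by simp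
      have "(\<lambda>l. ?h (l + Suc N) * c N (l + Suc N)) sums (?S - (\<Sum>l<Suc N. ?h l * c N l))"
        by (rule sums_split_initial_segment[OF A])
      hence sm: "(\<lambda>l. ?h (l + Suc N) * c N (l + Suc N)) sums (?S - ?h k)" by (simp only: init)
      have "norm (\<Sum>l. ?h (l + Suc N) * c N (l + Suc N)) \<le> (\<Sum>l. norm (?h (l + Suc N)))"
      proof (rule norm_suminf_le)
        show "summable (\<lambda>l. norm (?h (l + Suc N)))" using abs by (subst summable_iff_shift)
        show "norm (?h (l + Suc N) * c N (l + Suc N)) \<le> norm (?h (l + Suc N))" for l
          using root(3)[of "l + Suc N"] by (simp add: norm_mult mult_left_le)
      qed
      thus "norm (?S - ?h k) \<le> (\<Sum>l. norm (?h (l + Suc N)))" using sm by (simp only: sums_unique[symmetric])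
    qed
  qed
qed

lemma taylor_part_measurable [measurable_dest]:
  fixes h :: "complex^'n \<Rightarrow> complex"
  assumes "entire h" shows "taylor_part h k \<in> borel_measurable borel"
proof (rule borel_measurable_LIMSEQ_metric[OF _ taylor_part_rotation_limit[OF assms]])
  note [measurable] = entire_borel[OF assms]
  show "(\<lambda>z. (\<Sum>j<Suc N. h (cis (2 * pi / real (Suc N)) ^ j *s z) * (cnj (cis (2 * pi / real (Suc N))) ^ k) ^ j)
     / of_nat (Suc N)) \<in> borel_measurable borel" for N
    by measurable
qed

text \<open>The measure is invariant under \<open>z \<mapsto> \<omega> z\<close>, and averaging \<open>h\<close> against
  \<open>\<omega>\<^sup>-\<^sup>k\<close> over the \<open>N\<close>-th roots of unity converges to the homogeneous part of degree \<open>k\<close>.\<close>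

lemma integral_taylor_part:
  fixes h p :: "complex^'n \<Rightarrow> complex" and \<psi> :: "complex^'n \<Rightarrow> real"
  assumes h: "entire h" and p [measurable]: "p \<in> borel_measurable borel"
    and hom: "\<And>\<omega> z. norm \<omega> = 1 \<Longrightarrow> p (\<omega> *s z) = \<omega> ^ k * p z"
    and \<psi> [measurable]: "\<psi> \<in> borel_measurable borel"
    and rad: "\<And>\<omega> z. norm \<omega> = 1 \<Longrightarrow> \<psi> (\<omega> *s z) = \<psi> z"
    and G: "integrable gauss_volume G"
    and bound: "\<And>\<omega> z. norm \<omega> = 1 \<Longrightarrow> norm (p z * h (\<omega> *s z) * of_real (\<psi> z)) \<le> G z"
  shows "(\<integral>z. p z * cnj (h z) * of_real (\<psi> z) \<partial>gauss_volume)
       = (\<integral>z. p z * cnj (taylor_part h k z) * of_real (\<psi> z) \<partial>gauss_volume)"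
proof -
  define \<omega> where "\<omega> = (\<lambda>N. cis (2 * pi / real (Suc N)))"
  have n1: "norm (\<omega> N ^ j) = 1" for N j by (simp add: \<omega>_def norm_power)
  note [measurable] = entire_borel[OF h] taylor_part_measurable[OF h]
  let ?f = "\<lambda>z. p z * cnj (h z) * of_real (\<psi> z)"
  define A where "A = (\<lambda>N z. (\<Sum>j<Suc N. h (\<omega> N ^ j *s z) * (cnj (\<omega> N) ^ k) ^ j) / of_nat (Suc N))"
  have [measurable]: "A N \<in> borel_measurable borel" for N unfolding A_def by measurable
  note cn = measurable_compose[OF _ measurable_cnj]
  have [measurable]: "(\<lambda>z. cnj (h z)) \<in> borel_measurable borel" by (rule cn) measurable
  have mt [measurable]: "(\<lambda>z. cnj (A N z)) \<in> borel_measurable borel"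
     "(\<lambda>z. cnj (taylor_part h k z)) \<in> borel_measurable borel" for N
    by (rule cn, measurable)+
  have m: "?f \<in> borel_measurable borel" by measurable
  have ii: "integrable gauss_volume (\<lambda>z. ?f (\<omega> N ^ j *s z))" for N j
  proof (rule Bochner_Integration.integrable_bound[OF G])
    show "AE z in gauss_volume. norm (?f (\<omega> N ^ j *s z)) \<le> norm (G z)"
    proof (rule AE_I2)
      fix z :: "complex^'n"
      have "norm (?f (\<omega> N ^ j *s z)) = norm (p z * h (\<omega> N ^ j *s z) * of_real (\<psi> z))"
        using n1[of N j] by (simp add: hom rad norm_mult norm_power)
      also have "\<dots> \<le> G z" using n1 by (rule bound)
      finally show "norm (?f (\<omega> N ^ j *s z)) \<le> norm (G z)" by simp
    qed
    show "(\<lambda>z. ?f (\<omega> N ^ j *s z)) \<in> borel_measurable gauss_volume"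
      using measurable_compose[OF smult_measurable m] by simp
  qed
  \<comment> \<open>Homogeneity of p and radiality of \<psi> absorb the characters, so the average
    of h becomes an average of rotated copies of one and the same integrand; rotation invariance
    gives all of these the same integral.\<close>
  have sN: "p z * cnj (A N z) * of_real (\<psi> z) = (\<Sum>j<Suc N. ?f (\<omega> N ^ j *s z)) / of_nat (Suc N)" for N z
  proof -
    have e: "p z * cnj (h (\<omega> N ^ j *s z) * (cnj (\<omega> N) ^ k) ^ j) * of_real (\<psi> z) = ?f (\<omega> N ^ j *s z)" for j
    proof -
      have "(\<omega> N ^ j) ^ k = (\<omega> N ^ k) ^ j" by (simp add: mult.commute flip: power_mult)
      thus ?thesis using n1[of N j] by (simp add: hom rad mult_ac)
    qed
    have "(\<Sum>j<Suc N. p z * cnj (h (\<omega> N ^ j *s z) * (cnj (\<omega> N) ^ k) ^ j) * of_real (\<psi> z)) = (\<Sum>j<Suc N. ?f (\<omega> N ^ j *s z))"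
      by (intro sum.cong refl e)
    thus ?thesis unfolding A_def
      by (simp only: complex_cnj_divide cnj_sum complex_cnj_of_nat sum_distrib_left[symmetric] sum_distrib_right[symmetric]
           times_divide_eq_right times_divide_eq_left)
  qed
  have "(\<lambda>N. \<integral>z. p z * cnj (A N z) * of_real (\<psi> z) \<partial>gauss_volume)
     \<longlonglongrightarrow> (\<integral>z. p z * cnj (taylor_part h k z) * of_real (\<psi> z) \<partial>gauss_volume)"
  proof (rule integral_dominated_convergence[OF _ _ G])
    show "AE z in gauss_volume. (\<lambda>N. p z * cnj (A N z) * of_real (\<psi> z)) \<longlonglongrightarrow> p z * cnj (taylor_part h k z) * of_real (\<psi> z)"
      unfolding A_def \<omega>_def by (intro AE_I2 tendsto_intros taylor_part_rotation_limit h)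
    show "AE z in gauss_volume. norm (p z * cnj (A N z) * of_real (\<psi> z)) \<le> G z" for N
    proof (rule AE_I2)
      fix z :: "complex^'n"
      have "norm (\<Sum>j<Suc N. ?f (\<omega> N ^ j *s z)) \<le> (\<Sum>j<Suc N. G z)"
      proof (intro order_trans[OF norm_sum] sum_mono)
        fix j
        have "norm (?f (\<omega> N ^ j *s z)) = norm (p z * h (\<omega> N ^ j *s z) * of_real (\<psi> z))"
          using n1[of N j] by (simp add: hom rad norm_mult norm_power)
        also have "\<dots> \<le> G z" using n1 by (rule bound)
        finally show "norm (?f (\<omega> N ^ j *s z)) \<le> G z" .
      qed
      thus "norm (p z * cnj (A N z) * of_real (\<psi> z)) \<le> G z"
        unfolding sN norm_divide norm_of_nat by (simp add: divide_le_eq mult.commute del: of_nat_Suc)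
    qed
  qed (use mt in simp_all)
  moreover have "(\<integral>z. p z * cnj (A N z) * of_real (\<psi> z) \<partial>gauss_volume) = (\<integral>z. ?f z \<partial>gauss_volume)" for N
  proof -
    have "(\<integral>z. p z * cnj (A N z) * of_real (\<psi> z) \<partial>gauss_volume)
       = (\<Sum>j<Suc N. \<integral>z. ?f (\<omega> N ^ j *s z) \<partial>gauss_volume) / of_nat (Suc N)"
      unfolding sN by (simp only: integral_divide_zero Bochner_Integration.integral_sum[OF ii])
    also have "\<dots> = (\<Sum>j<Suc N. \<integral>z. ?f z \<partial>gauss_volume) / of_nat (Suc N)"
      by (simp only: integral_gauss_rotation[OF n1 m])
    also have "\<dots> = (\<integral>z. ?f z \<partial>gauss_volume)"
      by (simp only: sum_constant card_lessThan) (simp del: of_nat_Suc)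
    finally show ?thesis .
  qed
  ultimately show ?thesis by (simp only: LIMSEQ_const_iff)
qed

section \<open>Reproducing formula, homogeneous parts and radial moments\<close>

lemma hip_self: "hip z z = of_real ((norm z)\<^sup>2)"
  unfolding power2_norm_eq_inner Re_hip[symmetric] by (simp add: complex_eq_iff hip_def)

lemma norm_diff_power2: "(norm (z - w))\<^sup>2 = (norm z)\<^sup>2 - 2 * (z \<bullet> w) + (norm (w :: 'a::real_inner))\<^sup>2"
  by (simp add: power2_norm_eq_inner inner_diff_left inner_diff_right inner_commute)

lemma gauss_integral_one: "(\<integral>z. exp (- (norm (z::complex^'n))\<^sup>2) \<partial>gauss_volume) = 1"
  by (subst integral_eq_nn_integral) (auto simp: gauss_volume_normalized)

text \<open>The case k = 0, p = 1 of \<open>integral_taylor_part\<close>. It is stated for any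
  radial weight because two are needed: the Gaussian for the reproducing formula and the indicator
  of a ball for point evaluation.\<close>

lemma gauss_mean_value:
  fixes h :: "complex^'n \<Rightarrow> complex" and \<psi> :: "complex^'n \<Rightarrow> real"
  assumes h: "entire h" and \<psi>: "\<psi> \<in> borel_measurable borel"
    and rad: "\<And>\<omega> z. norm \<omega> = 1 \<Longrightarrow> \<psi> (\<omega> *s z) = \<psi> z"
    and G: "integrable gauss_volume G"
    and bound: "\<And>\<omega> z. norm \<omega> = 1 \<Longrightarrow> norm (h (\<omega> *s z)) * \<bar>\<psi> z\<bar> \<le> G z"
  shows "(\<integral>z. h z * of_real (\<psi> z) \<partial>gauss_volume) = h 0 * of_real (\<integral>z. \<psi> z \<partial>gauss_volume)"
proof -
  have "(\<integral>z. 1 * cnj (h z) * of_real (\<psi> z) \<partial>gauss_volume)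
      = (\<integral>z. 1 * cnj (taylor_part h 0 z) * of_real (\<psi> z) \<partial>gauss_volume)"
    using assms by (intro integral_taylor_part[OF h _ _ \<psi> rad G]) (auto simp: norm_mult)
  also have "\<dots> = cnj (h 0) * of_real (\<integral>z. \<psi> z \<partial>gauss_volume)"
    by (simp add: taylor_part_0)
  finally have "cnj (\<integral>z. 1 * cnj (h z) * of_real (\<psi> z) \<partial>gauss_volume)
      = h 0 * of_real (\<integral>z. \<psi> z \<partial>gauss_volume)" by simp
  thus ?thesis by (subst (asm) Bochner_Integration.integral_cnj[symmetric]) simp
qed

lemma growth_integrable:
  fixes f g :: "complex^'n \<Rightarrow> complex"
  assumes [measurable]: "f \<in> borel_measurable borel" "g \<in> borel_measurable borel"
    and f: "\<And>w. norm (f w) \<le> M * Phi b (norm w)"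
    and g: "\<And>w. norm (g w) \<le> C * ((1 + norm w) powr A * exp (B * norm w))"
  shows "integrable gauss_volume (\<lambda>w. f w * g w * of_real (exp (- (norm w)\<^sup>2)))"
proof (rule Bochner_Integration.integrable_bound)
  let ?G = "\<lambda>w::complex^'n. M * C * ((1 + norm w) powr (b + A) * exp (B * norm w) * exp (- (1/2) * (norm w)\<^sup>2))"
  show "integrable gauss_volume ?G"
    by (intro integrable_mult_right gauss_weight_integrable) simp
  show "AE w in gauss_volume. norm (f w * g w * of_real (exp (- (norm w)\<^sup>2))) \<le> norm (?G w)"
  proof (rule AE_I2)
    fix w :: "complex^'n"
    have "norm (f w * g w * of_real (exp (- (norm w)\<^sup>2)))
       \<le> (M * Phi b (norm w)) * (C * ((1 + norm w) powr A * exp (B * norm w))) * exp (- (norm w)\<^sup>2)"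
      unfolding norm_mult using mult_mono[OF f[of w] g[of w]] order_trans[OF norm_ge_zero f[of w]]
      by (simp add: mult_right_mono)
    also have "\<dots> = ?G w"
      by (simp add: Phi_def powr_add mult_ac flip: exp_add)
    finally show "norm (f w * g w * of_real (exp (- (norm w)\<^sup>2))) \<le> norm (?G w)" by simp
  qed
qed measurable

lemma Phi_translate_le:
  assumes "0 \<le> x" "x \<le> r + s" "0 \<le> r" "0 \<le> s"
  shows "Phi b x \<le> exp (\<bar>b\<bar> * s + s\<^sup>2 / 2) * (exp ((\<bar>b\<bar> + s) * r) * exp (r\<^sup>2 / 2))"
proof -
  have "x\<^sup>2 \<le> (r + s)\<^sup>2" using assms by (intro power_mono) auto
  hence 1: "exp (x\<^sup>2 / 2) \<le> exp ((r + s)\<^sup>2 / 2)" by simp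
  have "\<bar>b\<bar> * x \<le> \<bar>b\<bar> * (r + s)" using assms by (intro mult_left_mono) auto
  hence "(1 + x) powr b \<le> exp (\<bar>b\<bar> * (r + s))"
    using one_plus_powr_le_exp[OF assms(1), of b] by (meson exp_le_cancel_iff order_trans)
  hence "Phi b x \<le> exp (\<bar>b\<bar> * (r + s)) * exp ((r + s)\<^sup>2 / 2)"
    unfolding Phi_def using 1 by (intro mult_mono) auto
  also have "\<dots> = exp (\<bar>b\<bar> * s + s\<^sup>2 / 2) * (exp ((\<bar>b\<bar> + s) * r) * exp (r\<^sup>2 / 2))"
    by (simp add: power2_sum algebra_simps add_divide_distrib flip: exp_add)
  finally show ?thesis .
qed

text \<open>The mean value property at the origin, transported to \<open>z\<close> by the Weyl translation
  \<open>f \<mapsto> f (w + z) exp (- <w, z>)\<close>.\<close>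

lemma reproducing_formula:
  fixes f :: "complex^'n \<Rightarrow> complex"
  assumes f: "entire f" and bd: "\<And>w. norm (f w) \<le> M * Phi b (norm w)"
  shows "(\<integral>w. f w * exp (hip z w) * of_real (exp (- (norm w)\<^sup>2)) \<partial>gauss_volume) = f z"
proof -
  have M: "M \<ge> 0"
  proof -
    have "0 \<le> M * Phi b (norm (0::complex^'n))" using bd[of 0] norm_ge_zero order_trans by blast
    thus ?thesis by (simp add: Phi_def)
  qed
  note [measurable] = entire_borel[OF f] entire_borel[OF entire_hip]
  define h where "h = (\<lambda>w. f (w + z) * exp (- hip w z))"
  define F where "F = (\<lambda>v. f v * exp (- hip (v - z) z) * of_real (exp (- (norm (v - z))\<^sup>2)))"
  define G where "G = (\<lambda>w::complex^'n. M * exp (\<bar>b\<bar> * norm z + (norm z)\<^sup>2 / 2)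
     * ((1 + norm w) powr 0 * exp ((\<bar>b\<bar> + 2 * norm z) * norm w) * exp (- (1/2) * (norm w)\<^sup>2)))"
  have h: "entire h" unfolding h_def
    by (intro entire_mult entire_translate f entire_compose[of "\<lambda>x. exp (- x)"] entire_hip holomorphic_intros)
  have "(\<integral>w. h w * of_real (exp (- (norm w)\<^sup>2)) \<partial>gauss_volume)
      = h 0 * of_real (\<integral>w. exp (- (norm (w::complex^'n))\<^sup>2) \<partial>gauss_volume)"
  proof (rule gauss_mean_value[OF h])
    show "integrable gauss_volume G"
      unfolding G_def by (intro integrable_mult_right gauss_weight_integrable) simp
    fix \<omega> :: complex and w :: "complex^'n" assume \<omega>: "norm \<omega> = 1"
    show "exp (- (norm (\<omega> *s w))\<^sup>2) = exp (- (norm w)\<^sup>2)" using \<omega> by (simp add: norm_smult_complex)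
    let ?r = "norm w" and ?s = "norm z"
    have nw: "norm (\<omega> *s w) = ?r" using \<omega> by (simp add: norm_smult_complex)
    have "norm (f (\<omega> *s w + z)) \<le> M * Phi b (norm (\<omega> *s w + z))" by (rule bd)
    also have "\<dots> \<le> M * (exp (\<bar>b\<bar> * ?s + ?s\<^sup>2 / 2) * (exp ((\<bar>b\<bar> + ?s) * ?r) * exp (?r\<^sup>2 / 2)))"
      using M norm_triangle_ineq[of "\<omega> *s w" z] nw by (intro mult_left_mono Phi_translate_le) auto
    finally have 1: "norm (f (\<omega> *s w + z)) \<le> M * (exp (\<bar>b\<bar> * ?s + ?s\<^sup>2 / 2) * (exp ((\<bar>b\<bar> + ?s) * ?r) * exp (?r\<^sup>2 / 2)))" .
    have "- ((\<omega> *s w) \<bullet> z) \<le> ?r * ?s" using Cauchy_Schwarz_ineq2[of "\<omega> *s w" z] nw by simp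
    hence 2: "norm (exp (- hip (\<omega> *s w) z)) \<le> exp (?r * ?s)" by (simp add: Re_hip)
    have "norm (h (\<omega> *s w)) * exp (- ?r\<^sup>2)
      \<le> (M * (exp (\<bar>b\<bar> * ?s + ?s\<^sup>2 / 2) * (exp ((\<bar>b\<bar> + ?s) * ?r) * exp (?r\<^sup>2 / 2)))) * exp (?r * ?s) * exp (- ?r\<^sup>2)"
      unfolding h_def norm_mult using 1 2 M by (intro mult_mono) auto
    also have "\<dots> = G w"
    proof -
      have "exp ((\<bar>b\<bar> + ?s) * ?r) * exp (?r\<^sup>2 / 2) * exp (?r * ?s) * exp (- ?r\<^sup>2)
         = exp ((\<bar>b\<bar> + 2 * ?s) * ?r) * exp (- (1/2) * ?r\<^sup>2)"
        by (simp add: algebra_simps flip: exp_add)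
      moreover have "1 + ?r \<noteq> 0" using norm_ge_zero[of w] by linarith
      ultimately show ?thesis unfolding G_def by (simp add: mult.assoc)
    qed
    finally show "norm (h (\<omega> *s w)) * \<bar>exp (- (norm w)\<^sup>2)\<bar> \<le> G w" by simp
  qed measurable
  hence "f z = (\<integral>w. h w * of_real (exp (- (norm w)\<^sup>2)) \<partial>gauss_volume)"
    by (simp add: gauss_integral_one h_def)
  also have "\<dots> = (\<integral>w. F (w + z) \<partial>gauss_volume)" by (simp add: h_def F_def)
  also have "\<dots> = (\<integral>w. F w \<partial>gauss_volume)"
  proof (rule integral_gauss_translate)
    have "(\<lambda>v. exp (- hip (v - z) z)) = (\<lambda>v. exp (- hip (v + (- z)) z))" by simp
    moreover have "entire (\<lambda>v. exp (- hip (v + (- z)) z))"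
      by (intro entire_compose[of "\<lambda>x. exp (- x)"] entire_translate[OF entire_hip] holomorphic_intros)
    ultimately have [measurable]: "(\<lambda>v. exp (- hip (v - z) z)) \<in> borel_measurable borel"
      using entire_borel by metis
    show "F \<in> borel_measurable borel" unfolding F_def by measurable
  qed
  also have "F = (\<lambda>w. f w * exp (hip z w) * of_real (exp (- (norm w)\<^sup>2)))"
  proof
    fix v
    \<comment> \<open>Completing the square: undoing the translation turns the Weyl factor and the
      shifted Gaussian into exp <z, v> and the centred Gaussian.\<close>
    have "- hip (v - z) z - of_real ((norm (v - z))\<^sup>2) = hip z v - of_real ((norm v)\<^sup>2)"
    proof -
      have "hip (v - z) z = hip v z - hip z z"
        using hip_add_left[of "v - z" z z] by simp
      moreover have "of_real ((norm (v - z))\<^sup>2) = of_real ((norm v)\<^sup>2) - (hip v z + hip z v) + (hip z z :: complex)"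
      proof -
        have "hip v z + hip z v = of_real (2 * (v \<bullet> z))"
          using complex_add_cnj[of "hip v z"] by (simp add: cnj_hip Re_hip)
        thus ?thesis by (simp add: norm_diff_power2 hip_self)
      qed
      ultimately show ?thesis by simp
    qed
    hence "exp (- hip (v - z) z - of_real ((norm (v - z))\<^sup>2)) = exp (hip z v - of_real ((norm v)\<^sup>2))"
      by (rule arg_cong)
    hence "exp (- hip (v - z) z) * exp (- of_real ((norm (v - z))\<^sup>2)) = exp (hip z v) * exp (- of_real ((norm v)\<^sup>2))"
      by (simp only: exp_add[symmetric] diff_conv_add_uminus)
    thus "F v = f v * exp (hip z v) * of_real (exp (- (norm v)\<^sup>2))"
      by (simp add: F_def exp_of_real[symmetric] mult.assoc)
  qed
  finally show ?thesis by simp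
qed

lemma measurable_hip_right [measurable]: "(\<lambda>v. hip w v) \<in> borel_measurable borel"
  using measurable_compose[OF entire_borel[OF entire_hip] measurable_cnj, of w] by (simp add: cnj_hip)

text \<open>The reproducing formula at t z, with its exponential expanded in powers of t. The
  partial sums of the norms stay below the integrable majorant |f| exp |t <z, w>| exp(-|w|^2), so
  termwise integration is allowed, and uniqueness of coefficients gives the formula.\<close>

lemma taylor_part_integral:
  fixes f :: "complex^'n \<Rightarrow> complex"
  assumes f: "entire f" and bd: "\<And>w. norm (f w) \<le> M * Phi b (norm w)"
  shows "taylor_part f k z = (\<integral>w. f w * hip z w ^ k * of_real (exp (- (norm w)\<^sup>2)) \<partial>gauss_volume) / fact k"
proof (rule taylor_part_unique)
  fix t :: complex
  note [measurable] = entire_borel[OF f]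
  let ?e = "\<lambda>w::complex^'n. complex_of_real (exp (- (norm w)\<^sup>2))"
  let ?f = "\<lambda>k w. f w * ((t * hip z w) ^ k / fact k) * ?e w"
  have i: "integrable gauss_volume (?f k)" for k
  proof (rule growth_integrable[OF _ _ bd])
    show "norm ((t * hip z w) ^ k / fact k) \<le> 1 * ((1 + norm w) powr 0 * exp (norm t * norm z * norm w))" for w
    proof -
      have "norm ((t * hip z w) ^ k / fact k) = norm (t * hip z w) ^ k / fact k"
        by (simp add: norm_divide norm_power)
      also have "\<dots> \<le> exp (norm (t * hip z w))" by (rule power_fact_le_exp) simp
      also have "\<dots> \<le> exp (norm t * (norm z * norm w))"
        by (simp add: norm_mult mult_left_mono norm_hip_le)
      finally show ?thesis using norm_ge_zero[of w] by (auto simp: mult.assoc powr_zero_eq_one add_nonneg_eq_0_iff)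
    qed
  qed measurable
  have sm: "(\<lambda>k. norm (?f k w)) sums (norm (f w) * exp (norm (t * hip z w)) * norm (?e w))" for w
  proof -
    have "(\<lambda>k. norm (f w) * (norm (t * hip z w) ^ k /\<^sub>R fact k) * norm (?e w)) sums (norm (f w) * exp (norm (t * hip z w)) * norm (?e w))"
      by (intro sums_mult sums_mult2 exp_converges)
    moreover have "norm (?f k w) = norm (f w) * (norm (t * hip z w) ^ k /\<^sub>R fact k) * norm (?e w)" for k
      by (simp add: norm_mult norm_divide norm_power norm_inverse divide_inverse mult_ac)
    ultimately show ?thesis by simp
  qed
  have sm2: "(\<lambda>k. ?f k w) sums (f w * exp (hip (t *s z) w) * ?e w)" for w
  proof -
    have "(\<lambda>k. f w * ((t * hip z w) ^ k /\<^sub>R fact k) * ?e w) sums (f w * exp (t * hip z w) * ?e w)"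
      by (intro sums_mult sums_mult2 exp_converges)
    moreover have "(t * hip z w) ^ k /\<^sub>R fact k = (t * hip z w) ^ k / fact k" for k
      by (simp add: scaleR_conv_of_real divide_inverse mult.commute)
    ultimately show ?thesis by (simp add: hip_smult_left)
  qed
  have tot: "integrable gauss_volume (\<lambda>w. norm (f w) * exp (norm (t * hip z w)) * norm (?e w))"
  proof -
    have "integrable gauss_volume (\<lambda>w. f w * of_real (exp (norm (t * hip z w))) * ?e w)"
    proof (rule growth_integrable[OF _ _ bd])
      show "norm (complex_of_real (exp (norm (t * hip z w)))) \<le> 1 * ((1 + norm w) powr 0 * exp (norm t * norm z * norm w))" for w
      proof -
        have "exp (norm (t * hip z w)) \<le> exp (norm t * (norm z * norm w))"
          by (simp add: norm_mult mult_left_mono norm_hip_le)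
        thus ?thesis using norm_ge_zero[of w] by (auto simp: mult.assoc powr_zero_eq_one add_nonneg_eq_0_iff)
      qed
    qed measurable
    from integrable_norm[OF this] show ?thesis by (simp add: norm_mult)
  qed
  have sI: "summable (\<lambda>k. \<integral>w. norm (?f k w) \<partial>gauss_volume)"
  proof (rule summableI_nonneg_bounded)
    show "(\<Sum>k<n. \<integral>w. norm (?f k w) \<partial>gauss_volume) \<le> (\<integral>w. norm (f w) * exp (norm (t * hip z w)) * norm (?e w) \<partial>gauss_volume)" for n
    proof (subst Bochner_Integration.integral_sum[symmetric])
      show "integrable gauss_volume (\<lambda>w. norm (?f k w))" for k using i by (rule integrable_norm)
      show "(\<integral>w. (\<Sum>k<n. norm (?f k w)) \<partial>gauss_volume) \<le> (\<integral>w. norm (f w) * exp (norm (t * hip z w)) * norm (?e w) \<partial>gauss_volume)"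
      proof (rule integral_mono)
        show "integrable gauss_volume (\<lambda>w. \<Sum>k<n. norm (?f k w))"
          by (intro Bochner_Integration.integrable_sum integrable_norm i)
        show "(\<Sum>k<n. norm (?f k w)) \<le> norm (f w) * exp (norm (t * hip z w)) * norm (?e w)" for w
          using sum_le_suminf[of "\<lambda>k. norm (?f k w)" "{..<n}"] sm[of w] by (simp add: sums_iff)
      qed (rule tot)
    qed
  qed simp
  have "(\<lambda>k. \<integral>w. ?f k w \<partial>gauss_volume) sums (\<integral>w. (\<Sum>k. ?f k w) \<partial>gauss_volume)"
    using sm by (intro sums_integral i sI) (auto simp: sums_iff)
  moreover have "(\<integral>w. (\<Sum>k. ?f k w) \<partial>gauss_volume) = f (t *s z)"
    using sm2 reproducing_formula[OF f bd, of "t *s z"] by (simp add: sums_iff)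
  moreover have "(\<integral>w. ?f k w \<partial>gauss_volume) = (\<integral>w. f w * hip z w ^ k * ?e w \<partial>gauss_volume) / fact k * t ^ k" for k
  proof -
    have "?f k = (\<lambda>w. t ^ k / fact k * (f w * hip z w ^ k * ?e w))" by (simp add: power_mult_distrib fun_eq_iff)
    thus ?thesis by (simp only: integral_mult_right_zero) simp
  qed
  ultimately show "(\<lambda>k. (\<integral>w. f w * hip z w ^ k * ?e w \<partial>gauss_volume) / fact k * t ^ k) sums f (t *s z)"
    by simp
qed

section \<open>Monomials and polynomiality of the homogeneous components\<close>

definition monomial :: "('n \<Rightarrow> nat) \<Rightarrow> complex^'n \<Rightarrow> complex" where
  "monomial m z = (\<Prod>i\<in>UNIV. (z $ i) ^ m i)"

definition multi_indices :: "nat \<Rightarrow> ('n::finite \<Rightarrow> nat) set" where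
  "multi_indices k = {m. (\<Sum>i\<in>UNIV. m i) = k}"

lemma finite_multi_indices [simp]: "finite (multi_indices k :: ('n::finite \<Rightarrow> nat) set)"
proof (rule finite_subset)
  show "multi_indices k \<subseteq> (UNIV :: 'n set) \<rightarrow>\<^sub>E {..k}"
    by (auto simp: multi_indices_def PiE_iff intro: member_le_sum)
qed (simp add: finite_PiE)

text \<open>The power is expanded over all maps from the k factors to the indices, and the maps are
  grouped by the sizes of their fibres. The coefficients count maps and do not depend on x, which is
  what the quantifier order records.\<close>

lemma multinomial_expansion:
  "\<exists>C. \<forall>x. (\<Sum>i\<in>(UNIV :: 'n::finite set). x i :: complex) ^ k
     = (\<Sum>m\<in>multi_indices k. of_nat (C m) * (\<Prod>i\<in>UNIV. x i ^ m i))"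
proof -
  let ?H = "{..<k} \<rightarrow>\<^sub>E (UNIV :: 'n set)"
  define cnt where "cnt = (\<lambda>(h :: nat \<Rightarrow> 'n) i. card {j \<in> {..<k}. h j = i})"
  have fin: "finite ?H" by (simp add: finite_PiE)
  have sub: "cnt ` ?H \<subseteq> multi_indices k"
  proof
    fix m assume "m \<in> cnt ` ?H"
    then obtain h where m: "m = cnt h" by auto
    have "(\<Sum>i\<in>UNIV. cnt h i) = card (\<Union>i\<in>UNIV. {j \<in> {..<k}. h j = i})"
      unfolding cnt_def by (subst card_UN_disjoint) auto
    also have "(\<Union>i\<in>UNIV. {j \<in> {..<k}. h j = i}) = {..<k}" by auto
    finally show "m \<in> multi_indices k" by (simp add: m multi_indices_def)
  qed
  have "(\<Sum>i\<in>(UNIV :: 'n set). x i) ^ k = (\<Sum>m\<in>multi_indices k. of_nat (card {h \<in> ?H. cnt h = m}) * (\<Prod>i\<in>UNIV. x i ^ m i))"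
    for x :: "'n \<Rightarrow> complex"
  proof -
    have p: "(\<Prod>j<k. x (h j)) = (\<Prod>i\<in>UNIV. x i ^ cnt h i)" for h
    proof -
      have "(\<Prod>j<k. x (h j)) = (\<Prod>i\<in>UNIV. \<Prod>j\<in>{j \<in> {..<k}. h j = i}. x (h j))"
        by (rule prod.group[symmetric]) auto
      also have "\<dots> = (\<Prod>i\<in>UNIV. x i ^ cnt h i)"
        unfolding cnt_def by (intro prod.cong refl) simp
      finally show ?thesis .
    qed
    have "(\<Sum>i\<in>(UNIV :: 'n set). x i) ^ k = (\<Prod>j<k. \<Sum>i\<in>(UNIV :: 'n set). x i)" by simp
    also have "\<dots> = (\<Sum>h\<in>?H. \<Prod>j<k. x (h j))" by (rule prod_sum_PiE) auto
    also have "\<dots> = (\<Sum>m\<in>multi_indices k. \<Sum>h\<in>{h \<in> ?H. cnt h = m}. \<Prod>j<k. x (h j))"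
      using fin sub by (intro sum.group[symmetric]) auto
    also have "\<dots> = (\<Sum>m\<in>multi_indices k. of_nat (card {h \<in> ?H. cnt h = m}) * (\<Prod>i\<in>UNIV. x i ^ m i))"
    proof (intro sum.cong refl)
      fix m :: "'n \<Rightarrow> nat"
      have "(\<Sum>h\<in>{h \<in> ?H. cnt h = m}. \<Prod>j<k. x (h j)) = (\<Sum>h\<in>{h \<in> ?H. cnt h = m}. \<Prod>i\<in>UNIV. x i ^ m i)"
        by (intro sum.cong refl) (auto simp: p)
      thus "(\<Sum>h\<in>{h \<in> ?H. cnt h = m}. \<Prod>j<k. x (h j)) = of_nat (card {h \<in> ?H. cnt h = m}) * (\<Prod>i\<in>UNIV. x i ^ m i)"
        by simp
    qed
    finally show ?thesis .
  qed
  thus ?thesis by (intro exI[of _ "\<lambda>m. card {h \<in> ?H. cnt h = m}"]) blast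
qed

text \<open>Separates z from w, so that integration over w leaves a polynomial in z.\<close>

lemma hip_power_expansion:
  "\<exists>C. \<forall>z w :: complex^'n. hip z w ^ k = (\<Sum>m\<in>multi_indices k. of_nat (C m) * monomial m z * cnj (monomial m w))"
proof -
  obtain C where C: "\<And>x. (\<Sum>i\<in>(UNIV :: 'n::finite set). x i :: complex) ^ k
     = (\<Sum>m\<in>multi_indices k. of_nat (C m) * (\<Prod>i\<in>UNIV. x i ^ m i))"
    using multinomial_expansion by blast
  show ?thesis unfolding hip_def C
    by (intro exI[of _ C]) (simp add: monomial_def power_mult_distrib prod.distrib mult.assoc)
qed

lemma entire_monomial: "entire (monomial m)"
  unfolding monomial_def[abs_def] by (intro entire_prod entire_power entire_nth)

lemma norm_monomial_le: "norm (monomial m z) \<le> norm z ^ (\<Sum>i\<in>UNIV. m i)"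
proof -
  have "norm (monomial m z) = (\<Prod>i\<in>UNIV. norm (z $ i) ^ m i)"
    by (simp add: monomial_def norm_power flip: prod_norm)
  also have "\<dots> \<le> (\<Prod>i\<in>UNIV. norm z ^ m i)"
    by (intro prod_mono conjI power_mono Finite_Cartesian_Product.norm_nth_le) auto
  finally show ?thesis by (simp add: power_sum)
qed

lemma power_le_powr: "norm (z::'a::real_normed_vector) ^ k \<le> (1 + norm z) powr real k"
proof -
  have "norm z ^ k \<le> (1 + norm z) ^ k" by (intro power_mono) auto
  also have "\<dots> = (1 + norm z) powr real k"
    using norm_ge_zero[of z] by (subst powr_realpow) (auto intro: add_pos_nonneg)
  finally show ?thesis .
qed

lemma measurable_monomial_cnj: "(\<lambda>v. cnj (monomial m v)) \<in> borel_measurable borel"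
  by (rule measurable_compose[OF entire_borel[OF entire_monomial] measurable_cnj])

lemma growth_monomial_integrable:
  fixes f :: "complex^'n \<Rightarrow> complex"
  assumes f: "entire f" and bd: "\<And>w. norm (f w) \<le> M * Phi b (norm w)"
  shows "integrable gauss_volume (\<lambda>v. f v * cnj (monomial m v) * of_real (exp (- (norm v)\<^sup>2)))"
proof (rule growth_integrable[OF entire_borel[OF f] measurable_monomial_cnj bd])
  fix w :: "complex^'n"
  have "norm (cnj (monomial m w)) \<le> (1 + norm w) powr real (\<Sum>i\<in>UNIV. m i)"
    using order_trans[OF norm_monomial_le power_le_powr] by simp
  thus "norm (cnj (monomial m w)) \<le> 1 * ((1 + norm w) powr real (\<Sum>i\<in>UNIV. m i) * exp (0 * norm w))"
    by simp
qed

lemma taylor_part_expansion: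
  fixes f :: "complex^'n \<Rightarrow> complex"
  assumes f: "entire f" and bd: "\<And>w. norm (f w) \<le> M * Phi b (norm w)"
    and C: "\<And>z w :: complex^'n. hip z w ^ k = (\<Sum>m\<in>multi_indices k. of_nat (C m) * monomial m z * cnj (monomial m w))"
  shows "taylor_part f k z = (\<Sum>m\<in>multi_indices k.
     (of_nat (C m) / fact k * (\<integral>v. f v * cnj (monomial m v) * of_real (exp (- (norm v)\<^sup>2)) \<partial>gauss_volume)) * monomial m z)"
proof -
  let ?I = "\<lambda>m v. f v * cnj (monomial m v) * of_real (exp (- (norm v)\<^sup>2))"
  have "f v * hip z v ^ k * of_real (exp (- (norm v)\<^sup>2)) = (\<Sum>m\<in>multi_indices k. (of_nat (C m) * monomial m z) * ?I m v)" for v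
    unfolding C sum_distrib_left sum_distrib_right by (intro sum.cong refl) (simp add: mult_ac)
  hence "taylor_part f k z = (\<integral>v. (\<Sum>m\<in>multi_indices k. (of_nat (C m) * monomial m z) * ?I m v) \<partial>gauss_volume) / fact k"
    using taylor_part_integral[OF f bd, of k z] by simp
  also have "(\<integral>v. (\<Sum>m\<in>multi_indices k. (of_nat (C m) * monomial m z) * ?I m v) \<partial>gauss_volume)
     = (\<Sum>m\<in>multi_indices k. (of_nat (C m) * monomial m z) * (\<integral>v. ?I m v \<partial>gauss_volume))"
    by (subst Bochner_Integration.integral_sum)
       (auto intro!: integrable_mult_right growth_monomial_integrable[OF f bd])
  finally show ?thesis by (simp add: sum_divide_distrib mult_ac)
qed

lemma homogeneous_poly_taylor_part:
  fixes f :: "complex^'n \<Rightarrow> complex"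
  assumes f: "entire f" and bd: "\<And>w. norm (f w) \<le> M * Phi b (norm w)"
  shows "homogeneous_poly k (taylor_part f k)"
proof -
  obtain C where C: "\<And>z w :: complex^'n. hip z w ^ k = (\<Sum>m\<in>multi_indices k. of_nat (C m) * monomial m z * cnj (monomial m w))"
    using hip_power_expansion by blast
  show ?thesis unfolding homogeneous_poly_def
    using taylor_part_expansion[OF f bd C] unfolding monomial_def multi_indices_def
    by (intro exI allI) assumption
qed

text \<open>\<open>homogeneous_part\<close> is a definite description, so it has a usable value only
  once an expansion into polynomials exists. The growth bound supplies this through the integral
  formula, and uniqueness identifies the two.\<close>

lemma homogeneous_part_eq:
  fixes f :: "complex^'n \<Rightarrow> complex"
  assumes f: "entire f" and bd: "\<And>w. norm (f w) \<le> M * Phi b (norm w)"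
  shows "homogeneous_part f = taylor_part f"
proof -
  have "is_homogeneous_expansion f (taylor_part f)"
    unfolding is_homogeneous_expansion_def
    using homogeneous_poly_taylor_part[OF f bd] taylor_part_sums_self[OF f] by blast
  thus ?thesis unfolding homogeneous_part_def
    using homogeneous_expansion_unique by blast
qed

lemma entire_taylor_part:
  fixes f :: "complex^'n \<Rightarrow> complex"
  assumes f: "entire f" and bd: "\<And>w. norm (f w) \<le> M * Phi b (norm w)"
  shows "entire (taylor_part f k)"
proof -
  obtain C where C: "\<And>z w :: complex^'n. hip z w ^ k = (\<Sum>m\<in>multi_indices k. of_nat (C m) * monomial m z * cnj (monomial m w))"
    using hip_power_expansion by blast
  show ?thesis
    unfolding taylor_part_expansion[OF f bd C, abs_def] by (intro entire_sum entire_cmult entire_monomial)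
qed

lemma taylor_part_bound:
  assumes f: "entire f" and bd: "\<And>w. norm (f w) \<le> M * Phi b (norm w)"
  shows "norm (taylor_part f k z) \<le> M * Phi b (norm z)"
proof -
  have "norm (taylor_part f k z) \<le> M * Phi b (norm z) / 1 ^ k"
  proof (rule taylor_part_Cauchy[OF f zero_less_one])
    show "norm (f (t *s z)) \<le> M * Phi b (norm z)" if "norm t = 1" for t
      using bd[of "t *s z"] that by (simp add: norm_smult_complex)
  qed
  thus ?thesis by simp
qed

text \<open>Cauchy's estimate on the circle of radius 2 over a unit vector. The factor 2^(-k) makes
  the sum over k converge up to and including |z| = 1.\<close>

lemma taylor_part_bound_power:
  fixes f :: "complex^'n \<Rightarrow> complex"
  assumes f: "entire f" and bd: "\<And>w. norm (f w) \<le> M * Phi b (norm w)"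
  shows "norm (taylor_part f k z) \<le> M * Phi b 2 / 2 ^ k * norm z ^ k"
proof -
  have unit: "norm (taylor_part f k u) \<le> M * Phi b 2 / 2 ^ k" if "norm u = 1" for u k
  proof (rule taylor_part_Cauchy[OF f])
    show "(0::real) < 2" by simp
    show "norm (f (t *s u)) \<le> M * Phi b 2" if "norm t = 2" for t
      using bd[of "t *s u"] that \<open>norm u = 1\<close> by (simp add: norm_smult_complex)
  qed
  show ?thesis
proof (cases "z = 0")
  case True
  show ?thesis
  proof (cases "k = 0")
    case True
    have "norm (taylor_part f 0 (axis undefined 1)) \<le> M * Phi b 2 / 2 ^ 0" by (rule unit) (simp add: norm_axis_1)
    hence "norm (f 0) \<le> M * Phi b 2" by (simp add: taylor_part_0)
    thus ?thesis using True by (simp add: taylor_part_0)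
  next
    case False
    thus ?thesis using taylor_part_smult[OF f, of k 0 0] \<open>z = 0\<close> by (simp add: zero_power)
  qed
next
  case False
  define u where "u = complex_of_real (1 / norm z) *s z"
  have u: "norm u = 1" using False by (simp add: u_def norm_smult_complex norm_divide)
  have z: "z = complex_of_real (norm z) *s u" using False by (simp add: u_def vec_eq_iff)
  have "norm (taylor_part f k u) \<le> M * Phi b 2 / 2 ^ k"
    using u by (rule unit)
  hence "norm z ^ k * norm (taylor_part f k u) \<le> norm z ^ k * (M * Phi b 2 / 2 ^ k)"
    by (intro mult_left_mono) auto
  moreover have "norm (taylor_part f k z) = norm z ^ k * norm (taylor_part f k u)"
  proof -
    have "taylor_part f k z = taylor_part f k (complex_of_real (norm z) *s u)" using z by (rule arg_cong)
    thus ?thesis by (simp add: taylor_part_smult[OF f] norm_mult norm_power)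
  qed
  ultimately show ?thesis by (simp add: mult_ac)
qed
qed

text \<open>The mean value property over the unit ball, applied to the Weyl translate of g; over
  that ball the polynomial weight varies by at most a constant factor. It follows that elements of
  F^1 satisfy the growth hypothesis of the preceding lemmas.\<close>

lemma fock_one_pointwise:
  "\<exists>C>0. \<forall>g\<in>(fock_one \<alpha> :: (complex^'n \<Rightarrow> complex) set). \<forall>z. norm (g z) \<le> C * fock_one_norm \<alpha> g * Phi \<alpha> (norm z)"
proof -
  let ?\<psi> = "\<lambda>w::complex^'n. indicator (cball 0 1) w :: real"
  have [measurable]: "cball (0::complex^'n) 1 \<in> sets borel" by (intro borel_closed closed_cball)
  define c where "c = measure gauss_volume (cball (0::complex^'n) 1)"
  have em: "emeasure gauss_volume (cball (0::complex^'n) 1) = ennreal (1 / pi ^ CARD('n)) * emeasure lborel (cball (0::complex^'n) 1)"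
    using nn_integral_gauss_volume[OF borel_measurable_indicator, of "cball 0 1 :: (complex^'n) set"] by simp
  have fin: "emeasure gauss_volume (cball (0::complex^'n) 1) < \<infinity>"
    by (rule emeasure_gauss_cball)
  have psi_int: "integrable gauss_volume ?\<psi>" using fin by (intro integrable_real_indicator) auto
  have c_int: "(\<integral>w. ?\<psi> w \<partial>gauss_volume) = c" by (simp add: c_def)
  have "emeasure lborel (cball (0::complex^'n) 1) \<noteq> 0"
  proof
    assume "emeasure lborel (cball (0::complex^'n) 1) = 0"
    hence "measure lborel (cball (0::complex^'n) 1) = 0" by (simp add: measure_def)
    thus False using content_cball_pos[of 1 "0::complex^'n"] by simp
  qed
  hence "emeasure gauss_volume (cball (0::complex^'n) 1) \<noteq> 0" unfolding em by simp
  hence c: "c > 0" unfolding c_def using fin by (simp add: measure_def enn2real_positive_iff zero_less_iff_neq_zero)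
  let ?K = "exp (1/2) * 2 powr \<bar>\<alpha>\<bar>"
  have "norm (g z) \<le> ?K / c * fock_one_norm \<alpha> g * Phi \<alpha> (norm z)"
    if g: "g \<in> fock_one \<alpha>" for g :: "complex^'n \<Rightarrow> complex" and z
  proof -
    have eg: "entire g" using g by (simp add: fock_one_def)
    define F where "F = (\<lambda>v. norm (g v) * exp (- (norm v)\<^sup>2 / 2) * (1 + norm v) powr (- \<alpha>))"
    have F: "integrable gauss_volume F" using g by (simp add: fock_one_def F_def)
    define h where "h = (\<lambda>w. g (w + z) * exp (- hip w z))"
    have h: "entire h" unfolding h_def
      by (intro entire_mult entire_translate eg entire_compose[of "\<lambda>x. exp (- x)"] entire_hip holomorphic_intros)
    have "compact (h ` cball 0 1)" by (intro compact_continuous_image entire_continuous h) simp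
    then obtain B where B: "\<And>w. w \<in> cball 0 1 \<Longrightarrow> norm (h w) \<le> B"
      by (meson bounded_iff compact_imp_bounded imageI)
    have "(\<integral>w. h w * of_real (?\<psi> w) \<partial>gauss_volume) = h 0 * of_real (\<integral>w. ?\<psi> w \<partial>gauss_volume)"
    proof (rule gauss_mean_value[OF h])
      show "integrable gauss_volume (\<lambda>w. B * ?\<psi> w)" using psi_int by simp
      show "norm (h (\<omega> *s w)) * \<bar>?\<psi> w\<bar> \<le> B * ?\<psi> w" if "norm \<omega> = 1" for \<omega> w
        using B[of "\<omega> *s w"] that by (auto simp: indicator_def norm_smult_complex)
      show "?\<psi> \<in> borel_measurable borel" by (intro borel_measurable_indicator borel_closed closed_cball)
    qed (auto simp: norm_smult_complex indicator_def)
    hence eq: "g z * of_real c = (\<integral>w. h w * of_real (?\<psi> w) \<partial>gauss_volume)"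
      unfolding c_int by (simp add: h_def)
    have "norm (g z) * c = norm (\<integral>w. h w * of_real (?\<psi> w) \<partial>gauss_volume)"
      using c by (simp add: eq[symmetric] norm_mult)
    also have "\<dots> \<le> (\<integral>w. ?K * Phi \<alpha> (norm z) * F (w + z) \<partial>gauss_volume)"
    proof (rule Bochner_Integration.integral_norm_bound_integral)
      show "integrable gauss_volume (\<lambda>w. h w * of_real (?\<psi> w))"
      proof (rule Bochner_Integration.integrable_bound[of _ "\<lambda>w. B * ?\<psi> w"])
        show "integrable gauss_volume (\<lambda>w. B * ?\<psi> w)" using psi_int by simp
        show "(\<lambda>w. h w * complex_of_real (?\<psi> w)) \<in> borel_measurable gauss_volume"
          using entire_borel[OF h] by measurable
        show "AE w in gauss_volume. norm (h w * of_real (?\<psi> w)) \<le> norm (B * ?\<psi> w)"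
        proof (rule AE_I2)
          fix w :: "complex^'n"
          show "norm (h w * of_real (?\<psi> w)) \<le> norm (B * ?\<psi> w)"
            using B[of w] by (cases "norm w \<le> 1") (auto simp: indicator_def norm_mult)
        qed
      qed
      show "integrable gauss_volume (\<lambda>w. ?K * Phi \<alpha> (norm z) * F (w + z))"
        by (intro integrable_mult_right integrable_gauss_translate F)
      fix w :: "complex^'n"
      show "norm (h w * of_real (?\<psi> w)) \<le> ?K * Phi \<alpha> (norm z) * F (w + z)"
      proof (cases "norm w \<le> 1")
        case False thus ?thesis by (simp add: indicator_def F_def)
      next
        case True
        let ?v = "norm (w + z)"
        \<comment> \<open>The Weyl factor exp(-w . z) is the quotient of the Gaussian weights at w +
          z and at z, up to exp(|w|^2/2).\<close>
        have "?v\<^sup>2 = (norm w)\<^sup>2 + 2 * (w \<bullet> z) + (norm z)\<^sup>2"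
          by (simp add: power2_norm_eq_inner inner_add_left inner_add_right inner_commute)
        moreover have "(norm w)\<^sup>2 \<le> 1" using True by (simp add: abs_square_le_1)
        ultimately have "- (w \<bullet> z) \<le> 1/2 + (norm z)\<^sup>2 / 2 + - ?v\<^sup>2 / 2" by linarith
        hence e: "exp (- (w \<bullet> z)) \<le> exp (1/2) * exp ((norm z)\<^sup>2 / 2) * exp (- ?v\<^sup>2 / 2)"
          by (simp flip: exp_add)
        have "\<bar>?v - norm z\<bar> \<le> 1" using True norm_triangle_ineq3[of "w + z" z] by simp
        hence "(1 + \<bar>?v - norm z\<bar>) powr \<bar>\<alpha>\<bar> \<le> 2 powr \<bar>\<alpha>\<bar>" by (intro powr_mono2) auto
        hence "(1 + ?v) powr \<alpha> \<le> (1 + norm z) powr \<alpha> * 2 powr \<bar>\<alpha>\<bar>"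
          using one_plus_powr_moderate[of ?v "norm z" \<alpha>] by (smt (verit) mult_left_mono norm_ge_zero powr_ge_zero)
        hence "(1 + ?v) powr \<alpha> * (1 + ?v) powr (- \<alpha>) \<le> (1 + norm z) powr \<alpha> * 2 powr \<bar>\<alpha>\<bar> * (1 + ?v) powr (- \<alpha>)"
          by (intro mult_right_mono) auto
        moreover have "1 + ?v > 0" by (simp add: add_pos_nonneg)
        ultimately have p: "1 \<le> (1 + norm z) powr \<alpha> * 2 powr \<bar>\<alpha>\<bar> * (1 + ?v) powr (- \<alpha>)"
          by (simp flip: powr_add)
        have "norm (h w * of_real (?\<psi> w)) = norm (g (w + z)) * (exp (- (w \<bullet> z)) * 1)"
          using True by (simp add: h_def norm_mult Re_hip)
        also have "\<dots> \<le> norm (g (w + z)) * ((exp (1/2) * exp ((norm z)\<^sup>2 / 2) * exp (- ?v\<^sup>2 / 2))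
            * ((1 + norm z) powr \<alpha> * 2 powr \<bar>\<alpha>\<bar> * (1 + ?v) powr (- \<alpha>)))"
          using e p by (intro mult_left_mono mult_mono) auto
        also have "\<dots> = ?K * Phi \<alpha> (norm z) * F (w + z)" by (simp add: F_def Phi_def mult_ac)
        finally show ?thesis .
      qed
    qed
    also have "\<dots> = ?K * Phi \<alpha> (norm z) * fock_one_norm \<alpha> g"
      using integral_gauss_translate[of F z] borel_measurable_integrable[OF F]
      by (simp add: fock_one_norm_def F_def)
    finally show ?thesis using c by (simp add: field_simps)
  qed
  thus ?thesis using c by (intro exI[of _ "?K / c"]) simp
qed

section \<open>Radial moments of homogeneous functions\<close>

text \<open>Replace \<Gamma>(m) (1 + u)^(-m) by the integral of v^(m-1) exp(-(1 + u) v) and exchange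
  the integrals; the inner one in u is again a Gamma integral.\<close>

lemma Beta_second_kind:
  assumes s: "s > 0" and m: "m > (s::real)"
  shows "(\<integral>\<^sup>+u. ennreal (indicator {0..} u * u powr (s - 1) * (1 + u) powr (- m)) \<partial>lborel) * ennreal (Gamma m)
    = ennreal (Gamma s) * ennreal (Gamma (m - s))"
proof -
  have m0: "m > 0" using s m by simp
  let ?w = "\<lambda>u. ennreal (indicator {0..} u * u powr (s - 1))"
  let ?v = "\<lambda>v. ennreal (indicator {0..} v * v powr (m - 1))"
  have "(\<integral>\<^sup>+u. ennreal (indicator {0..} u * u powr (s - 1) * (1 + u) powr (- m)) \<partial>lborel) * ennreal (Gamma m)
      = (\<integral>\<^sup>+u. ennreal (indicator {0..} u * u powr (s - 1) * (1 + u) powr (- m)) * ennreal (Gamma m) \<partial>lborel)"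
    by (intro nn_integral_multc[symmetric]) measurable
  also have "\<dots> = (\<integral>\<^sup>+u. (\<integral>\<^sup>+v. ?w u * (?v v * ennreal (exp (- (1 + u) * v))) \<partial>lborel) \<partial>lborel)"
  proof (intro nn_integral_cong)
    fix u :: real
    show "ennreal (indicator {0..} u * u powr (s - 1) * (1 + u) powr (- m)) * ennreal (Gamma m)
       = (\<integral>\<^sup>+v. ?w u * (?v v * ennreal (exp (- (1 + u) * v))) \<partial>lborel)"
    proof (cases "u \<ge> 0")
      case True
      have "(\<integral>\<^sup>+v. ?w u * (?v v * ennreal (exp (- (1 + u) * v))) \<partial>lborel)
          = ?w u * (\<integral>\<^sup>+v. ennreal (indicator {0..} v * v powr (m - 1) * exp (- (1 + u) * v)) \<partial>lborel)"
        by (subst nn_integral_cmult) (auto simp: ennreal_mult)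
      also have "\<dots> = ?w u * ennreal (Gamma m / (1 + u) powr m)"
        using True m0 by (subst Gamma_scaled_nn_integral) auto
      also have "\<dots> = ennreal (indicator {0..} u * u powr (s - 1) * (1 + u) powr (- m)) * ennreal (Gamma m)"
        using True m0 by (simp add: powr_minus divide_inverse Gamma_real_nonneg mult_ac flip: ennreal_mult)
      finally show ?thesis by simp
    qed simp
  qed
  also have "\<dots> = (\<integral>\<^sup>+v. (\<integral>\<^sup>+u. ?w u * (?v v * ennreal (exp (- (1 + u) * v))) \<partial>lborel) \<partial>lborel)"
    by (intro lborel_pair.Fubini') measurable
  also have "\<dots> = (\<integral>\<^sup>+v. ennreal (Gamma s) * ennreal (indicator {0..} v * v powr (m - s - 1) * exp (- 1 * v)) \<partial>lborel)"
  proof (intro nn_integral_cong_AE)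
    have "AE v in lborel. v \<noteq> (0::real)" by (rule AE_lborel_singleton)
    thus "AE v in lborel. (\<integral>\<^sup>+u. ?w u * (?v v * ennreal (exp (- (1 + u) * v))) \<partial>lborel)
       = ennreal (Gamma s) * ennreal (indicator {0..} v * v powr (m - s - 1) * exp (- 1 * v))"
    proof eventually_elim
      case (elim v)
      show ?case
      proof (cases "v > 0")
        case True
        have "(\<integral>\<^sup>+u. ?w u * (?v v * ennreal (exp (- (1 + u) * v))) \<partial>lborel)
          = (\<integral>\<^sup>+u. ennreal (v powr (m - 1) * exp (- v)) * ennreal (indicator {0..} u * u powr (s - 1) * exp (- v * u)) \<partial>lborel)"
        proof (intro nn_integral_cong)
          fix u :: real
          have "exp (- (1 + u) * v) = exp (- v) * exp (- v * u)" by (simp add: algebra_simps flip: exp_add)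
          thus "?w u * (?v v * ennreal (exp (- (1 + u) * v))) =
             ennreal (v powr (m - 1) * exp (- v)) * ennreal (indicator {0..} u * u powr (s - 1) * exp (- v * u))"
            using True by (simp add: mult_ac flip: ennreal_mult)
        qed
        also have "\<dots> = ennreal (v powr (m - 1) * exp (- v)) * ennreal (Gamma s / v powr s)"
          by (subst nn_integral_cmult, simp, subst Gamma_scaled_nn_integral[OF s True]) simp
        also have "\<dots> = ennreal (Gamma s) * ennreal (indicator {0..} v * v powr (m - s - 1) * exp (- 1 * v))"
        proof -
          have "v powr (m - 1) / v powr s = v powr (m - s - 1)" by (simp add: algebra_simps flip: powr_diff)
          hence "v powr (m - 1) * exp (- v) * (Gamma s / v powr s) = Gamma s * (v powr (m - s - 1) * exp (- v))"
            by (metis (no_types, opaque_lifting) mult.commute mult.left_commute times_divide_eq_left times_divide_eq_right)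
          thus ?thesis using True s by (simp add: Gamma_real_nonneg flip: ennreal_mult)
        qed
        finally show ?thesis .
      next
        case False
        thus ?thesis using elim by simp
      qed
    qed
  qed
  also have "\<dots> = ennreal (Gamma s) * ennreal (Gamma (m - s) / 1 powr (m - s))"
    using m by (subst nn_integral_cmult, simp, subst Gamma_scaled_nn_integral) auto
  finally show ?thesis by simp
qed

text \<open>A substitute for polar coordinates. The extra factor |z|^(-2s) is written as a Gamma
  integral of exp(-u |z|^2), the resulting Gaussian of width (1 + u)^(-1/2) is rescaled, and the
  remaining integral in u is \<open>Beta_second_kind\<close>. Working with products in
  \<open>ennreal\<close> avoids assuming that the moments are finite.\<close>

lemma radial_shift:
  fixes H :: "complex^'n \<Rightarrow> real"
  assumes [measurable]: "H \<in> borel_measurable borel" and H0: "\<And>z. H z \<ge> 0"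
    and hom: "\<And>t z. t > 0 \<Longrightarrow> H (t *\<^sub>R z) = t ^ (2 * k) * H z"
    and s: "s > 0" and m: "real (CARD('n) + k) - \<kappa> > s"
  shows "(\<integral>\<^sup>+z. ennreal (H z * norm z powr (- (2 * (\<kappa> + s))) * exp (- (norm z)\<^sup>2)) \<partial>gauss_volume) * ennreal (Gamma (real (CARD('n) + k) - \<kappa>))
    = ennreal (Gamma (real (CARD('n) + k) - \<kappa> - s)) * (\<integral>\<^sup>+z. ennreal (H z * norm z powr (- (2 * \<kappa>)) * exp (- (norm z)\<^sup>2)) \<partial>gauss_volume)"
proof -
  interpret V: sigma_finite_measure "gauss_volume :: (complex^'n) measure" by (rule gauss_volume_sigma_finite)
  interpret P: pair_sigma_finite lborel "gauss_volume :: (complex^'n) measure" ..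
  define m where "m = real (CARD('n) + k) - \<kappa>"
  let ?I = "\<integral>\<^sup>+z. ennreal (H z * norm z powr (- (2 * \<kappa>)) * exp (- (norm z)\<^sup>2)) \<partial>gauss_volume"
  let ?J = "\<integral>\<^sup>+z. ennreal (H z * norm z powr (- (2 * (\<kappa> + s))) * exp (- (norm z)\<^sup>2)) \<partial>gauss_volume"
  have scaled: "(\<integral>\<^sup>+z. ennreal (H z * norm z powr (- (2 * \<kappa>)) * exp (- (1 + u) * (norm z)\<^sup>2)) \<partial>gauss_volume)
     = ennreal ((1 + u) powr (- m)) * ?I" if u: "u \<ge> 0" for u
  proof -
    \<comment> \<open>The dilation that turns exp(-(1 + u) |z|^2) into exp(-|z|^2).\<close>
    define t where "t = (1 + u) powr (- 1/2)"
    have t: "t > 0" using u by (simp add: t_def)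
    have "t\<^sup>2 = (1 + u) powr (- 1)" unfolding t_def using u by (subst powr_power) auto
    hence t2: "(1 + u) * t\<^sup>2 = 1" using u by (simp add: powr_minus)
    have "(\<integral>\<^sup>+z. ennreal (H z * norm z powr (- (2 * \<kappa>)) * exp (- (1 + u) * (norm z)\<^sup>2)) \<partial>gauss_volume)
       = ennreal (t ^ (2 * CARD('n))) * (\<integral>\<^sup>+z. ennreal (H (t *\<^sub>R z) * norm (t *\<^sub>R z) powr (- (2 * \<kappa>)) * exp (- (1 + u) * (norm (t *\<^sub>R z))\<^sup>2)) \<partial>gauss_volume)"
      by (rule nn_integral_gauss_scale) (use t in auto)
    also have "\<dots> = ennreal (t ^ (2 * CARD('n))) * (\<integral>\<^sup>+z. ennreal (t ^ (2 * k) * t powr (- (2 * \<kappa>))) * ennreal (H z * norm z powr (- (2 * \<kappa>)) * exp (- (norm z)\<^sup>2)) \<partial>gauss_volume)"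
    proof (intro arg_cong2[of _ _ _ _ "(*)"] refl nn_integral_cong)
      fix z :: "complex^'n"
      have "(1 + u) * (norm (t *\<^sub>R z))\<^sup>2 = ((1 + u) * t\<^sup>2) * (norm z)\<^sup>2" by (simp add: power_mult_distrib)
      hence "- (1 + u) * (norm (t *\<^sub>R z))\<^sup>2 = - (norm z)\<^sup>2" unfolding t2 by (simp only: mult_minus_left mult_1)
      hence e: "exp (- (1 + u) * (norm (t *\<^sub>R z))\<^sup>2) = exp (- (norm z)\<^sup>2)" by (rule arg_cong)
      show "ennreal (H (t *\<^sub>R z) * norm (t *\<^sub>R z) powr (- (2 * \<kappa>)) * exp (- (1 + u) * (norm (t *\<^sub>R z))\<^sup>2))
         = ennreal (t ^ (2 * k) * t powr (- (2 * \<kappa>))) * ennreal (H z * norm z powr (- (2 * \<kappa>)) * exp (- (norm z)\<^sup>2))"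
        unfolding e using t H0[of z] by (simp add: hom powr_mult mult_ac flip: ennreal_mult)
    qed
    also have "\<dots> = ennreal (t ^ (2 * CARD('n))) * (ennreal (t ^ (2 * k) * t powr (- (2 * \<kappa>))) * ?I)"
      by (subst nn_integral_cmult) auto
    also have "\<dots> = ennreal (t ^ (2 * CARD('n)) * (t ^ (2 * k) * t powr (- (2 * \<kappa>)))) * ?I"
      using t by (simp add: ennreal_mult mult.assoc)
    \<comment> \<open>The Jacobian contributes 2n, the homogeneity of H contributes 2k and the
      weight -2\<kappa>, in total 2m.\<close>
    also have "t ^ (2 * CARD('n)) * (t ^ (2 * k) * t powr (- (2 * \<kappa>))) = t powr (2 * m)"
      using t by (simp add: m_def algebra_simps flip: powr_realpow powr_add)
    also have "\<dots> = (1 + u) powr (- m)" using u by (simp add: t_def powr_powr)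
    finally show ?thesis .
  qed
  let ?w = "\<lambda>u. ennreal (indicator {0..} u * u powr (s - 1))"
  let ?F = "\<lambda>z::complex^'n. ennreal (H z * norm z powr (- (2 * \<kappa>)) * exp (- (norm z)\<^sup>2))"
  have "ennreal (Gamma s) * ?J = (\<integral>\<^sup>+z. ennreal (Gamma s) * ennreal (H z * norm z powr (- (2 * (\<kappa> + s))) * exp (- (norm z)\<^sup>2)) \<partial>gauss_volume)"
    by (rule nn_integral_cmult[symmetric]) measurable
  also have "\<dots> = (\<integral>\<^sup>+z. (\<integral>\<^sup>+u. ?w u * (?F z * ennreal (exp (- (norm z)\<^sup>2 * u))) \<partial>lborel) \<partial>gauss_volume)"
  proof (intro nn_integral_cong)
    fix z :: "complex^'n"
    show "ennreal (Gamma s) * ennreal (H z * norm z powr (- (2 * (\<kappa> + s))) * exp (- (norm z)\<^sup>2))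
      = (\<integral>\<^sup>+u. ?w u * (?F z * ennreal (exp (- (norm z)\<^sup>2 * u))) \<partial>lborel)"
    \<comment> \<open>At the origin both sides vanish, because \<open>0 powr x\<close> is 0 for
      every exponent.\<close>
    proof (cases "z = 0")
      case False
      have "(\<integral>\<^sup>+u. ?w u * (?F z * ennreal (exp (- (norm z)\<^sup>2 * u))) \<partial>lborel)
         = (\<integral>\<^sup>+u. ?F z * ennreal (indicator {0..} u * u powr (s - 1) * exp (- (norm z)\<^sup>2 * u)) \<partial>lborel)"
        using H0[of z] by (intro nn_integral_cong) (simp add: mult_ac flip: ennreal_mult)
      also have "\<dots> = ?F z * ennreal (Gamma s / (norm z)\<^sup>2 powr s)"
        using s False by (subst nn_integral_cmult, simp, subst Gamma_scaled_nn_integral) auto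
      also have "\<dots> = ennreal (Gamma s) * ennreal (H z * norm z powr (- (2 * (\<kappa> + s))) * exp (- (norm z)\<^sup>2))"
      proof -
        have "norm z powr (- (2 * (\<kappa> + s))) = norm z powr (- (2 * \<kappa>)) / (norm z)\<^sup>2 powr s"
          using False by (simp add: powr_powr algebra_simps flip: powr_numeral powr_diff)
        thus ?thesis using H0[of z] s by (simp add: Gamma_real_nonneg mult_ac flip: ennreal_mult)
      qed
      finally show ?thesis by simp
    qed simp
  qed
  also have "\<dots> = (\<integral>\<^sup>+u. (\<integral>\<^sup>+z. ?w u * (?F z * ennreal (exp (- (norm z)\<^sup>2 * u))) \<partial>gauss_volume) \<partial>lborel)"
    by (rule P.Fubini') measurable
  also have "\<dots> = (\<integral>\<^sup>+u. ennreal (indicator {0..} u * u powr (s - 1) * (1 + u) powr (- m)) * ?I \<partial>lborel)"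
  proof (intro nn_integral_cong)
    fix u :: real
    show "(\<integral>\<^sup>+z. ?w u * (?F z * ennreal (exp (- (norm z)\<^sup>2 * u))) \<partial>gauss_volume)
      = ennreal (indicator {0..} u * u powr (s - 1) * (1 + u) powr (- m)) * ?I"
    proof (cases "u \<ge> 0")
      case True
      have "(\<integral>\<^sup>+z. ?w u * (?F z * ennreal (exp (- (norm z)\<^sup>2 * u))) \<partial>gauss_volume)
        = (\<integral>\<^sup>+z. ?w u * ennreal (H z * norm z powr (- (2 * \<kappa>)) * exp (- (1 + u) * (norm z)\<^sup>2)) \<partial>gauss_volume)"
      proof (intro nn_integral_cong)
        fix z :: "complex^'n"
        have "exp (- (1 + u) * (norm z)\<^sup>2) = exp (- (norm z)\<^sup>2) * exp (- (norm z)\<^sup>2 * u)"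
          by (simp add: algebra_simps flip: exp_add)
        thus "?w u * (?F z * ennreal (exp (- (norm z)\<^sup>2 * u))) = ?w u * ennreal (H z * norm z powr (- (2 * \<kappa>)) * exp (- (1 + u) * (norm z)\<^sup>2))"
          using H0[of z] by (simp add: mult_ac flip: ennreal_mult)
      qed
      also have "\<dots> = ?w u * (ennreal ((1 + u) powr (- m)) * ?I)"
        using True scaled[of u] by (subst nn_integral_cmult) auto
      also have "\<dots> = ennreal (indicator {0..} u * u powr (s - 1) * (1 + u) powr (- m)) * ?I"
        by (simp add: ennreal_mult mult.assoc)
      finally show ?thesis .
    qed simp
  qed
  also have "\<dots> = (\<integral>\<^sup>+u. ennreal (indicator {0..} u * u powr (s - 1) * (1 + u) powr (- m)) \<partial>lborel) * ?I"
    by (rule nn_integral_multc) measurable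
  finally have "ennreal (Gamma s) * ?J * ennreal (Gamma m)
     = ((\<integral>\<^sup>+u. ennreal (indicator {0..} u * u powr (s - 1) * (1 + u) powr (- m)) \<partial>lborel) * ennreal (Gamma m)) * ?I"
    by (simp add: mult_ac)
  also have "\<dots> = ennreal (Gamma s) * ennreal (Gamma (m - s)) * ?I"
    using s m by (subst Beta_second_kind) (auto simp: m_def)
  finally have "ennreal (Gamma s) * (?J * ennreal (Gamma m)) = ennreal (Gamma s) * (ennreal (Gamma (m - s)) * ?I)"
    by (simp add: mult.assoc)
  moreover have "ennreal (Gamma s) \<noteq> 0" "ennreal (Gamma s) \<noteq> \<infinity>"
    using Gamma_real_pos[OF s] by auto
  ultimately show ?thesis unfolding m_def by (simp add: ennreal_mult_cancel_left)
qed

text \<open>\<open>radial_shift\<close> only lowers the exponent of |z|. For positive \<kappa> it is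
  applied from the unweighted moment to the weighted one, for negative \<kappa> the other way
  round.\<close>

lemma radial_ratio:
  fixes H :: "complex^'n \<Rightarrow> real"
  assumes H: "H \<in> borel_measurable borel" "\<And>z. H z \<ge> 0"
    "\<And>t z. t > 0 \<Longrightarrow> H (t *\<^sub>R z) = t ^ (2 * k) * H z"
    and \<kappa>: "real (CARD('n) + k) > \<kappa>"
  shows "(\<integral>\<^sup>+z. ennreal (H z * norm z powr (- (2 * \<kappa>)) * exp (- (norm z)\<^sup>2)) \<partial>gauss_volume) * ennreal (Gamma (real (CARD('n) + k)))
    = ennreal (Gamma (real (CARD('n) + k) - \<kappa>)) * (\<integral>\<^sup>+z. ennreal (H z * norm z powr 0 * exp (- (norm z)\<^sup>2)) \<partial>gauss_volume)"
proof (cases \<kappa> "0::real" rule: linorder_cases)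
  case equal
  thus ?thesis by (simp add: mult.commute)
next
  case greater
  thus ?thesis using radial_shift[OF H, where \<kappa> = 0 and s = \<kappa>] \<kappa> by simp
next
  case less
  have "real (CARD('n) + k) > 0" by (simp add: add_pos_nonneg)
  thus ?thesis using less radial_shift[OF H, where \<kappa> = \<kappa> and s = "- \<kappa>"] \<kappa>
    by (simp add: mult.commute)
qed

lemma radial_integral:
  fixes H :: "complex^'n \<Rightarrow> real"
  assumes H [measurable]: "H \<in> borel_measurable borel" and H0: "\<And>z. H z \<ge> 0"
    and hom: "\<And>t z. t > 0 \<Longrightarrow> H (t *\<^sub>R z) = t ^ (2 * k) * H z"
    and bd: "\<And>z. H z \<le> C * norm z ^ (2 * k)"
    and \<kappa>: "real (CARD('n) + k) > \<kappa>"
  shows "has_bochner_integral gauss_volume (\<lambda>z. H z * norm z powr (- (2 * \<kappa>)) * exp (- (norm z)\<^sup>2))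
    (Gamma (real (CARD('n) + k) - \<kappa>) / Gamma (real (CARD('n) + k)) * (\<integral>z. H z * norm z powr 0 * exp (- (norm z)\<^sup>2) \<partial>gauss_volume))"
proof -
  let ?I = "\<lambda>z. H z * norm z powr (- (2 * \<kappa>)) * exp (- (norm z)\<^sup>2)"
  let ?J = "\<lambda>z. H z * norm z powr 0 * exp (- (norm z)\<^sup>2)"
  have C: "C \<ge> 0"
  proof -
    have "0 \<le> C * norm (axis undefined 1 :: complex^'n) ^ (2 * k)" using bd H0 order_trans by blast
    thus ?thesis by (simp add: norm_axis_1)
  qed
  have i0: "integrable gauss_volume ?J"
  proof (rule Bochner_Integration.integrable_bound)
    let ?G = "\<lambda>z::complex^'n. C * ((1 + norm z) powr real (2 * k) * exp (0 * norm z) * exp (- 1 * (norm z)\<^sup>2))"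
    show "integrable gauss_volume ?G" by (intro integrable_mult_right gauss_weight_integrable) simp
    show "AE z in gauss_volume. norm (?J z) \<le> norm (?G z)"
    proof (rule AE_I2)
      fix z :: "complex^'n"
      have "norm (?J z) \<le> H z * exp (- (norm z)\<^sup>2)" using H0[of z] H0[of 0] by simp
      also have "\<dots> \<le> C * norm z ^ (2 * k) * exp (- (norm z)\<^sup>2)" using bd[of z] by (intro mult_right_mono) auto
      also have "\<dots> \<le> C * (1 + norm z) powr real (2 * k) * exp (- (norm z)\<^sup>2)"
        using C power_le_powr[of z "2 * k"] by (intro mult_right_mono mult_left_mono) auto
      finally show "norm (?J z) \<le> norm (?G z)" using C by (simp add: mult.assoc)
    qed
  qed measurable
  have pos: "Gamma (real (CARD('n) + k)) > 0" "Gamma (real (CARD('n) + k) - \<kappa>) > 0"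
    using \<kappa> by (auto intro!: Gamma_real_pos add_pos_nonneg)
  have nn0: "(\<integral>\<^sup>+z. ennreal (?J z) \<partial>gauss_volume) = ennreal (\<integral>z. ?J z \<partial>gauss_volume)"
    by (intro nn_integral_eq_integral i0 AE_I2 mult_nonneg_nonneg H0) auto
  have I0: "(\<integral>z. ?J z \<partial>gauss_volume) \<ge> 0" by (intro Bochner_Integration.integral_nonneg mult_nonneg_nonneg H0) auto
  have "(\<integral>\<^sup>+z. ennreal (?I z) \<partial>gauss_volume)
     = ennreal (Gamma (real (CARD('n) + k) - \<kappa>) / Gamma (real (CARD('n) + k)) * (\<integral>z. ?J z \<partial>gauss_volume))"
  proof -
    let ?g = "Gamma (real (CARD('n) + k))"
    have "(\<integral>\<^sup>+z. ennreal (?I z) \<partial>gauss_volume) = (\<integral>\<^sup>+z. ennreal (?I z) \<partial>gauss_volume) * ennreal ?g * ennreal (1 / ?g)"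
      using pos by (simp add: mult.assoc flip: ennreal_mult)
    also have "\<dots> = ennreal (Gamma (real (CARD('n) + k) - \<kappa>)) * ennreal (\<integral>z. ?J z \<partial>gauss_volume) * ennreal (1 / ?g)"
    proof -
      have "(\<integral>\<^sup>+z. ennreal (?I z) \<partial>gauss_volume) * ennreal ?g
         = ennreal (Gamma (real (CARD('n) + k) - \<kappa>)) * (\<integral>\<^sup>+z. ennreal (?J z) \<partial>gauss_volume)"
        by (rule radial_ratio[OF H H0 hom \<kappa>])
      thus ?thesis by (simp only: nn0)
    qed
    also have "\<dots> = ennreal (Gamma (real (CARD('n) + k) - \<kappa>) / ?g * (\<integral>z. ?J z \<partial>gauss_volume))"
      using pos I0 by (simp add: mult_ac flip: ennreal_mult)
    finally show ?thesis .
  qed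
  thus ?thesis using pos I0 by (intro has_bochner_integral_nn_integral) (auto simp: H0)
qed

lemma polarization:
  "4 * (x * cnj y) = (\<Sum>j<4. \<i> ^ j * of_real ((norm (x + \<i> ^ j * y))\<^sup>2))"
proof -
  have "of_real ((norm (x + c * y))\<^sup>2) = (x + c * y) * (cnj x + cnj c * cnj y)" for c
    by (subst complex_norm_square) simp
  thus ?thesis by (simp only:) (simp add: eval_nat_numeral lessThan_Suc algebra_simps)
qed

text \<open>The radial moments are available for nonnegative functions. Polarization writes p times
  the conjugate of q as a combination of the four squares |p + i^j q|^2, each homogeneous of real
  degree 2k, and the Gamma quotient is the same for all of them.\<close>

lemma form_homogeneous:
  fixes p q :: "complex^'n \<Rightarrow> complex"
  assumes p: "entire p" "\<And>t z. p (t *s z) = t ^ k * p z" "\<And>z. norm (p z) \<le> A * norm z ^ k"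
    and q: "entire q" "\<And>t z. q (t *s z) = t ^ k * q z" "\<And>z. norm (q z) \<le> B * norm z ^ k"
    and \<kappa>: "real (CARD('n) + k) > \<kappa>"
  shows "integrable gauss_volume (form_integrand (2 * \<kappa>) p q)"
    and "form (2 * \<kappa>) p q = of_real (Gamma (real (CARD('n) + k) - \<kappa>) / Gamma (real (CARD('n) + k))) * form 0 p q"
proof -
  define \<gamma> where "\<gamma> = Gamma (real (CARD('n) + k) - \<kappa>) / Gamma (real (CARD('n) + k))"
  define H where "H = (\<lambda>j z. (norm (p z + \<i> ^ j * q z))\<^sup>2)"
  note [measurable] = entire_borel[OF p(1)] entire_borel[OF q(1)]
  have HB: "has_bochner_integral gauss_volume (\<lambda>z. H j z * norm z powr (- (2 * \<kappa>)) * exp (- (norm z)\<^sup>2))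
    (Gamma (real (CARD('n) + k) - \<kappa>) / Gamma (real (CARD('n) + k)) * (\<integral>z. H j z * norm z powr 0 * exp (- (norm z)\<^sup>2) \<partial>gauss_volume))"
    if "real (CARD('n) + k) > \<kappa>" for j \<kappa>
  proof (rule radial_integral[OF _ _ _ _ that])
    show "H j \<in> borel_measurable borel" unfolding H_def by measurable
    show "H j (t *\<^sub>R z) = t ^ (2 * k) * H j z" if "t > 0" for t z
    proof -
      have "p (t *\<^sub>R z) + \<i> ^ j * q (t *\<^sub>R z) = of_real t ^ k * (p z + \<i> ^ j * q z)"
        unfolding scaleR_eq_smult p(2) q(2) by (simp add: algebra_simps)
      thus ?thesis using that by (simp add: H_def norm_mult norm_power power_mult_distrib mult.commute[of 2] flip: power_mult)
    qed
    show "H j z \<le> (A + B)\<^sup>2 * norm z ^ (2 * k)" for z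
    proof -
      have "norm (p z + \<i> ^ j * q z) \<le> norm (p z) + norm (q z)"
        by (rule order_trans[OF norm_triangle_ineq]) (simp add: norm_mult norm_power)
      also have "\<dots> \<le> (A + B) * norm z ^ k" using p(3)[of z] q(3)[of z] by (simp add: distrib_right)
      finally have "H j z \<le> ((A + B) * norm z ^ k)\<^sup>2" unfolding H_def by (intro power_mono) auto
      thus ?thesis by (simp add: power_mult_distrib mult.commute[of 2] flip: power_mult)
    qed
  qed (simp add: H_def)
  have pol: "form_integrand \<sigma> p q z = (\<Sum>j<4. \<i> ^ j / 4 * of_real (H j z * norm z powr (- \<sigma>) * exp (- (norm z)\<^sup>2)))" for \<sigma> z
  proof -
    have "p z * cnj (q z) = (\<Sum>j<4. \<i> ^ j / 4 * of_real (H j z))"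
    proof -
      have "p z * cnj (q z) = (4 * (p z * cnj (q z))) / 4" by simp
      thus ?thesis by (simp only: polarization H_def sum_divide_distrib times_divide_eq_left)
    qed
    thus ?thesis unfolding form_integrand_def
      by (simp only: sum_distrib_right) (intro sum.cong refl, simp add: mult_ac)
  qed
  have hb: "has_bochner_integral gauss_volume (form_integrand (2 * \<kappa>) p q)
     (\<Sum>j<4. \<i> ^ j / 4 * of_real (Gamma (real (CARD('n) + k) - \<kappa>) / Gamma (real (CARD('n) + k)) * (\<integral>z. H j z * norm z powr 0 * exp (- (norm z)\<^sup>2) \<partial>gauss_volume)))"
    if "real (CARD('n) + k) > \<kappa>" for \<kappa>
    unfolding pol[abs_def]
    by (intro has_bochner_integral_sum has_bochner_integral_mult_right has_bochner_integral_of_real HB that)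
  show "integrable gauss_volume (form_integrand (2 * \<kappa>) p q)"
    using hb[OF \<kappa>] by (simp add: has_bochner_integral_iff)
  have "form (2 * \<kappa>) p q = (\<Sum>j<4. \<i> ^ j / 4 * of_real (\<gamma> * (\<integral>z. H j z * norm z powr 0 * exp (- (norm z)\<^sup>2) \<partial>gauss_volume)))"
    using hb[OF \<kappa>] by (simp add: has_bochner_integral_iff form_def \<gamma>_def)
  also have "\<dots> = of_real \<gamma> * (\<Sum>j<4. \<i> ^ j / 4 * of_real (\<integral>z. H j z * norm z powr 0 * exp (- (norm z)\<^sup>2) \<partial>gauss_volume))"
    by (simp add: sum_distrib_left mult_ac)
  also have "(\<Sum>j<4. \<i> ^ j / 4 * of_real (\<integral>z. H j z * norm z powr 0 * exp (- (norm z)\<^sup>2) \<partial>gauss_volume)) = form 0 p q"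
  proof -
    have pos: "real (CARD('n) + k) > 0" by (simp add: add_pos_nonneg)
    hence "Gamma (real (CARD('n) + k)) \<noteq> 0" using Gamma_real_pos less_imp_neq by metis
    thus ?thesis using hb[OF pos] by (simp add: has_bochner_integral_iff form_def)
  qed
  finally show "form (2 * \<kappa>) p q = of_real (Gamma (real (CARD('n) + k) - \<kappa>) / Gamma (real (CARD('n) + k))) * form 0 p q"
    by (simp add: \<gamma>_def)
qed

section \<open>The pairing on the Fock spaces\<close>

text \<open>An upper bound for the weighted sup norm, used instead of the supremum itself. With b =
  \<beta> it describes balls of F^\<infinity>, with b = \<alpha> the pointwise bounds of elements of
  F^1.\<close>

definition dominated :: "real \<Rightarrow> real \<Rightarrow> (complex^'n \<Rightarrow> complex) \<Rightarrow> bool" where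
  "dominated b M f \<longleftrightarrow> entire f \<and> (\<forall>z. norm (f z) \<le> M * Phi b (norm z))"

lemma dominatedD:
  assumes "dominated b M f"
  shows "entire f" "norm (f z) \<le> M * Phi b (norm z)" "M \<ge> 0"
proof -
  show "entire f" and b: "norm (f z) \<le> M * Phi b (norm z)" for z
    using assms by (auto simp: dominated_def)
  have "0 \<le> M * Phi b 0" using order_trans[OF norm_ge_zero b[of 0]] by simp
  thus "M \<ge> 0" by (simp add: Phi_def)
qed

lemma dominated_zero: "dominated b 0 (\<lambda>z. 0)"
  by (simp add: dominated_def entire_const)

lemma dominated_add: "dominated b M f \<Longrightarrow> dominated b N g \<Longrightarrow> dominated b (M + N) (\<lambda>z. f z + g z)"
  unfolding dominated_def by (auto simp: distrib_right intro!: entire_add norm_triangle_mono)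

lemma dominated_cmult: "dominated b M f \<Longrightarrow> dominated b (norm c * M) (\<lambda>z. c * f z)"
  unfolding dominated_def by (auto simp: norm_mult mult.assoc intro!: entire_cmult mult_left_mono)

lemma fock_weighted_eq: "fock_weighted \<beta> f z * Phi \<beta> (norm z) = norm (f z)"
proof -
  have "1 + norm z > 0" by (simp add: add_pos_nonneg)
  hence "1 + norm z \<noteq> 0" by simp
  thus ?thesis by (simp add: fock_weighted_def Phi_def exp_minus)
qed

lemma fock_weighted_le_iff: "fock_weighted \<beta> f z \<le> M \<longleftrightarrow> norm (f z) \<le> M * Phi \<beta> (norm z)"
  unfolding fock_weighted_eq[of \<beta> f z, symmetric] by (simp add: mult_le_cancel_right_pos)

lemma fock_weighted_nonneg: "fock_weighted \<beta> f z \<ge> 0"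
  by (simp add: fock_weighted_def)

lemma fock_inf_norm_le: "dominated \<beta> M f \<Longrightarrow> fock_inf_norm \<beta> f \<le> M"
  unfolding fock_inf_norm_def dominated_def fock_weighted_le_iff[symmetric] by (intro cSUP_least) auto

lemma fock_inf_iff: "f \<in> fock_inf \<beta> \<longleftrightarrow> (\<exists>M. dominated \<beta> M f)"
  by (auto simp: fock_inf_def bdd_above_def dominated_def fock_weighted_le_iff[symmetric])

lemma fock_inf_dominated: "f \<in> fock_inf \<beta> \<Longrightarrow> dominated \<beta> (fock_inf_norm \<beta> f) f"
  unfolding dominated_def fock_weighted_le_iff[symmetric] fock_inf_norm_def fock_inf_def
  by (auto intro: cSUP_upper)

lemma fock_inf0_dominated: "f \<in> fock_inf0 \<beta> \<Longrightarrow> dominated \<beta> (fock_inf_norm \<beta> f) f"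
  by (simp add: fock_inf0_def fock_inf_dominated)

lemma fock_inf0_entire: "f \<in> fock_inf0 \<beta> \<Longrightarrow> entire f"
  by (simp add: fock_inf0_def fock_inf_def)

lemma fock_inf0_add:
  assumes "f \<in> fock_inf0 \<beta>" "g \<in> fock_inf0 \<beta>" shows "(\<lambda>z. f z + g z) \<in> fock_inf0 \<beta>"
proof -
  have "((\<lambda>z. fock_weighted \<beta> f z + fock_weighted \<beta> g z) \<longlongrightarrow> 0 + 0) at_infinity"
    using assms by (intro tendsto_add) (auto simp: fock_inf0_def)
  hence l: "((\<lambda>z. fock_weighted \<beta> f z + fock_weighted \<beta> g z) \<longlongrightarrow> 0) at_infinity" by simp
  have "fock_weighted \<beta> (\<lambda>z. f z + g z) z \<le> fock_weighted \<beta> f z + fock_weighted \<beta> g z" for z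
    by (simp add: fock_weighted_le_iff distrib_right fock_weighted_eq norm_triangle_ineq)
  hence "(fock_weighted \<beta> (\<lambda>z. f z + g z) \<longlongrightarrow> 0) at_infinity"
    by (intro tendsto_sandwich[OF _ _ tendsto_const l]) (auto simp: fock_weighted_nonneg)
  thus ?thesis using assms by (auto simp: fock_inf0_def fock_inf_iff intro: dominated_add)
qed

lemma fock_inf0_cmult:
  assumes "f \<in> fock_inf0 \<beta>" shows "(\<lambda>z. c * f z) \<in> fock_inf0 \<beta>"
proof -
  have "fock_weighted \<beta> (\<lambda>z. c * f z) = (\<lambda>z. norm c * fock_weighted \<beta> f z)"
    by (simp add: fock_weighted_def norm_mult fun_eq_iff)
  moreover have "((\<lambda>z. norm c * fock_weighted \<beta> f z) \<longlongrightarrow> norm c * 0) at_infinity"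
    using assms by (intro tendsto_mult tendsto_const) (auto simp: fock_inf0_def)
  ultimately show ?thesis using assms by (auto simp: fock_inf0_def fock_inf_iff intro: dominated_cmult)
qed

lemma fock_inf0_zero: "(\<lambda>z. 0) \<in> fock_inf0 \<beta>"
  using dominated_zero by (auto simp: fock_inf0_def fock_inf_iff fock_weighted_def[abs_def])

lemma fock_inf0_diff:
  assumes "f \<in> fock_inf0 \<beta>" "g \<in> fock_inf0 \<beta>" shows "(\<lambda>z. f z - g z) \<in> fock_inf0 \<beta>"
  using fock_inf0_add[OF assms(1) fock_inf0_cmult[OF assms(2), of "-1"]] by simp

lemma fock_inf0_sum:
  "(\<And>i. i \<in> I \<Longrightarrow> f i \<in> fock_inf0 \<beta>) \<Longrightarrow> (\<lambda>z. \<Sum>i\<in>I. f i z) \<in> fock_inf0 \<beta>"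
  by (induction I rule: infinite_finite_induct) (auto intro: fock_inf0_zero fock_inf0_add)

text \<open>Finite exponential type is negligible against exp(|w|^2/2), for every \<beta>.
  Polynomials, kernels and derivatives of kernels all enter the space through this lemma.\<close>

lemma exp_growth_fock_inf0:
  fixes f :: "complex^'n \<Rightarrow> complex"
  assumes f: "entire f" and bd: "\<And>w. norm (f w) \<le> C * exp (c * norm w)"
  shows "f \<in> fock_inf0 \<beta>"
proof -
  obtain D where D: "D > 0" "\<And>r. r \<ge> 0 \<Longrightarrow> (1 + r) powr 0 * exp (c * r) \<le> D * Phi \<beta> r"
    using powr_exp_le_Phi[of 0 c \<beta>] by blast
  have C: "C \<ge> 0"
  proof -
    have "0 \<le> C * exp (c * norm (0::complex^'n))" using order_trans[OF norm_ge_zero bd[of 0]] .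
    thus ?thesis by simp
  qed
  have "norm (f w) \<le> C * D * Phi \<beta> (norm w)" for w
  proof -
    have "1 + norm w \<noteq> 0" using norm_ge_zero[of w] by linarith
    hence "exp (c * norm w) \<le> D * Phi \<beta> (norm w)" using D(2)[of "norm w"] by simp
    hence "C * exp (c * norm w) \<le> C * (D * Phi \<beta> (norm w))" using C by (rule mult_left_mono)
    thus ?thesis using bd[of w] by (simp add: mult.assoc)
  qed
  hence 1: "f \<in> fock_inf \<beta>" using f by (auto simp: fock_inf_iff dominated_def)
  let ?E = "exp ((\<bar>- \<beta>\<bar> + \<bar>c\<bar>)\<^sup>2 / (4 * (1/4)))"
  have le: "fock_weighted \<beta> f w \<le> C * ?E * exp (- (norm w)\<^sup>2 / 4)" for w
  proof -
    have "fock_weighted \<beta> f w \<le> C * exp (c * norm w) * exp (- (norm w)\<^sup>2 / 2) / (1 + norm w) powr \<beta>"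
      unfolding fock_weighted_def by (intro divide_right_mono mult_right_mono bd) auto
    also have "\<dots> = C * ((1 + norm w) powr (- \<beta>) * exp (c * norm w)) * exp (- (norm w)\<^sup>2 / 2)"
      by (simp add: powr_minus field_simps)
    also have "\<dots> \<le> C * (?E * exp (1/4 * (norm w)\<^sup>2)) * exp (- (norm w)\<^sup>2 / 2)"
      using C by (intro mult_right_mono mult_left_mono powr_exp_le_gauss) auto
    also have "\<dots> = C * ?E * exp (1/4 * (norm w)\<^sup>2 + - (norm w)\<^sup>2 / 2)" by (simp only: exp_add mult.assoc)
    also have "1/4 * (norm w)\<^sup>2 + - (norm w)\<^sup>2 / 2 = - (norm w)\<^sup>2 / 4" by simp
    finally show ?thesis .
  qed
  have "((\<lambda>r::real. C * ?E * exp (- r\<^sup>2 / 4)) \<longlongrightarrow> C * ?E * 0) at_top"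
  proof (intro tendsto_mult tendsto_const)
    have "filterlim (\<lambda>r::real. - (1/4) * r\<^sup>2) at_bot at_top"
      by (intro filterlim_tendsto_neg_mult_at_bot[OF tendsto_const] filterlim_pow_at_top filterlim_ident) auto
    from filterlim_compose[OF exp_at_bot this]
    show "((\<lambda>r::real. exp (- r\<^sup>2 / 4)) \<longlongrightarrow> 0) at_top" by simp
  qed
  from filterlim_compose[OF this filterlim_norm_at_top]
  have l: "((\<lambda>w::complex^'n. C * ?E * exp (- (norm w)\<^sup>2 / 4)) \<longlongrightarrow> 0) at_infinity" by simp
  have "(fock_weighted \<beta> f \<longlongrightarrow> 0) at_infinity"
    by (intro tendsto_sandwich[OF _ _ tendsto_const l] always_eventually allI fock_weighted_nonneg le)
  thus ?thesis using 1 by (simp add: fock_inf0_def)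
qed

lemma power_growth_fock_inf0:
  fixes f :: "complex^'n \<Rightarrow> complex"
  assumes f: "entire f" and bd: "\<And>w. norm (f w) \<le> A * norm w ^ k"
  shows "f \<in> fock_inf0 \<beta>"
proof (rule exp_growth_fock_inf0[OF f])
  fix w :: "complex^'n"
  have "A \<ge> 0"
  proof -
    have "0 \<le> A * norm (axis undefined 1 :: complex^'n) ^ k" using order_trans[OF norm_ge_zero bd] .
    thus ?thesis by (simp add: norm_axis_1)
  qed
  moreover have "norm w ^ k \<le> exp (real k * norm w)"
    using power_le_powr[of w k] one_plus_powr_le_exp[of "norm w" "real k"] by simp
  ultimately have "A * norm w ^ k \<le> A * exp (real k * norm w)" by (simp add: mult_left_mono)
  thus "norm (f w) \<le> A * exp (real k * norm w)" using bd[of w] by linarith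
qed

lemma hip_power_fock_inf0: "(\<lambda>w. hip w z ^ k) \<in> fock_inf0 \<beta>"
proof (rule power_growth_fock_inf0)
  show "entire (\<lambda>w. hip w z ^ k)" by (intro entire_power entire_hip)
  show "norm (hip w z ^ k) \<le> norm z ^ k * norm w ^ k" for w
    using power_mono[OF norm_hip_le norm_ge_zero, of w z k] by (simp add: norm_power power_mult_distrib mult.commute)
qed

section \<open>Bounded functionals and norm convergent series\<close>

text \<open>Boundedness is stated against every M that dominates f, so that explicit bounds can be
  inserted directly without computing a supremum.\<close>

definition linear_on_fock :: "real \<Rightarrow> ((complex^'n \<Rightarrow> complex) \<Rightarrow> complex) \<Rightarrow> real \<Rightarrow> bool" where
  "linear_on_fock \<beta> L C \<longleftrightarrow> C \<ge> 0 \<and>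
     (\<forall>f\<in>fock_inf0 \<beta>. \<forall>h\<in>fock_inf0 \<beta>. L (\<lambda>z. f z + h z) = L f + L h) \<and>
     (\<forall>c. \<forall>f\<in>fock_inf0 \<beta>. L (\<lambda>z. c * f z) = c * L f) \<and>
     (\<forall>f\<in>fock_inf0 \<beta>. \<forall>M. dominated \<beta> M f \<longrightarrow> norm (L f) \<le> C * M)"

lemma linear_on_fockD:
  assumes "linear_on_fock \<beta> L C"
  shows "C \<ge> 0" "f \<in> fock_inf0 \<beta> \<Longrightarrow> h \<in> fock_inf0 \<beta> \<Longrightarrow> L (\<lambda>z. f z + h z) = L f + L h"
    "f \<in> fock_inf0 \<beta> \<Longrightarrow> L (\<lambda>z. c * f z) = c * L f"
    "f \<in> fock_inf0 \<beta> \<Longrightarrow> dominated \<beta> M f \<Longrightarrow> norm (L f) \<le> C * M"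
  using assms unfolding linear_on_fock_def by blast+

lemma linear_on_fock_diff:
  assumes L: "linear_on_fock \<beta> L C" and "f \<in> fock_inf0 \<beta>" "h \<in> fock_inf0 \<beta>"
  shows "L (\<lambda>z. f z - h z) = L f - L h"
proof -
  have "L (\<lambda>z. f z + (- 1) * h z) = L f + (- 1) * L h"
    using linear_on_fockD(2)[OF L assms(2) fock_inf0_cmult[OF assms(3), of "-1"]]
      linear_on_fockD(3)[OF L assms(3), of "-1"] by simp
  thus ?thesis by simp
qed

lemma linear_on_fock_sum:
  assumes L: "linear_on_fock \<beta> L C" and "finite I" "\<And>i. i \<in> I \<Longrightarrow> f i \<in> fock_inf0 \<beta>"
  shows "L (\<lambda>z. \<Sum>i\<in>I. f i z) = (\<Sum>i\<in>I. L (f i))"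
  using assms(2,3)
proof (induction I rule: finite_induct)
  case empty
  have "norm (L (\<lambda>z. 0)) \<le> C * 0"
    by (rule linear_on_fockD(4)[OF L fock_inf0_zero dominated_zero])
  thus ?case by simp
next
  case (insert i I)
  thus ?case using linear_on_fockD(2)[OF L, of "f i" "\<lambda>z. \<Sum>i\<in>I. f i z"] fock_inf0_sum[of I f]
    by (simp add: fun_eq_iff)
qed

text \<open>The tails are dominated by tails of the summable bounds, so the pointwise convergent
  series converges in norm and L passes through it.\<close>

lemma linear_on_fock_sums:
  assumes L: "linear_on_fock \<beta> L C" and f: "\<And>k. f k \<in> fock_inf0 \<beta>"
    and dom: "\<And>k. dominated \<beta> (B k) (f k)" and B: "summable B"
    and F: "F \<in> fock_inf0 \<beta>" and sums: "\<And>w. (\<lambda>k. f k w) sums F w"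
  shows "(\<lambda>k. L (f k)) sums L F"
proof -
  have "(\<lambda>n. \<Sum>k. B (k + n)) \<longlonglongrightarrow> 0" by (rule suminf_exist_split2[OF B])
  hence lim: "(\<lambda>n. C * (\<Sum>k. B (k + n))) \<longlonglongrightarrow> 0" using tendsto_mult_right_zero by blast
  have bound: "norm ((\<Sum>k<n. L (f k)) - L F) \<le> C * (\<Sum>k. B (k + n))" for n
  proof -
    let ?S = "\<lambda>z. \<Sum>k<n. f k z"
    have S: "?S \<in> fock_inf0 \<beta>" by (intro fock_inf0_sum f)
    have D: "(\<lambda>z. F z - ?S z) \<in> fock_inf0 \<beta>" by (intro fock_inf0_diff F S)
    have "dominated \<beta> (\<Sum>k. B (k + n)) (\<lambda>z. F z - ?S z)"
      unfolding dominated_def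
    proof (intro conjI allI)
      show "entire (\<lambda>z. F z - ?S z)" using D by (rule fock_inf0_entire)
      fix z
      have s: "(\<lambda>k. f (k + n) z) sums (F z - ?S z)" by (rule sums_split_initial_segment[OF sums])
      have Bs: "summable (\<lambda>k. B (k + n))" using B by (subst summable_iff_shift)
      have "norm (\<Sum>k. f (k + n) z) \<le> (\<Sum>k. B (k + n) * Phi \<beta> (norm z))"
        using dominatedD(2)[OF dom] by (intro norm_suminf_le summable_mult2 Bs) auto
      thus "norm (F z - ?S z) \<le> (\<Sum>k. B (k + n)) * Phi \<beta> (norm z)"
        using s Bs by (simp add: sums_iff suminf_mult2)
    qed
    from linear_on_fockD(4)[OF L D this]
    have "norm (L F - L ?S) \<le> C * (\<Sum>k. B (k + n))" by (simp add: linear_on_fock_diff[OF L F S])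
    thus ?thesis by (simp add: linear_on_fock_sum[OF L _ f] norm_minus_commute)
  qed
  have "(\<lambda>n. (\<Sum>k<n. L (f k)) - L F) \<longlonglongrightarrow> 0"
    by (rule Lim_null_comparison[OF _ lim]) (use bound in simp)
  thus ?thesis unfolding sums_def by (rule Lim_null[THEN iffD2])
qed

section \<open>Low and high degree parts and the rewritten pairing\<close>

definition low :: "nat \<Rightarrow> (complex^'n \<Rightarrow> complex) \<Rightarrow> complex^'n \<Rightarrow> complex" where
  "low K f z = (\<Sum>k<K. taylor_part f k z)"

text \<open>Defined by subtraction rather than as a series, so that analyticity and growth are
  inherited at once.\<close>

definition high :: "nat \<Rightarrow> (complex^'n \<Rightarrow> complex) \<Rightarrow> complex^'n \<Rightarrow> complex" where
  "high K f z = f z - low K f z"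

lemma entire_low: "dominated b M f \<Longrightarrow> entire (low K f)"
  unfolding low_def[abs_def] using dominatedD by (intro entire_sum entire_taylor_part) blast+

lemma entire_high: "dominated b M f \<Longrightarrow> entire (high K f)"
  unfolding high_def[abs_def] using dominatedD by (intro entire_diff entire_low) blast+

lemma low_bound:
  assumes f: "dominated b M f"
  shows "norm (low K f z) \<le> real K * M * Phi b 2 * (1 + norm z) powr real K"
proof -
  note M = dominatedD(3)[OF f]
  have "norm (low K f z) \<le> (\<Sum>k<K. M * Phi b 2 * (1 + norm z) powr real K)"
    unfolding low_def
  proof (intro order_trans[OF norm_sum] sum_mono)
    fix k assume k: "k \<in> {..<K}"
    have "norm (taylor_part f k z) \<le> M * Phi b 2 / 2 ^ k * norm z ^ k"
      by (rule taylor_part_bound_power[OF dominatedD(1,2)[OF f]])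
    also have "\<dots> \<le> M * Phi b 2 / 2 ^ k * (1 + norm z) powr real k"
      using M by (intro mult_left_mono power_le_powr) auto
    also have "\<dots> \<le> M * Phi b 2 / 1 * (1 + norm z) powr real K"
      using M k by (intro mult_mono divide_left_mono powr_mono) auto
    finally show "norm (taylor_part f k z) \<le> M * Phi b 2 * (1 + norm z) powr real K" by simp
  qed
  thus ?thesis by (simp add: mult_ac)
qed

lemma dominated_low:
  assumes f: "dominated b M f" shows "dominated b (real K * M) (low K f)"
  unfolding dominated_def
proof (intro conjI allI)
  show "entire (low K f)" using f by (rule entire_low)
  have "norm (low K f z) \<le> (\<Sum>k<K. M * Phi b (norm z))" for z
    unfolding low_def by (intro order_trans[OF norm_sum] sum_mono taylor_part_bound dominatedD[OF f])
  thus "norm (low K f z) \<le> real K * M * Phi b (norm z)" for z by (simp add: mult.assoc)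
qed

lemma dominated_high:
  assumes f: "dominated b M f" shows "dominated b ((real K + 1) * M) (high K f)"
proof -
  have "dominated b (M + norm (-1 :: complex) * (real K * M)) (\<lambda>z. f z + (-1) * low K f z)"
    by (intro dominated_add f dominated_cmult dominated_low)
  thus ?thesis by (simp add: high_def[abs_def] algebra_simps)
qed

lemma high_sums:
  assumes "entire f"
  shows "(\<lambda>k. if k < K then 0 else taylor_part f k z * t ^ k) sums (f (t *s z) - (\<Sum>k<K. taylor_part f k z * t ^ k))"
proof -
  have "(\<lambda>k. if k \<in> {..<K} then taylor_part f k z * t ^ k else 0) sums (\<Sum>k<K. taylor_part f k z * t ^ k)"
    by (rule sums_If_finite_set) simp
  from sums_diff[OF taylor_part_sums[OF assms, of z t] this] show ?thesis
    by (rule sums_cong[THEN iffD1, rotated]) auto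
qed

lemma taylor_part_high:
  assumes "entire f" shows "taylor_part (high K f) k z = (if k < K then 0 else taylor_part f k z)"
proof (rule taylor_part_unique)
  fix t :: complex
  have "high K f (t *s z) = f (t *s z) - (\<Sum>k<K. taylor_part f k z * t ^ k)"
    by (simp add: high_def low_def taylor_part_smult[OF assms] mult.commute)
  moreover have "(\<lambda>k. (if k < K then 0 else taylor_part f k z) * t ^ k) = (\<lambda>k. if k < K then 0 else taylor_part f k z * t ^ k)"
    by auto
  ultimately show "(\<lambda>k. (if k < K then 0 else taylor_part f k z) * t ^ k) sums high K f (t *s z)"
    using high_sums[OF assms, of K z t] by simp
qed

lemma taylor_part_low:
  assumes "entire f" shows "taylor_part (low K f) k z = (if k < K then taylor_part f k z else 0)"
proof (rule taylor_part_unique)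
  fix t :: complex
  have "(\<lambda>k. if k \<in> {..<K} then taylor_part f k z * t ^ k else 0) sums (\<Sum>k<K. taylor_part f k z * t ^ k)"
    by (rule sums_If_finite_set) simp
  moreover have "low K f (t *s z) = (\<Sum>k<K. taylor_part f k z * t ^ k)"
    by (simp add: low_def taylor_part_smult[OF assms] mult.commute)
  moreover have "(\<lambda>k. (if k < K then taylor_part f k z else 0) * t ^ k) = (\<lambda>k. if k \<in> {..<K} then taylor_part f k z * t ^ k else 0)"
    by auto
  ultimately show "(\<lambda>k. (if k < K then taylor_part f k z else 0) * t ^ k) sums low K f (t *s z)" by simp
qed

text \<open>The zero of order K at the origin. Two such factors give |z|^(2K), which makes
  |z|^(-2\<kappa>) integrable because K + n > \<kappa>.\<close>

lemma high_bound_near_zero: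
  assumes f: "dominated b M f" and z: "norm z \<le> 1"
  shows "norm (high K f z) \<le> 2 * Phi b 2 * M * norm z ^ K"
proof -
  note M = dominatedD(3)[OF f]
  let ?D = "M * Phi b 2"
  have "(\<lambda>k. if k < K then 0 else taylor_part f k z) sums high K f z"
    using high_sums[OF dominatedD(1)[OF f], of K z 1] by (simp add: high_def low_def cong: if_cong)
  moreover have "norm (\<Sum>k. if k < K then 0 else taylor_part f k z) \<le> (\<Sum>k. ?D * norm z ^ K * (1/2) ^ k)"
  proof (rule norm_suminf_le)
    show "norm (if k < K then 0 else taylor_part f k z) \<le> ?D * norm z ^ K * (1/2) ^ k" for k
    proof (cases "k < K")
      case False
      have "norm (taylor_part f k z) \<le> ?D / 2 ^ k * norm z ^ k"
        by (rule taylor_part_bound_power[OF dominatedD(1,2)[OF f]])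
      also have "\<dots> \<le> ?D / 2 ^ k * norm z ^ K"
        using M z False by (intro mult_left_mono power_decreasing) auto
      finally show ?thesis using False by (simp add: power_divide)
    qed (use M in auto)
    show "summable (\<lambda>k. ?D * norm z ^ K * (1/2::real) ^ k)"
      by (intro summable_mult summable_geometric) simp
  qed
  moreover have "(\<Sum>k. ?D * norm z ^ K * (1/2::real) ^ k) = ?D * norm z ^ K * 2"
    using sums_mult[OF geometric_sums[of "1/2::real"], of "?D * norm z ^ K"] by (simp add: sums_iff)
  ultimately show ?thesis by (simp add: sums_iff mult_ac)
qed

lemma low_add: "entire f \<Longrightarrow> entire g \<Longrightarrow> low K (\<lambda>z. f z + g z) = (\<lambda>z. low K f z + low K g z)"
  by (simp add: low_def[abs_def] taylor_part_add sum.distrib)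

lemma low_cmult: "entire f \<Longrightarrow> low K (\<lambda>z. c * f z) = (\<lambda>z. c * low K f z)"
  by (simp add: low_def[abs_def] taylor_part_cmult sum_distrib_left)

lemma high_add: "entire f \<Longrightarrow> entire g \<Longrightarrow> high K (\<lambda>z. f z + g z) = (\<lambda>z. high K f z + high K g z)"
  by (simp add: high_def[abs_def] low_add algebra_simps)

lemma high_cmult: "entire f \<Longrightarrow> high K (\<lambda>z. c * f z) = (\<lambda>z. c * high K f z)"
  by (simp add: high_def[abs_def] low_cmult right_diff_distrib)

definition split_pairing :: "nat \<Rightarrow> real \<Rightarrow> (complex^'n \<Rightarrow> complex) \<Rightarrow> (complex^'n \<Rightarrow> complex) \<Rightarrow> complex" where
  "split_pairing K \<kappa> f g = form 0 (low K f) (low K g) + form (2 * \<kappa>) (high K f) (high K g)"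

text \<open>The floor plus 1 counts the degrees k \<le> \<sigma>/2. Below the threshold 2n the value
  0 makes \<open>low\<close> vanish and \<open>high\<close> the identity, so a single formula covers
  both cases of the pairing.\<close>

definition cutoff :: "nat \<Rightarrow> real \<Rightarrow> nat" where
  "cutoff n \<sigma> = (if \<sigma> < 2 * real n then 0 else nat \<lfloor>\<sigma> / 2\<rfloor> + 1)"

lemma cutoff_bound: "real (cutoff n \<sigma> + n) > \<sigma> / 2"
proof -
  have "\<sigma> / 2 < real (nat \<lfloor>\<sigma> / 2\<rfloor>) + 1" by linarith
  thus ?thesis by (auto simp: cutoff_def)
qed

lemma low_high_part_eq:
  fixes f :: "complex^'n \<Rightarrow> complex"
  assumes \<sigma>: "\<sigma> \<ge> 2 * real CARD('n)" and f: "dominated b M f"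
  shows "low_part (\<sigma> / 2) f = low (cutoff CARD('n) \<sigma>) f"
    and "high_part (\<sigma> / 2) f = high (cutoff CARD('n) \<sigma>) f"
proof -
  let ?K = "cutoff CARD('n) \<sigma>"
  have s0: "\<sigma> / 2 \<ge> 0" using \<sigma> by (smt (verit) of_nat_0_le_iff divide_nonneg_nonneg)
  have iff: "real k \<le> \<bar>\<sigma> / 2\<bar> \<longleftrightarrow> k < ?K" for k
    using s0 \<sigma> unfolding cutoff_def by (auto simp: le_nat_iff le_floor_iff less_Suc_eq_le)
  have hp: "homogeneous_part f = taylor_part f"
    using dominatedD[OF f] by (intro homogeneous_part_eq)
  show "low_part (\<sigma> / 2) f = low ?K f"
    unfolding low_part_def[abs_def] low_def[abs_def] hp iff by (simp add: lessThan_def)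
  have "(\<lambda>k. if k < ?K then 0 else taylor_part f k z) sums high ?K f z" for z
    using high_sums[OF dominatedD(1)[OF f], of ?K z 1] by (simp add: high_def low_def cong: if_cong)
  moreover have "(if real k > \<bar>\<sigma> / 2\<bar> then taylor_part f k z else 0) = (if k < ?K then 0 else taylor_part f k z)" for k z
    using iff[of k] by auto
  ultimately show "high_part (\<sigma> / 2) f = high ?K f"
    unfolding high_part_def[abs_def] hp by (simp add: sums_iff fun_eq_iff)
qed

lemma low_0 [simp]: "low 0 f = (\<lambda>z. 0)" by (simp add: low_def[abs_def])
lemma high_0 [simp]: "high 0 f = f" by (simp add: high_def[abs_def])

lemma pairing_eq_split:
  fixes f g :: "complex^'n \<Rightarrow> complex"
  assumes "dominated b M f" "dominated b' M' g"
  shows "pairing \<sigma> f g = split_pairing (cutoff CARD('n) \<sigma>) (\<sigma> / 2) f g"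
    and "pairing_well_defined \<sigma> f g \<longleftrightarrow>
      integrable gauss_volume (form_integrand 0 (low (cutoff CARD('n) \<sigma>) f) (low (cutoff CARD('n) \<sigma>) g)) \<and>
      integrable gauss_volume (form_integrand (2 * (\<sigma> / 2)) (high (cutoff CARD('n) \<sigma>) f) (high (cutoff CARD('n) \<sigma>) g))"
proof -
  have z: "form_integrand 0 (\<lambda>z. 0) (\<lambda>z. 0) = (\<lambda>z::complex^'n. 0)" by (simp add: form_integrand_def fun_eq_iff)
  show "pairing \<sigma> f g = split_pairing (cutoff CARD('n) \<sigma>) (\<sigma> / 2) f g"
  proof (cases "\<sigma> < 2 * real CARD('n)")
    case True
    thus ?thesis by (simp add: pairing_def split_pairing_def cutoff_def form_def z)
  next
    case False
    thus ?thesis using low_high_part_eq[OF _ assms(1), of \<sigma>] low_high_part_eq[OF _ assms(2), of \<sigma>]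
      by (simp add: pairing_def split_pairing_def)
  qed
  show "pairing_well_defined \<sigma> f g \<longleftrightarrow>
      integrable gauss_volume (form_integrand 0 (low (cutoff CARD('n) \<sigma>) f) (low (cutoff CARD('n) \<sigma>) g)) \<and>
      integrable gauss_volume (form_integrand (2 * (\<sigma> / 2)) (high (cutoff CARD('n) \<sigma>) f) (high (cutoff CARD('n) \<sigma>) g))"
  proof (cases "\<sigma> < 2 * real CARD('n)")
    case True
    thus ?thesis by (simp add: pairing_well_defined_def cutoff_def z)
  next
    case False
    thus ?thesis using low_high_part_eq[OF _ assms(1), of \<sigma>] low_high_part_eq[OF _ assms(2), of \<sigma>]
      by (simp add: pairing_well_defined_def)
  qed
qed

section \<open>Convergence and boundedness of the pairing\<close>

lemma gauss_volume_nonzero: "AE z in gauss_volume. z \<noteq> (0 :: complex^'n)"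
proof (rule AE_I)
  have "emeasure gauss_volume {0 :: complex^'n} = ennreal (1 / pi ^ CARD('n)) * emeasure lborel {0 :: complex^'n}"
    using nn_integral_gauss_volume[OF borel_measurable_indicator, of "{0} :: (complex^'n) set"] by simp
  thus "emeasure gauss_volume {0 :: complex^'n} = 0" by simp
qed auto

lemma fock_one_norm_nonneg: "fock_one_norm \<alpha> g \<ge> 0"
  unfolding fock_one_norm_def by (intro Bochner_Integration.integral_nonneg) simp

lemma fock_one_entire: "g \<in> fock_one \<alpha> \<Longrightarrow> entire g"
  by (simp add: fock_one_def)

lemma fock_one_dominated:
  "\<exists>C>0. \<forall>g\<in>(fock_one \<alpha> :: (complex^'n \<Rightarrow> complex) set). dominated \<alpha> (C * fock_one_norm \<alpha> g) g"
  using fock_one_pointwise[of \<alpha>] by (auto simp: dominated_def fock_one_def)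

lemma norm_powr_le_one_plus:
  fixes r :: real assumes "r \<ge> 1" shows "r powr c \<le> 2 powr \<bar>c\<bar> * (1 + r) powr c"
proof (cases "c \<ge> 0")
  case True
  hence "r powr c \<le> (1 + r) powr c" using assms by (intro powr_mono2) auto
  also have "\<dots> \<le> 2 powr \<bar>c\<bar> * (1 + r) powr c"
    using mult_right_mono[of 1 "2 powr \<bar>c\<bar>" "(1 + r) powr c"] by (simp add: ge_one_powr_ge_zero)
  finally show ?thesis .
next
  case False
  have "r powr c \<le> ((1 + r) / 2) powr c" using assms False by (intro powr_mono2') auto
  also have "\<dots> = 2 powr \<bar>c\<bar> * (1 + r) powr c" using assms False by (simp add: powr_divide powr_minus field_simps)
  finally show ?thesis .
qed

lemma power_weight_integrable:
  assumes "real (K + CARD('n)) > \<kappa>"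
  shows "integrable gauss_volume (\<lambda>z::complex^'n. norm z ^ (2 * K) * norm z powr (- (2 * \<kappa>)) * exp (- (norm z)\<^sup>2))"
proof -
  have "has_bochner_integral gauss_volume (\<lambda>z::complex^'n. norm z ^ (2 * K) * norm z powr (- (2 * \<kappa>)) * exp (- (norm z)\<^sup>2))
    (Gamma (real (CARD('n) + K) - \<kappa>) / Gamma (real (CARD('n) + K)) * (\<integral>z. norm (z::complex^'n) ^ (2 * K) * norm z powr 0 * exp (- (norm z)\<^sup>2) \<partial>gauss_volume))"
    using assms by (intro radial_integral[of _ K 1]) (auto simp: power_mult_distrib add.commute)
  thus ?thesis by (simp add: has_bochner_integral_iff)
qed

lemma form_integrand_borel: "entire f \<Longrightarrow> entire g \<Longrightarrow> form_integrand \<sigma> f g \<in> borel_measurable borel"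
proof -
  assume "entire f" "entire g"
  note [measurable] = entire_borel[OF \<open>entire f\<close>] measurable_compose[OF entire_borel[OF \<open>entire g\<close>] measurable_cnj]
  show ?thesis unfolding form_integrand_def[abs_def] by measurable
qed

lemma norm_form_integrand: "norm (form_integrand \<sigma> f g z) = norm (f z) * norm (g z) * (exp (- (norm z)\<^sup>2) * norm z powr (- \<sigma>))"
  by (simp add: form_integrand_def norm_mult)

lemma integrable_gauss_bound:
  fixes f :: "complex^'n \<Rightarrow> complex"
  assumes "f \<in> borel_measurable borel" "integrable gauss_volume g" "\<And>z. norm (f z) \<le> g z"
  shows "integrable gauss_volume f"
proof (rule Bochner_Integration.integrable_bound[OF assms(2)])
  show "AE z in gauss_volume. norm (f z) \<le> norm (g z)"
    using assms(3) by (intro AE_I2) (auto intro: order_trans[OF _ abs_ge_self])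
qed (use assms(1) in simp)

text \<open>The low parts are polynomials. The high parts are controlled near the origin by their
  zeros, and away from it by the sup bound of f against the integral norm of g. Every coefficient is
  controlled by the two norms, so all bounds are uniform in f and g.\<close>

lemma split_pairing_bound:
  assumes \<sigma>: "2 * \<kappa> = \<alpha> + \<beta>" and K: "real (K + CARD('n)) > \<kappa>"
  shows "\<exists>C\<ge>0. \<forall>g\<in>(fock_one \<alpha> :: (complex^'n \<Rightarrow> complex) set). \<forall>f M. dominated \<beta> M f \<longrightarrow>
     integrable gauss_volume (form_integrand 0 (low K f) (low K g)) \<and>
     integrable gauss_volume (form_integrand (2 * \<kappa>) (high K f) (high K g)) \<and>
     norm (split_pairing K \<kappa> f g) \<le> C * (M * fock_one_norm \<alpha> g)"
proof -
  obtain C1 where C1: "C1 > 0" "\<And>g :: complex^'n \<Rightarrow> complex. g \<in> fock_one \<alpha> \<Longrightarrow> dominated \<alpha> (C1 * fock_one_norm \<alpha> g) g"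
    using fock_one_dominated by blast
  \<comment> \<open>Integrable majorants: G1 for the product of the low parts, G2 for the high parts
    in the unit ball, G3 for \<open>high K f\<close> against the polynomial \<open>low K g\<close>
    outside it.\<close>
  define G1 where "G1 = (\<lambda>z::complex^'n. (1 + norm z) powr real (2 * K) * exp (0 * norm z) * exp (- 1 * (norm z)\<^sup>2))"
  define G2 where "G2 = (\<lambda>z::complex^'n. norm z ^ (2 * K) * norm z powr (- (2 * \<kappa>)) * exp (- (norm z)\<^sup>2))"
  define G3 where "G3 = (\<lambda>z::complex^'n. (1 + norm z) powr (real K - \<alpha>) * exp (0 * norm z) * exp (- (1/2) * (norm z)\<^sup>2))"
  have G1: "integrable gauss_volume G1" unfolding G1_def by (rule gauss_weight_integrable) simp
  have G2: "integrable gauss_volume G2" unfolding G2_def by (rule power_weight_integrable[OF K])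
  have G3: "integrable gauss_volume G3" unfolding G3_def by (rule gauss_weight_integrable) simp
  have Gp: "G1 z \<ge> 0" "G2 z \<ge> 0" "G3 z \<ge> 0" for z by (simp_all add: G1_def G2_def G3_def)
  define A1 where "A1 = (real K * Phi \<beta> 2) * (real K * C1 * Phi \<alpha> 2)"
  define A2 where "A2 = (2 * Phi \<beta> 2) * (2 * Phi \<alpha> 2 * C1)"
  define B where "B = (real K + 1) * 2 powr \<bar>- (2 * \<kappa>)\<bar>"
  define A3 where "A3 = B * (real K * C1 * Phi \<alpha> 2)"
  have A: "A1 \<ge> 0" "A2 \<ge> 0" "A3 \<ge> 0" "B \<ge> 0"
    using C1(1) by (auto simp: A1_def A2_def A3_def B_def intro!: mult_nonneg_nonneg)
  let ?C = "A1 * integral\<^sup>L gauss_volume G1 + (A2 * integral\<^sup>L gauss_volume G2 + B + A3 * integral\<^sup>L gauss_volume G3)"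
  have I: "integral\<^sup>L gauss_volume G1 \<ge> 0" "integral\<^sup>L gauss_volume G2 \<ge> 0" "integral\<^sup>L gauss_volume G3 \<ge> 0"
    using Gp by (intro Bochner_Integration.integral_nonneg; simp)+
  show ?thesis
  proof (intro exI[of _ ?C] conjI ballI allI impI)
    show "?C \<ge> 0" using A I by simp
    fix g f :: "complex^'n \<Rightarrow> complex" and M assume g: "g \<in> fock_one \<alpha>" and f: "dominated \<beta> M f"
    let ?N = "fock_one_norm \<alpha> g"
    note N = fock_one_norm_nonneg[of \<alpha> g] and M = dominatedD(3)[OF f] and gd = C1(2)[OF g]
    let ?w = "\<lambda>z. norm (g z) * exp (- (norm z)\<^sup>2 / 2) * (1 + norm z) powr (- \<alpha>)"
    have w: "integrable gauss_volume ?w" using g by (simp add: fock_one_def)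
    have p1: "norm (form_integrand 0 (low K f) (low K g) z) \<le> M * ?N * A1 * G1 z" for z
    proof -
      have "norm (form_integrand 0 (low K f) (low K g) z) \<le> norm (low K f z) * norm (low K g z) * (exp (- (norm z)\<^sup>2) * 1)"
        unfolding norm_form_integrand by (intro mult_left_mono) auto
      also have "\<dots> \<le> (real K * M * Phi \<beta> 2 * (1 + norm z) powr real K) * (real K * (C1 * ?N) * Phi \<alpha> 2 * (1 + norm z) powr real K) * (exp (- (norm z)\<^sup>2) * 1)"
        using low_bound[OF f, of K z] low_bound[OF gd, of K z] M by (intro mult_right_mono mult_mono) auto
      also have "\<dots> = M * ?N * A1 * G1 z"
      proof -
        have "(1 + norm z) powr real (2 * K) = (1 + norm z) powr real K * (1 + norm z) powr real K"
          by (simp flip: powr_add)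
        thus ?thesis unfolding A1_def G1_def by (simp only:) (simp add: mult_ac)
      qed
      finally show ?thesis .
    qed
    have p2: "norm (form_integrand (2 * \<kappa>) (high K f) (high K g) z) \<le> M * (?N * A2 * G2 z + B * ?w z + ?N * A3 * G3 z)" for z
    proof (cases "norm z \<le> 1")
      case True
      have "norm (form_integrand (2 * \<kappa>) (high K f) (high K g) z)
        \<le> (2 * Phi \<beta> 2 * M * norm z ^ K) * (2 * Phi \<alpha> 2 * (C1 * ?N) * norm z ^ K) * (exp (- (norm z)\<^sup>2) * norm z powr (- (2 * \<kappa>)))"
        unfolding norm_form_integrand
        using high_bound_near_zero[OF f True, of K] high_bound_near_zero[OF gd True, of K] M
        by (intro mult_right_mono mult_mono) auto
      also have "\<dots> = M * (?N * A2 * G2 z)"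
      proof -
        have "norm z ^ (2 * K) = norm z ^ K * norm z ^ K" by (simp add: mult_2 power_add)
        thus ?thesis unfolding A2_def G2_def by (simp only:) (simp add: mult_ac)
      qed
      also have "\<dots> \<le> M * (?N * A2 * G2 z + B * ?w z + ?N * A3 * G3 z)"
        using M N A Gp by (intro mult_left_mono) auto
      finally show ?thesis .
    next
      case False
      let ?r = "norm z"
      have r: "?r \<ge> 1" using False by simp
      have h1: "norm (high K f z) \<le> (real K + 1) * M * Phi \<beta> ?r"
        using dominatedD(2)[OF dominated_high[OF f]] .
      \<comment> \<open>Splitting off \<open>low K g\<close> keeps |g| itself, whose weighted
        integral is the norm. Inserting the pointwise bound of g here would leave a function that is
        not integrable.\<close>
      have h2: "norm (high K g z) \<le> norm (g z) + real K * (C1 * ?N) * Phi \<alpha> 2 * (1 + ?r) powr real K"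
        unfolding high_def using norm_triangle_ineq4[of "g z" "low K g z"] low_bound[OF gd, of K z] by linarith
      have h3: "?r powr (- (2 * \<kappa>)) \<le> 2 powr \<bar>- (2 * \<kappa>)\<bar> * (1 + ?r) powr (- (2 * \<kappa>))"
        using norm_powr_le_one_plus[OF r] .
      have "norm (form_integrand (2 * \<kappa>) (high K f) (high K g) z)
        \<le> ((real K + 1) * M * Phi \<beta> ?r) * (norm (g z) + real K * (C1 * ?N) * Phi \<alpha> 2 * (1 + ?r) powr real K)
          * (exp (- ?r\<^sup>2) * (2 powr \<bar>- (2 * \<kappa>)\<bar> * (1 + ?r) powr (- (2 * \<kappa>))))"
        unfolding norm_form_integrand
      proof (intro mult_mono[OF mult_mono[OF h1 h2] mult_left_mono[OF h3]])
        have X: "0 \<le> (real K + 1) * M * Phi \<beta> ?r" using M by simp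
        thus "0 \<le> (real K + 1) * M * Phi \<beta> ?r" .
        have "0 \<le> norm (g z) + real K * (C1 * ?N) * Phi \<alpha> 2 * (1 + ?r) powr real K"
          using order_trans[OF norm_ge_zero h2] .
        with X show "0 \<le> (real K + 1) * M * Phi \<beta> ?r * (norm (g z) + real K * (C1 * ?N) * Phi \<alpha> 2 * (1 + ?r) powr real K)"
          by (rule mult_nonneg_nonneg)
      qed simp_all
      also have "\<dots> = M * B * (Phi \<beta> ?r * exp (- ?r\<^sup>2) * (1 + ?r) powr (- (2 * \<kappa>)))
          * (norm (g z) + real K * (C1 * ?N) * Phi \<alpha> 2 * (1 + ?r) powr real K)"
        by (simp add: B_def mult_ac)
      \<comment> \<open>Since \<beta> - 2 \<kappa> = -\<alpha>, the growth of f and the weight of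
        the pairing combine to the weight of F^1.\<close>
      also have "Phi \<beta> ?r * exp (- ?r\<^sup>2) * (1 + ?r) powr (- (2 * \<kappa>)) = exp (- ?r\<^sup>2 / 2) * (1 + ?r) powr (- \<alpha>)"
      proof -
        have "exp (?r\<^sup>2 / 2) * exp (- ?r\<^sup>2) = exp (- ?r\<^sup>2 / 2)" by (simp flip: exp_add)
        moreover have "(1 + ?r) powr \<beta> * (1 + ?r) powr (- (2 * \<kappa>)) = (1 + ?r) powr (- \<alpha>)"
          using \<sigma> by (simp flip: powr_add)
        moreover have "Phi \<beta> ?r * exp (- ?r\<^sup>2) * (1 + ?r) powr (- (2 * \<kappa>))
            = (exp (?r\<^sup>2 / 2) * exp (- ?r\<^sup>2)) * ((1 + ?r) powr \<beta> * (1 + ?r) powr (- (2 * \<kappa>)))"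
          by (simp add: Phi_def)
        ultimately show ?thesis by (simp only:)
      qed
      also have "M * B * (exp (- ?r\<^sup>2 / 2) * (1 + ?r) powr (- \<alpha>)) * (norm (g z) + real K * (C1 * ?N) * Phi \<alpha> 2 * (1 + ?r) powr real K)
         = M * (B * ?w z + ?N * A3 * G3 z)"
      proof -
        have "exp (- ?r\<^sup>2 / 2) * (1 + ?r) powr (- \<alpha>) * (1 + ?r) powr real K = G3 z"
        proof -
          have "(1 + ?r) powr (- \<alpha>) * (1 + ?r) powr real K = (1 + ?r) powr (real K - \<alpha>)" by (simp flip: powr_add)
          thus ?thesis by (simp add: G3_def mult_ac)
        qed
        hence "M * B * (exp (- ?r\<^sup>2 / 2) * (1 + ?r) powr (- \<alpha>)) * (real K * (C1 * ?N) * Phi \<alpha> 2 * (1 + ?r) powr real K) = M * (?N * A3 * G3 z)"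
          by (simp add: A3_def mult_ac)
        thus ?thesis by (simp add: algebra_simps)
      qed
      also have "\<dots> \<le> M * (?N * A2 * G2 z + B * ?w z + ?N * A3 * G3 z)"
        using M N A Gp by (intro mult_left_mono) auto
      finally show ?thesis .
    qed
    note ent = entire_low[OF f] entire_low[OF gd] entire_high[OF f] entire_high[OF gd]
    have i1: "integrable gauss_volume (\<lambda>z. M * ?N * A1 * G1 z)" by (intro integrable_mult_right G1)
    have i2: "integrable gauss_volume (\<lambda>z. M * (?N * A2 * G2 z + B * ?w z + ?N * A3 * G3 z))"
      by (intro integrable_mult_right Bochner_Integration.integrable_add G2 G3 w)
    show j1: "integrable gauss_volume (form_integrand 0 (low K f) (low K g))"
      by (rule integrable_gauss_bound[OF form_integrand_borel[OF ent(1,2)] i1 p1])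
    show j2: "integrable gauss_volume (form_integrand (2 * \<kappa>) (high K f) (high K g))"
      by (rule integrable_gauss_bound[OF form_integrand_borel[OF ent(3,4)] i2 p2])
    have b1: "norm (form 0 (low K f) (low K g)) \<le> M * ?N * A1 * integral\<^sup>L gauss_volume G1"
      unfolding form_def using Bochner_Integration.integral_norm_bound_integral[OF j1 i1 p1] by simp
    have "norm (form (2 * \<kappa>) (high K f) (high K g)) \<le> (\<integral>z. M * (?N * A2 * G2 z + B * ?w z + ?N * A3 * G3 z) \<partial>gauss_volume)"
      unfolding form_def by (rule Bochner_Integration.integral_norm_bound_integral[OF j2 i2 p2])
    also have "\<dots> = M * (?N * A2 * integral\<^sup>L gauss_volume G2 + B * ?N + ?N * A3 * integral\<^sup>L gauss_volume G3)"
      using G2 G3 w by (simp add: fock_one_norm_def)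
    finally have b2: "norm (form (2 * \<kappa>) (high K f) (high K g)) \<le> \<dots>" .
    show "norm (split_pairing K \<kappa> f g) \<le> ?C * (M * ?N)"
      unfolding split_pairing_def using norm_triangle_le[OF add_mono[OF b1 b2]] by (simp add: algebra_simps)
  qed
qed

lemma split_pairing_linear:
  assumes \<sigma>: "2 * \<kappa> = \<alpha> + \<beta>" and K: "real (K + CARD('n)) > \<kappa>"
  shows "\<exists>C\<ge>0. \<forall>g\<in>(fock_one \<alpha> :: (complex^'n \<Rightarrow> complex) set).
     linear_on_fock \<beta> (\<lambda>f. split_pairing K \<kappa> f g) (C * fock_one_norm \<alpha> g)"
proof -
  obtain C where C: "C \<ge> 0" "\<And>(g :: complex^'n \<Rightarrow> complex) f M. g \<in> fock_one \<alpha> \<Longrightarrow> dominated \<beta> M f \<Longrightarrow>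
     integrable gauss_volume (form_integrand 0 (low K f) (low K g)) \<and>
     integrable gauss_volume (form_integrand (2 * \<kappa>) (high K f) (high K g)) \<and>
     norm (split_pairing K \<kappa> f g) \<le> C * (M * fock_one_norm \<alpha> g)"
    using split_pairing_bound[OF assms] by blast
  show ?thesis
  proof (intro exI[of _ C] conjI ballI C(1))
    fix g :: "complex^'n \<Rightarrow> complex" assume g: "g \<in> fock_one \<alpha>"
    have int: "integrable gauss_volume (form_integrand 0 (low K f) (low K g))"
       "integrable gauss_volume (form_integrand (2 * \<kappa>) (high K f) (high K g))" if "f \<in> fock_inf0 \<beta>" for f
      using C(2)[OF g fock_inf0_dominated[OF that]] by auto
    show "linear_on_fock \<beta> (\<lambda>f. split_pairing K \<kappa> f g) (C * fock_one_norm \<alpha> g)"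
      unfolding linear_on_fock_def
    proof (intro conjI ballI allI impI)
      show "C * fock_one_norm \<alpha> g \<ge> 0" using C(1) fock_one_norm_nonneg[of \<alpha> g] by simp
      fix f :: "complex^'n \<Rightarrow> complex" assume f: "f \<in> fock_inf0 \<beta>"
      show "norm (split_pairing K \<kappa> f g) \<le> C * fock_one_norm \<alpha> g * M" if "dominated \<beta> M f" for M
        using C(2)[OF g that] by (simp add: mult_ac)
      have cm: "form_integrand \<sigma> (\<lambda>z. c * u z) v = (\<lambda>z. c * form_integrand \<sigma> u v z)" for \<sigma> c and u v :: "complex^'n \<Rightarrow> complex"
        by (simp add: form_integrand_def fun_eq_iff)
      show "split_pairing K \<kappa> (\<lambda>z. c * f z) g = c * split_pairing K \<kappa> f g" for c
        by (simp add: split_pairing_def low_cmult high_cmult fock_inf0_entire[OF f] form_def cm distrib_left)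
      fix h :: "complex^'n \<Rightarrow> complex" assume h: "h \<in> fock_inf0 \<beta>"
      have ad: "form_integrand \<sigma> (\<lambda>z. u z + u' z) v = (\<lambda>z. form_integrand \<sigma> u v z + form_integrand \<sigma> u' v z)" for \<sigma> and u u' v :: "complex^'n \<Rightarrow> complex"
        by (simp add: form_integrand_def fun_eq_iff distrib_right)
      show "split_pairing K \<kappa> (\<lambda>z. f z + h z) g = split_pairing K \<kappa> f g + split_pairing K \<kappa> h g"
        using int[OF f] int[OF h]
        by (simp add: split_pairing_def low_add high_add fock_inf0_entire[OF f] fock_inf0_entire[OF h] form_def ad)
    qed
  qed
qed

section \<open>The pairing with homogeneous polynomials\<close>

text \<open>Orthogonality of different degrees for a radial weight. The majorant has to serve for
  all rotations of h at once, because the proof averages over them.\<close>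

lemma form_taylor_part:
  fixes p h :: "complex^'n \<Rightarrow> complex"
  assumes p: "entire p" "\<And>t z. p (t *s z) = t ^ k * p z" and h: "entire h"
    and G: "integrable gauss_volume G"
    and bound: "\<And>\<omega> z. norm \<omega> = 1 \<Longrightarrow> norm (p z) * norm (h (\<omega> *s z)) * (exp (- (norm z)\<^sup>2) * norm z powr (- \<sigma>)) \<le> G z"
  shows "form \<sigma> p h = form \<sigma> p (taylor_part h k)"
  unfolding form_def form_integrand_def
proof (rule integral_taylor_part[OF h entire_borel[OF p(1)] p(2) _ _ G])
  show "(\<lambda>z::complex^'n. exp (- (norm z)\<^sup>2) * norm z powr (- \<sigma>)) \<in> borel_measurable borel" by measurable
  show "norm (p z * h (\<omega> *s z) * of_real (exp (- (norm z)\<^sup>2) * norm z powr (- \<sigma>))) \<le> G z" if "norm \<omega> = 1" for \<omega> z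
    using bound[OF that, of z] by (simp add: norm_mult)
qed (auto simp: norm_smult_complex)

lemma form_zero_taylor_part:
  fixes p h :: "complex^'n \<Rightarrow> complex"
  assumes p: "entire p" "\<And>t z. p (t *s z) = t ^ k * p z" "\<And>z. norm (p z) \<le> A * norm z ^ k"
    and h: "dominated b M h"
  shows "form 0 p h = form 0 p (taylor_part h k)"
proof (rule form_taylor_part[OF p(1,2) dominatedD(1)[OF h]])
  let ?G = "\<lambda>z::complex^'n. \<bar>A\<bar> * M * ((1 + norm z) powr (real k + b) * exp (0 * norm z) * exp (- (1/2) * (norm z)\<^sup>2))"
  show "integrable gauss_volume ?G" by (intro integrable_mult_right gauss_weight_integrable) simp
  fix \<omega> :: complex and z :: "complex^'n" assume \<omega>: "norm \<omega> = 1"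
  have "norm (p z) \<le> \<bar>A\<bar> * norm z ^ k"
    using p(3)[of z] mult_right_mono[OF abs_ge_self, of "norm z ^ k" A] by simp
  also have "\<dots> \<le> \<bar>A\<bar> * (1 + norm z) powr real k" by (intro mult_left_mono power_le_powr) auto
  finally have 1: "norm (p z) \<le> \<bar>A\<bar> * (1 + norm z) powr real k" .
  have 2: "norm (h (\<omega> *s z)) \<le> M * Phi b (norm z)"
    using dominatedD(2)[OF h, of "\<omega> *s z"] \<omega> by (simp add: norm_smult_complex)
  have "norm (p z) * norm (h (\<omega> *s z)) * (exp (- (norm z)\<^sup>2) * norm z powr (- 0))
     \<le> (\<bar>A\<bar> * (1 + norm z) powr real k) * (M * Phi b (norm z)) * (exp (- (norm z)\<^sup>2) * 1)"
    using 1 2 dominatedD(3)[OF h] by (intro mult_mono) auto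
  also have "\<dots> = \<bar>A\<bar> * M * ((1 + norm z) powr (real k + b) * (exp ((norm z)\<^sup>2 / 2) * exp (- (norm z)\<^sup>2)))"
    by (simp add: Phi_def powr_add mult_ac)
  also have "exp ((norm z)\<^sup>2 / 2) * exp (- (norm z)\<^sup>2) = exp (- (1/2) * (norm z)\<^sup>2)" by (simp flip: exp_add)
  finally show "norm (p z) * norm (h (\<omega> *s z)) * (exp (- (norm z)\<^sup>2) * norm z powr (- 0)) \<le> ?G z" by simp
qed

lemma form_high_taylor_part:
  fixes p h :: "complex^'n \<Rightarrow> complex"
  assumes p: "entire p" "\<And>t z. p (t *s z) = t ^ k * p z" "\<And>z. norm (p z) \<le> A * norm z ^ k"
    and h: "dominated b M h" and k: "k \<ge> K" and K: "real (K + CARD('n)) > \<kappa>"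
  shows "form (2 * \<kappa>) p (high K h) = form (2 * \<kappa>) p (taylor_part (high K h) k)"
proof (rule form_taylor_part[OF p(1,2) entire_high[OF h]])
  let ?G1 = "\<lambda>z::complex^'n. \<bar>A\<bar> * (2 * Phi b 2 * M) * (norm z ^ (2 * K) * norm z powr (- (2 * \<kappa>)) * exp (- (norm z)\<^sup>2))"
  let ?B = "\<bar>A\<bar> * ((real K + 1) * M) * 2 powr \<bar>- (2 * \<kappa>)\<bar>"
  let ?G2 = "\<lambda>z::complex^'n. ?B * ((1 + norm z) powr (real k + b + - (2 * \<kappa>)) * exp (0 * norm z) * exp (- (1/2) * (norm z)\<^sup>2))"
  show "integrable gauss_volume (\<lambda>z. ?G1 z + ?G2 z)"
    by (intro Bochner_Integration.integrable_add integrable_mult_right gauss_weight_integrable power_weight_integrable K) simp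
  note M = dominatedD(3)[OF h]
  fix \<omega> :: complex and z :: "complex^'n" assume \<omega>: "norm \<omega> = 1"
  have pz: "norm (p z) \<le> \<bar>A\<bar> * norm z ^ k"
    using p(3)[of z] mult_right_mono[OF abs_ge_self, of "norm z ^ k" A] by simp
  have g1: "?G1 z \<ge> 0" and g2: "?G2 z \<ge> 0" using M by simp_all
  show "norm (p z) * norm (high K h (\<omega> *s z)) * (exp (- (norm z)\<^sup>2) * norm z powr (- (2 * \<kappa>))) \<le> ?G1 z + ?G2 z"
  proof (cases "norm z \<le> 1")
    case True
    have "norm z ^ k \<le> norm z ^ K" using True k by (intro power_decreasing) auto
    hence 1: "norm (p z) \<le> \<bar>A\<bar> * norm z ^ K"
      using pz mult_left_mono[of "norm z ^ k" "norm z ^ K" "\<bar>A\<bar>"] by linarith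
    have 2: "norm (high K h (\<omega> *s z)) \<le> 2 * Phi b 2 * M * norm z ^ K"
      using high_bound_near_zero[OF h, of "\<omega> *s z" K] \<omega> True by (simp add: norm_smult_complex)
    have "norm (p z) * norm (high K h (\<omega> *s z)) * (exp (- (norm z)\<^sup>2) * norm z powr (- (2 * \<kappa>)))
       \<le> (\<bar>A\<bar> * norm z ^ K) * (2 * Phi b 2 * M * norm z ^ K) * (exp (- (norm z)\<^sup>2) * norm z powr (- (2 * \<kappa>)))"
      using 1 2 by (intro mult_right_mono mult_mono) auto
    also have "\<dots> = ?G1 z"
    proof -
      have "norm z ^ (2 * K) = norm z ^ K * norm z ^ K" by (simp add: mult_2 power_add)
      thus ?thesis by (simp only:) (simp add: mult_ac)
    qed
    finally show ?thesis using g2 by linarith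
  next
    case False
    have 1: "norm (p z) \<le> \<bar>A\<bar> * (1 + norm z) powr real k"
      using pz mult_left_mono[OF power_le_powr[of z k], of "\<bar>A\<bar>"] by linarith
    have 2: "norm (high K h (\<omega> *s z)) \<le> (real K + 1) * M * Phi b (norm z)"
      using dominatedD(2)[OF dominated_high[OF h], of K "\<omega> *s z"] \<omega> by (simp add: norm_smult_complex)
    have 3: "norm z powr (- (2 * \<kappa>)) \<le> 2 powr \<bar>- (2 * \<kappa>)\<bar> * (1 + norm z) powr (- (2 * \<kappa>))"
      using norm_powr_le_one_plus[of "norm z" "- (2 * \<kappa>)"] False by simp
    have "norm (p z) * norm (high K h (\<omega> *s z)) * (exp (- (norm z)\<^sup>2) * norm z powr (- (2 * \<kappa>)))
       \<le> (\<bar>A\<bar> * (1 + norm z) powr real k) * ((real K + 1) * M * Phi b (norm z)) * (exp (- (norm z)\<^sup>2) * (2 powr \<bar>- (2 * \<kappa>)\<bar> * (1 + norm z) powr (- (2 * \<kappa>))))"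
      using 1 2 3 M by (intro mult_mono) auto
    also have "\<dots> = ?B * ((1 + norm z) powr (real k + b + - (2 * \<kappa>)) * (exp ((norm z)\<^sup>2 / 2) * exp (- (norm z)\<^sup>2)))"
      unfolding Phi_def powr_add by (simp add: mult_ac)
    also have "exp ((norm z)\<^sup>2 / 2) * exp (- (norm z)\<^sup>2) = exp (- (1/2) * (norm z)\<^sup>2)" by (simp flip: exp_add)
    finally have "norm (p z) * norm (high K h (\<omega> *s z)) * (exp (- (norm z)\<^sup>2) * norm z powr (- (2 * \<kappa>))) \<le> ?G2 z" by simp
    thus ?thesis using g1 by linarith
  qed
qed

text \<open>A homogeneous p lies entirely in the low or entirely in the high part, so one summand
  survives. In the low case it is already the Gaussian form; in the high case orthogonality leaves
  two polynomials of equal degree, and \<open>form_homogeneous\<close> supplies the Gamma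
  quotient.\<close>

lemma split_pairing_homogeneous:
  fixes p g :: "complex^'n \<Rightarrow> complex"
  assumes p: "entire p" "\<And>t z. p (t *s z) = t ^ k * p z" "\<And>z. norm (p z) \<le> A * norm z ^ k"
    and g: "dominated b M g" and K: "real (K + CARD('n)) > \<kappa>"
  shows "split_pairing K \<kappa> p g = of_real (1 / mu CARD('n) K \<kappa> k) * form 0 p g"
proof -
  note tp = taylor_part_homogeneous[of p, OF p(2)]
  note eg = dominatedD(1)[OF g]
  have lowp: "low K p = (if k < K then p else (\<lambda>z. 0))"
    by (auto simp: low_def fun_eq_iff tp)
  have highp: "high K p = (if k < K then (\<lambda>z. 0) else p)"
    by (auto simp: high_def lowp fun_eq_iff)
  have z: "form \<sigma> (\<lambda>z. 0) v = 0" for \<sigma> and v :: "complex^'n \<Rightarrow> complex"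
    by (simp add: form_def form_integrand_def)
  have f0: "form 0 p g = form 0 p (taylor_part g k)" by (rule form_zero_taylor_part[OF p g])
  show ?thesis
  proof (cases "k < K")
    case True
    have "form 0 p (low K g) = form 0 p (taylor_part (low K g) k)"
      by (rule form_zero_taylor_part[OF p dominated_low[OF g]])
    also have "taylor_part (low K g) k = taylor_part g k"
      using True by (simp add: fun_eq_iff taylor_part_low[OF eg])
    finally show ?thesis using True f0 by (simp add: split_pairing_def lowp highp z mu_def)
  next
    case False
    have "form (2 * \<kappa>) p (high K g) = form (2 * \<kappa>) p (taylor_part (high K g) k)"
      using False by (intro form_high_taylor_part[OF p g _ K]) auto
    also have "taylor_part (high K g) k = taylor_part g k"
      using False by (simp add: fun_eq_iff taylor_part_high[OF eg])
    also have "form (2 * \<kappa>) p (taylor_part g k) = of_real (Gamma (real (CARD('n) + k) - \<kappa>) / Gamma (real (CARD('n) + k))) * form 0 p (taylor_part g k)"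
    proof (rule form_homogeneous(2)[OF p])
      show "entire (taylor_part g k)" using dominatedD[OF g] by (intro entire_taylor_part)
      show "taylor_part g k (t *s z) = t ^ k * taylor_part g k z" for t z by (rule taylor_part_smult[OF eg])
      show "norm (taylor_part g k z) \<le> M * Phi b 2 / 2 ^ k * norm z ^ k" for z
        using dominatedD[OF g] by (intro taylor_part_bound_power)
      show "real (CARD('n) + k) > \<kappa>" using K False by simp
    qed
    finally show ?thesis using False f0 by (simp add: split_pairing_def lowp highp z mu_def)
  qed
qed

lemma form_zero_hip_power:
  fixes g :: "complex^'n \<Rightarrow> complex"
  assumes g: "dominated b M g"
  shows "form 0 (\<lambda>w. hip w z ^ k) g = cnj (fact k * taylor_part g k z)"
proof -
  have "fact k * taylor_part g k z = (\<integral>w. g w * hip z w ^ k * of_real (exp (- (norm w)\<^sup>2)) \<partial>gauss_volume)"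
    using taylor_part_integral[OF dominatedD(1,2)[OF g], of k z] by simp
  hence "cnj (fact k * taylor_part g k z) = (\<integral>w. cnj (g w * hip z w ^ k * of_real (exp (- (norm w)\<^sup>2))) \<partial>gauss_volume)"
    by (simp only: Bochner_Integration.integral_cnj)
  also have "\<dots> = form 0 (\<lambda>w. hip w z ^ k) g"
    unfolding form_def
  proof (rule integral_cong_AE)
    note [measurable] = measurable_compose[OF entire_borel[OF dominatedD(1)[OF g]] measurable_cnj] entire_borel[OF entire_hip]
    show "form_integrand 0 (\<lambda>w. hip w z ^ k) g \<in> borel_measurable gauss_volume"
      using form_integrand_borel[OF entire_power[OF entire_hip] dominatedD(1)[OF g]] by simp
    show "(\<lambda>w. cnj (g w * hip z w ^ k * of_real (exp (- (norm w)\<^sup>2)))) \<in> borel_measurable gauss_volume"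
      by (simp add: cnj_hip)
    \<comment> \<open>The form with exponent 0 contains \<open>norm w powr 0\<close>, which is 0 and
      not 1 at the origin; equality can be claimed only off that null set.\<close>
    show "AE w in gauss_volume. cnj (g w * hip z w ^ k * of_real (exp (- (norm w)\<^sup>2))) = form_integrand 0 (\<lambda>w. hip w z ^ k) g w"
      using gauss_volume_nonzero by eventually_elim (simp add: form_integrand_def cnj_hip)
  qed
  finally show ?thesis by simp
qed

section \<open>The kernels that represent point evaluation\<close>

text \<open>The function \<open>Q_z\<close> of the overview, with z as parameter and w as
  variable.\<close>

definition dual_kernel :: "nat \<Rightarrow> real \<Rightarrow> complex^'n \<Rightarrow> complex^'n \<Rightarrow> complex" where
  "dual_kernel K \<kappa> z w = Psi CARD('n) K \<kappa> (hip w z)"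

lemma card_ge_1: "CARD('n::finite) \<ge> 1"
  by (simp add: Suc_le_eq)

lemma dual_kernel_fock_inf0:
  assumes "real (K + CARD('n)) > \<kappa>"
  shows "(dual_kernel K \<kappa> z :: complex^'n \<Rightarrow> complex) \<in> fock_inf0 \<beta>"
proof -
  obtain C where C: "C > 0" "\<And>x. norm (Psi CARD('n) K \<kappa> x) \<le> C * exp (4 * norm x)"
    using Psi_bound[OF card_ge_1 assms] by blast
  show ?thesis unfolding dual_kernel_def[abs_def]
  proof (rule exp_growth_fock_inf0)
    show "entire (\<lambda>w. Psi CARD('n) K \<kappa> (hip w z))"
      by (rule entire_compose[OF Psi_holomorphic[OF card_ge_1 assms] entire_hip])
    show "norm (Psi CARD('n) K \<kappa> (hip w z)) \<le> C * exp ((4 * norm z) * norm w)" for w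
    proof -
      have "4 * norm (hip w z) \<le> (4 * norm z) * norm w" using norm_hip_le[of w z] by (simp add: mult.commute)
      hence "C * exp (4 * norm (hip w z)) \<le> C * exp ((4 * norm z) * norm w)" using C(1) by simp
      thus ?thesis using C(2)[of "hip w z"] by linarith
    qed
  qed
qed

text \<open>The geometric factor in \<open>Psi_term_bound\<close> makes the kernel series converge
  in norm, so every bounded functional may be applied term by term.\<close>

lemma dual_kernel_functional_sums:
  fixes z :: "complex^'n"
  assumes L: "linear_on_fock \<beta> L C" and K: "real (K + CARD('n)) > \<kappa>"
  shows "(\<lambda>k. of_real (mu CARD('n) K \<kappa> k) / fact k * L (\<lambda>w. hip w z ^ k)) sums L (dual_kernel K \<kappa> z)"
proof -
  obtain A where A: "A > 0" "\<And>k x. norm (of_real (mu CARD('n) K \<kappa> k) / fact k * x ^ k :: complex) \<le> A * (1/2) ^ k * exp (4 * norm x)"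
    using Psi_term_bound[OF card_ge_1 K] by blast
  obtain D where D: "D > 0" "\<And>r. r \<ge> 0 \<Longrightarrow> (1 + r) powr 0 * exp ((4 * norm z) * r) \<le> D * Phi \<beta> r"
    using powr_exp_le_Phi[of 0 "4 * norm z" \<beta>] by blast
  let ?f = "\<lambda>k w. of_real (mu CARD('n) K \<kappa> k) / fact k * hip w z ^ k"
  have "(\<lambda>k. L (?f k)) sums L (dual_kernel K \<kappa> z)"
  proof (rule linear_on_fock_sums[OF L])
    show f: "?f k \<in> fock_inf0 \<beta>" for k by (intro fock_inf0_cmult hip_power_fock_inf0)
    show "summable (\<lambda>k. A * (1/2::real) ^ k * D)" by (intro summable_mult2 summable_mult summable_geometric) simp
    show "dual_kernel K \<kappa> z \<in> fock_inf0 \<beta>" by (rule dual_kernel_fock_inf0[OF K])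
    show "(\<lambda>k. ?f k w) sums dual_kernel K \<kappa> z w" for w
      unfolding dual_kernel_def by (rule Psi_sums[OF card_ge_1 K])
    show "dominated \<beta> (A * (1/2) ^ k * D) (?f k)" for k
      unfolding dominated_def
    proof (intro conjI allI)
      show "entire (?f k)" using f by (rule fock_inf0_entire)
      fix w :: "complex^'n"
      have "1 + norm w \<noteq> 0" using norm_ge_zero[of w] by linarith
      hence e: "exp ((4 * norm z) * norm w) \<le> D * Phi \<beta> (norm w)" using D(2)[of "norm w"] by simp
      have "4 * norm (hip w z) \<le> (4 * norm z) * norm w" using norm_hip_le[of w z] by (simp add: mult.commute)
      hence "exp (4 * norm (hip w z)) \<le> exp ((4 * norm z) * norm w)" by simp
      hence "exp (4 * norm (hip w z)) \<le> D * Phi \<beta> (norm w)" using e by linarith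
      hence "A * (1/2) ^ k * exp (4 * norm (hip w z)) \<le> A * (1/2) ^ k * (D * Phi \<beta> (norm w))"
        using A(1) by (intro mult_left_mono) auto
      thus "norm (?f k w) \<le> A * (1/2) ^ k * D * Phi \<beta> (norm w)"
        using A(2)[of k "hip w z"] by (simp add: mult.assoc)
    qed
  qed
  moreover have "L (?f k) = of_real (mu CARD('n) K \<kappa> k) / fact k * L (\<lambda>w. hip w z ^ k)" for k
    by (rule linear_on_fockD(3)[OF L hip_power_fock_inf0])
  ultimately show ?thesis by simp
qed

text \<open>The pairing divides degree k by \<open>mu\<close>, which the kernel was built to
  multiply in; what remains is the sum of the conjugated Taylor parts of g at z.\<close>

lemma split_pairing_dual_kernel:
  fixes g :: "complex^'n \<Rightarrow> complex"
  assumes \<sigma>: "2 * \<kappa> = \<alpha> + \<beta>" and K: "real (K + CARD('n)) > \<kappa>" and g: "g \<in> fock_one \<alpha>"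
  shows "split_pairing K \<kappa> (dual_kernel K \<kappa> z) g = cnj (g z)"
proof -
  obtain C where L: "linear_on_fock \<beta> (\<lambda>f. split_pairing K \<kappa> f g) (C * fock_one_norm \<alpha> g)"
    using split_pairing_linear[OF \<sigma> K] g by blast
  obtain M where gd: "dominated \<alpha> M g" using fock_one_dominated g by blast
  have "(\<lambda>k. of_real (mu CARD('n) K \<kappa> k) / fact k * split_pairing K \<kappa> (\<lambda>w. hip w z ^ k) g) sums split_pairing K \<kappa> (dual_kernel K \<kappa> z) g"
    by (rule dual_kernel_functional_sums[OF L K])
  moreover have eq: "of_real (mu CARD('n) K \<kappa> k) / fact k * split_pairing K \<kappa> (\<lambda>w. hip w z ^ k) g = cnj (taylor_part g k z)" for k
  proof -
    have "split_pairing K \<kappa> (\<lambda>w. hip w z ^ k) g = of_real (1 / mu CARD('n) K \<kappa> k) * form 0 (\<lambda>w. hip w z ^ k) g"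
    proof (rule split_pairing_homogeneous[OF _ _ _ gd K])
      show "entire (\<lambda>w. hip w z ^ k)" by (intro entire_power entire_hip)
      show "hip (t *s w) z ^ k = t ^ k * hip w z ^ k" for t w by (simp add: hip_smult_left power_mult_distrib)
      show "norm (hip w z ^ k) \<le> norm z ^ k * norm w ^ k" for w
        using power_mono[OF norm_hip_le norm_ge_zero, of w z k] by (simp add: norm_power power_mult_distrib mult.commute)
    qed
    moreover have "mu CARD('n) K \<kappa> k > 0" by (rule mu_pos[OF card_ge_1 K])
    ultimately show ?thesis by (simp add: form_zero_hip_power[OF gd])
  qed
  moreover have "(\<lambda>k. cnj (taylor_part g k z)) sums cnj (g z)"
    using taylor_part_sums_self[OF fock_one_entire[OF g]] by (simp add: sums_cnj)
  ultimately show ?thesis by (simp only: eq sums_iff)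
qed

section \<open>Determination by the kernels\<close>

text \<open>Outside a large ball both f and its dilate are small relative to the weight, by
  vanishing at infinity; inside it uniform continuity applies once r is close to 1.\<close>

lemma dilation_approx:
  fixes f :: "complex^'n \<Rightarrow> complex"
  assumes f: "f \<in> fock_inf0 \<beta>" and \<epsilon>: "\<epsilon> > 0"
  shows "\<exists>r. 0 < r \<and> r < 1 \<and> dominated \<beta> \<epsilon> (\<lambda>z. f z - f (complex_of_real r *s z))"
proof -
  let ?E = "exp (\<beta>\<^sup>2 / 2)"
  \<comment> \<open>Far out, f contributes \<delta> and its dilate at most \<delta> (1 + E), where E
    is the loss in \<open>Phi_mono_up_to\<close>.\<close>
  define \<delta> where "\<delta> = \<epsilon> / (2 + ?E)"
  have den: "2 + ?E > 0" by (simp add: add_pos_pos)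
  have \<delta>: "\<delta> > 0" using \<epsilon> den by (simp add: \<delta>_def)
  have \<delta>\<epsilon>: "\<delta> * (2 + ?E) = \<epsilon>" using den by (simp add: \<delta>_def)
  have ef: "entire f" by (rule fock_inf0_entire[OF f])
  have "(fock_weighted \<beta> f \<longlongrightarrow> 0) at_infinity" using f by (simp add: fock_inf0_def)
  hence "eventually (\<lambda>z. dist (fock_weighted \<beta> f z) 0 < \<delta>) at_infinity" using \<delta> by (rule tendstoD)
  then obtain R0 where R0: "\<And>z. norm z \<ge> R0 \<Longrightarrow> dist (fock_weighted \<beta> f z) 0 < \<delta>"
    unfolding eventually_at_infinity by blast
  have far: "norm (f z) \<le> \<delta> * Phi \<beta> (norm z)" if "norm z \<ge> R0" for z
    using R0[OF that] by (simp add: dist_norm fock_weighted_nonneg flip: fock_weighted_le_iff)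
  have "compact (f ` cball 0 R0)" by (intro compact_continuous_image entire_continuous ef compact_cball)
  then obtain B0 where B0: "\<And>z. z \<in> cball 0 R0 \<Longrightarrow> norm (f z) \<le> B0"
    by (meson bounded_iff compact_imp_bounded imageI)
  obtain C where C: "C > 0" "\<And>r. r \<ge> 0 \<Longrightarrow> r ^ 1 \<le> C * Phi \<beta> r" using power_le_Phi by blast
  \<comment> \<open>The dilate of a far point may still lie within R0, where only the bound B0 is
    known. Beyond R even B0 is at most \<delta> times the weight, because the norm of z is at most C
    times the weight.\<close>
  define R where "R = max 1 (max R0 (\<bar>B0\<bar> * C / \<delta>))"
  have R: "R \<ge> R0" "R > 0" "R \<ge> \<bar>B0\<bar> * C / \<delta>" by (auto simp: R_def)
  have B0_far: "B0 \<le> \<delta> * Phi \<beta> (norm z)" if "norm z \<ge> R" for z :: "complex^'n"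
  proof -
    have "\<bar>B0\<bar> * C / \<delta> \<le> norm z" using that R by linarith
    hence "\<bar>B0\<bar> * C \<le> \<delta> * norm z" using \<delta> by (simp add: field_simps)
    also have "\<dots> \<le> \<delta> * (C * Phi \<beta> (norm z))" using C(2)[of "norm z"] \<delta> by (intro mult_left_mono) auto
    finally have "\<bar>B0\<bar> * C \<le> (\<delta> * Phi \<beta> (norm z)) * C" by (simp add: mult_ac)
    hence "\<bar>B0\<bar> \<le> \<delta> * Phi \<beta> (norm z)" using C(1) by (simp only: mult_le_cancel_right_pos)
    thus ?thesis by linarith
  qed
  have Phi_low: "Phi \<beta> x \<ge> 1 / ?E" if "x \<ge> 0" for x
  proof -
    have "Phi \<beta> 0 \<le> ?E * Phi \<beta> x" using that by (intro Phi_mono_up_to) auto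
    thus ?thesis by (simp add: Phi_def field_simps)
  qed
  have "uniformly_continuous_on (cball 0 R) f"
    by (intro compact_uniformly_continuous entire_continuous ef compact_cball)
  moreover have eE: "\<epsilon> / ?E > 0" using \<epsilon> by simp
  ultimately obtain d where d: "d > 0" "\<And>x y. x \<in> cball 0 R \<Longrightarrow> y \<in> cball 0 R \<Longrightarrow> dist y x < d \<Longrightarrow> dist (f y) (f x) < \<epsilon> / ?E"
    unfolding uniformly_continuous_on_def by meson
  \<comment> \<open>Dilation moves a point of the ball by at most (1 - r) R \<le> d/2, less than the
    modulus d of uniform continuity.\<close>
  define r where "r = max (1/2) (1 - d / (2 * R))"
  have r: "0 < r" "r < 1" "(1 - r) * R < d"
  proof -
    show "0 < r" by (simp add: r_def)
    show "r < 1" using d(1) R(2) by (simp add: r_def)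
    have "(1 - r) * R \<le> d / (2 * R) * R" using R(2) by (intro mult_right_mono) (auto simp: r_def)
    also have "\<dots> < d" using R(2) d(1) by simp
    finally show "(1 - r) * R < d" .
  qed
  have "norm (f z - f (complex_of_real r *s z)) \<le> \<epsilon> * Phi \<beta> (norm z)" for z
  proof (cases "norm z \<le> R")
    case True
    let ?y = "complex_of_real r *s z"
    have ny: "norm ?y = r * norm z" using r by (simp add: norm_smult_complex)
    have "r * norm z \<le> 1 * norm z" using r by (intro mult_right_mono) auto
    hence y: "?y \<in> cball 0 R" using True ny by simp
    have "z - ?y = complex_of_real (1 - r) *s z" by (simp add: vec_eq_iff algebra_simps)
    hence "dist z ?y = (1 - r) * norm z" using r by (simp add: dist_norm norm_smult_complex del: of_real_diff)
    also have "\<dots> \<le> (1 - r) * R" using True r by (intro mult_left_mono) auto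
    finally have "dist z ?y < d" using r(3) by linarith
    hence "dist (f z) (f ?y) < \<epsilon> / ?E" using d(2)[OF y, of z] True by simp
    also have "\<epsilon> / ?E = \<epsilon> * (1 / ?E)" by simp
    also have "\<dots> \<le> \<epsilon> * Phi \<beta> (norm z)" using \<epsilon> by (intro mult_left_mono Phi_low) auto
    finally show ?thesis by (simp add: dist_norm)
  next
    case False
    let ?P = "Phi \<beta> (norm z)"
    let ?y = "complex_of_real r *s z"
    have ny: "norm ?y = r * norm z" using r by (simp add: norm_smult_complex)
    have rz: "r * norm z \<le> norm z" using mult_right_mono[of r 1 "norm z"] r by simp
    have 1: "norm (f z) \<le> \<delta> * ?P" using far[of z] False R(1) by simp
    have 2: "norm (f ?y) \<le> \<delta> * ((1 + ?E) * ?P)"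
    proof (cases "norm ?y \<ge> R0")
      case True
      have "norm (f ?y) \<le> \<delta> * Phi \<beta> (norm ?y)" by (rule far[OF True])
      also have "\<dots> \<le> \<delta> * (?E * ?P)"
        unfolding ny using \<delta> r rz by (intro mult_left_mono Phi_mono_up_to) auto
      also have "\<dots> \<le> \<delta> * ((1 + ?E) * ?P)" using \<delta> by (intro mult_left_mono mult_right_mono) auto
      finally show ?thesis .
    next
      case False
      hence "norm (f ?y) \<le> B0" by (intro B0) simp
      also have "B0 \<le> \<delta> * ?P" using \<open>\<not> norm z \<le> R\<close> by (intro B0_far) simp
      also have "\<dots> \<le> \<delta> * ((1 + ?E) * ?P)"
        using \<delta> mult_right_mono[of 1 "1 + ?E" ?P] by (intro mult_left_mono) auto
      finally show ?thesis .
    qed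
    have "norm (f z - f ?y) \<le> \<delta> * ?P + \<delta> * ((1 + ?E) * ?P)"
      using norm_triangle_ineq4[of "f z" "f ?y"] 1 2 by linarith
    also have "\<dots> = (\<delta> * (2 + ?E)) * ?P" by (simp add: algebra_simps)
    finally show ?thesis by (simp only: \<delta>\<epsilon>)
  qed
  moreover have "entire (\<lambda>z. f z - f (complex_of_real r *s z))"
    by (intro entire_diff entire_smult ef)
  ultimately have "dominated \<beta> \<epsilon> (\<lambda>z. f z - f (complex_of_real r *s z))" by (simp add: dominated_def)
  thus ?thesis using r by blast
qed

lemma monomial_fock_inf0: "monomial m \<in> fock_inf0 \<beta>"
  by (rule power_growth_fock_inf0[OF entire_monomial, of _ 1 "\<Sum>i\<in>UNIV. m i"]) (simp add: norm_monomial_le)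

lemma taylor_part_fock_inf0:
  assumes "dominated b M f" shows "taylor_part f k \<in> fock_inf0 \<beta>"
  by (rule power_growth_fock_inf0[OF entire_taylor_part[OF dominatedD(1,2)[OF assms]] taylor_part_bound_power[OF dominatedD(1,2)[OF assms]]])

text \<open>Replacing z by the conjugate of t times z multiplies the degree k term by t^k. The
  values of L on these kernels form a power series in t that vanishes identically, hence each
  coefficient is 0, and \<open>mu\<close> is positive.\<close>

lemma functional_hip_power_zero:
  fixes L :: "(complex^'n \<Rightarrow> complex) \<Rightarrow> complex"
  assumes L: "linear_on_fock \<beta> L C" and K: "real (K + CARD('n)) > \<kappa>"
    and zero: "\<And>z. L (dual_kernel K \<kappa> z) = 0"
  shows "L (\<lambda>w. hip w z ^ k) = 0"
proof -
  define a where "a = (\<lambda>k. of_real (mu CARD('n) K \<kappa> k) / fact k * L (\<lambda>w. hip w z ^ k))"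
  have "(\<lambda>k. a k * t ^ k) sums 0" for t
  proof -
    have "(\<lambda>k. of_real (mu CARD('n) K \<kappa> k) / fact k * L (\<lambda>w. hip w (cnj t *s z) ^ k)) sums 0"
      using dual_kernel_functional_sums[OF L K, of "cnj t *s z"] by (simp only: zero)
    moreover have "L (\<lambda>w. hip w (cnj t *s z) ^ k) = t ^ k * L (\<lambda>w. hip w z ^ k)" for k
    proof -
      have "(\<lambda>w. hip w (cnj t *s z) ^ k) = (\<lambda>w. t ^ k * hip w z ^ k)"
        by (simp add: hip_smult_right power_mult_distrib)
      thus ?thesis using linear_on_fockD(3)[OF L hip_power_fock_inf0, of "t ^ k" z k] by simp
    qed
    ultimately show ?thesis by (simp add: a_def mult_ac)
  qed
  hence "fact k * a k = (deriv ^^ k) (\<lambda>t. 0) 0" by (rule power_series_entire(2)[symmetric])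
  also have "\<dots> = fact k * 0" by (rule power_series_entire(2)[of "\<lambda>k. 0"]) simp
  finally have "a k = 0" by simp
  moreover have "mu CARD('n) K \<kappa> k > 0" by (rule mu_pos[OF card_ge_1 K])
  ultimately show ?thesis by (simp add: a_def)
qed

text \<open>The Taylor part is an average of the functions w \<mapsto> <w, v>^k over v. As only
  finitely many monomials occur, L can be moved under this integral through the coefficients, with
  no vector-valued integration.\<close>

lemma functional_taylor_part_zero:
  fixes L :: "(complex^'n \<Rightarrow> complex) \<Rightarrow> complex"
  assumes L: "linear_on_fock \<beta> L C" and zero: "\<And>z k. L (\<lambda>w. hip w z ^ k) = 0"
    and f: "dominated b M f"
  shows "L (taylor_part f k) = 0"
proof -
  note fd = dominatedD(1,2)[OF f]
  obtain N where N: "\<And>z w :: complex^'n. hip z w ^ k = (\<Sum>m\<in>multi_indices k. of_nat (N m) * monomial m z * cnj (monomial m w))"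
    using hip_power_expansion by blast
  let ?e = "\<lambda>v::complex^'n. complex_of_real (exp (- (norm v)\<^sup>2))"
  let ?I = "\<lambda>m. \<integral>v. f v * cnj (monomial m v) * ?e v \<partial>gauss_volume"
  have comb: "L (\<lambda>z. \<Sum>m\<in>multi_indices k. c m * monomial m z) = (\<Sum>m\<in>multi_indices k. c m * L (monomial m))" for c
  proof -
    have "L (\<lambda>z. \<Sum>m\<in>multi_indices k. c m * monomial m z) = (\<Sum>m\<in>multi_indices k. L (\<lambda>z. c m * monomial m z))"
      by (rule linear_on_fock_sum[OF L finite_multi_indices]) (intro fock_inf0_cmult monomial_fock_inf0)
    thus ?thesis by (simp only: linear_on_fockD(3)[OF L monomial_fock_inf0])
  qed
  have z: "(\<Sum>m\<in>multi_indices k. (of_nat (N m) * cnj (monomial m v)) * L (monomial m)) = 0" for v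
  proof -
    have "(\<lambda>w. hip w v ^ k) = (\<lambda>w. \<Sum>m\<in>multi_indices k. (of_nat (N m) * cnj (monomial m v)) * monomial m w)"
      unfolding N by (simp add: mult_ac)
    hence "L (\<lambda>w. hip w v ^ k) = (\<Sum>m\<in>multi_indices k. (of_nat (N m) * cnj (monomial m v)) * L (monomial m))"
      by (simp only: comb)
    thus ?thesis by (simp only: zero)
  qed
  have "taylor_part f k = (\<lambda>z. \<Sum>m\<in>multi_indices k. (of_nat (N m) / fact k * ?I m) * monomial m z)"
    by (intro ext) (rule taylor_part_expansion[OF fd N])
  hence "L (taylor_part f k) = (\<Sum>m\<in>multi_indices k. (of_nat (N m) / fact k * ?I m) * L (monomial m))"
    by (simp only: comb)
  also have "\<dots> = (\<Sum>m\<in>multi_indices k. \<integral>v. (of_nat (N m) * L (monomial m) / fact k) * (f v * cnj (monomial m v) * ?e v) \<partial>gauss_volume)"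
    by (intro sum.cong refl) simp
  also have "\<dots> = (\<integral>v. (\<Sum>m\<in>multi_indices k. (of_nat (N m) * L (monomial m) / fact k) * (f v * cnj (monomial m v) * ?e v)) \<partial>gauss_volume)"
    by (rule Bochner_Integration.integral_sum[symmetric]) (intro integrable_mult_right growth_monomial_integrable[OF fd])
  also have "\<dots> = (\<integral>v. f v * ?e v / fact k * (\<Sum>m\<in>multi_indices k. (of_nat (N m) * cnj (monomial m v)) * L (monomial m)) \<partial>gauss_volume)"
    by (simp add: sum_distrib_left mult_ac)
  also have "\<dots> = 0" by (simp only: z) simp
  finally show ?thesis .
qed

text \<open>The dilations \<open>f (r z)\<close> with \<open>r < 1\<close> have norm convergent homogeneous expansions and
  approximate \<open>f\<close>, so a functional that kills the kernels kills everything.\<close>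

lemma functional_zero:
  fixes L :: "(complex^'n \<Rightarrow> complex) \<Rightarrow> complex"
  assumes L: "linear_on_fock \<beta> L C" and K: "real (K + CARD('n)) > \<kappa>"
    and zero: "\<And>z. L (dual_kernel K \<kappa> z) = 0" and f: "f \<in> fock_inf0 \<beta>"
  shows "L f = 0"
proof -
  define N where "N = fock_inf_norm \<beta> f"
  have fd: "dominated \<beta> N f" unfolding N_def by (rule fock_inf0_dominated[OF f])
  note ef = dominatedD(1)[OF fd]
  have tp: "L (taylor_part f k) = 0" for k
    by (rule functional_taylor_part_zero[OF L functional_hip_power_zero[OF L K zero] fd])
  have tX: "taylor_part f k \<in> fock_inf0 \<beta>" for k by (rule taylor_part_fock_inf0[OF fd])
  have le: "norm (L f) \<le> C * \<epsilon>" if \<epsilon>: "\<epsilon> > 0" for \<epsilon>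
  proof -
    obtain r where r: "0 < r" "r < 1" and dom: "dominated \<beta> \<epsilon> (\<lambda>z. f z - f (complex_of_real r *s z))"
      using dilation_approx[OF f \<epsilon>] by blast
    let ?fr = "\<lambda>z. f (complex_of_real r *s z)"
    let ?g = "\<lambda>k z. complex_of_real r ^ k * taylor_part f k z"
    have g: "?g k \<in> fock_inf0 \<beta>" for k by (rule fock_inf0_cmult[OF tX])
    \<comment> \<open>The Taylor parts of f are only uniformly bounded in norm; the dilation
      contributes the factor r^k that makes the bounds summable.\<close>
    have gd: "dominated \<beta> (r ^ k * N) (?g k)" for k
    proof -
      have "dominated \<beta> N (taylor_part f k)"
        using taylor_part_bound[OF dominatedD(1,2)[OF fd]] fock_inf0_entire[OF tX] by (simp add: dominated_def)
      from dominated_cmult[OF this, of "complex_of_real r ^ k"] show ?thesis using r by (simp add: norm_power)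
    qed
    have sm: "summable (\<lambda>k. r ^ k * N)" using r by (intro summable_mult2 summable_geometric) simp
    have gs: "(\<lambda>k. ?g k w) sums ?fr w" for w
      using taylor_part_sums[OF ef, of w "complex_of_real r"] by (simp add: mult.commute)
    have frX: "?fr \<in> fock_inf0 \<beta>"
    proof -
      have le: "fock_weighted \<beta> ?fr z \<le> exp (\<beta>\<^sup>2 / 2) * fock_weighted \<beta> f (complex_of_real r *s z)" for z
      proof -
        let ?y = "complex_of_real r *s z"
        have ny: "norm ?y = r * norm z" using r by (simp add: norm_smult_complex)
        have rz: "r * norm z \<le> norm z" using mult_right_mono[of r 1 "norm z"] r by simp
        have "norm (f ?y) = fock_weighted \<beta> f ?y * Phi \<beta> (norm ?y)" by (simp add: fock_weighted_eq)
        also have "\<dots> \<le> fock_weighted \<beta> f ?y * (exp (\<beta>\<^sup>2 / 2) * Phi \<beta> (norm z))"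
          unfolding ny using r rz by (intro mult_left_mono Phi_mono_up_to fock_weighted_nonneg) auto
        finally show ?thesis by (simp add: fock_weighted_le_iff mult_ac)
      qed
      have fl: "filterlim (\<lambda>z::complex^'n. complex_of_real r *s z) at_infinity at_infinity"
        unfolding filterlim_at_infinity_conv_norm_at_top norm_smult_complex
        by (rule filterlim_tendsto_pos_mult_at_top[OF tendsto_const _ filterlim_norm_at_top]) (use r in simp)
      have "(fock_weighted \<beta> f \<longlongrightarrow> 0) at_infinity" using f by (simp add: fock_inf0_def)
      from tendsto_mult[OF tendsto_const filterlim_compose[OF this fl], of "exp (\<beta>\<^sup>2 / 2)"]
      have l: "((\<lambda>z. exp (\<beta>\<^sup>2 / 2) * fock_weighted \<beta> f (complex_of_real r *s z)) \<longlongrightarrow> 0) at_infinity" by simp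
      have "(fock_weighted \<beta> ?fr \<longlongrightarrow> 0) at_infinity"
        by (intro tendsto_sandwich[OF _ _ tendsto_const l] always_eventually allI fock_weighted_nonneg le)
      moreover have "?fr \<in> fock_inf \<beta>"
      proof -
        have "dominated \<beta> (N + norm (-1 :: complex) * \<epsilon>) (\<lambda>z. f z + (-1) * (f z - ?fr z))"
          by (intro dominated_add fd dominated_cmult dom)
        thus ?thesis by (auto simp: fock_inf_iff)
      qed
      ultimately show ?thesis by (simp add: fock_inf0_def)
    qed
    have "(\<lambda>k. L (?g k)) sums L ?fr" by (rule linear_on_fock_sums[OF L g gd sm frX gs])
    moreover have "L (?g k) = 0" for k
      using linear_on_fockD(3)[OF L tX, of "complex_of_real r ^ k" k] tp[of k] by simp
    ultimately have "L ?fr = 0" by (simp add: sums_iff)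
    hence "L f = L (\<lambda>z. f z - ?fr z)" by (simp add: linear_on_fock_diff[OF L f frX])
    thus ?thesis using linear_on_fockD(4)[OF L fock_inf0_diff[OF f frX] dom] by simp
  qed
  have "norm (L f) \<le> 0 + \<epsilon>" if "\<epsilon> > 0" for \<epsilon>
  proof -
    have C: "C \<ge> 0" by (rule linear_on_fockD(1)[OF L])
    have "norm (L f) \<le> C * (\<epsilon> / (C + 1))" using that C by (intro le) simp
    also have "\<dots> \<le> (C + 1) * (\<epsilon> / (C + 1))" using that C by (intro mult_right_mono) auto
    also have "\<dots> = \<epsilon>" using C by simp
    finally show ?thesis by simp
  qed
  hence "norm (L f) \<le> 0" by (rule field_le_epsilon)
  thus ?thesis by simp
qed

section \<open>The representing function\<close>

text \<open>Cauchy's estimate on discs of radius 1 preserves the exponential type, so the first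
  derivative and the quadratic remainder of a function of this type stay in the space.\<close>

lemma holomorphic_exp_growth_Taylor:
  fixes \<Psi> :: "complex \<Rightarrow> complex"
  assumes hol: "\<Psi> holomorphic_on UNIV" and bd: "\<And>x. norm (\<Psi> x) \<le> C * exp (c * norm x)"
    and c: "c \<ge> 0"
  shows "norm (deriv \<Psi> x) \<le> C * exp (c * (norm x + 1))"
    and "norm (\<Psi> (x + y) - \<Psi> x - deriv \<Psi> x * y) \<le> 2 * C * exp (c * (norm x + norm y + 1)) * (norm y)\<^sup>2"
proof -
  have C: "C \<ge> 0"
  proof -
    have "0 \<le> C * exp (c * norm (0::complex))" using order_trans[OF norm_ge_zero bd[of 0]] .
    thus ?thesis by simp
  qed
  have Cauchy: "norm ((deriv ^^ k) \<Psi> v) \<le> fact k * (C * exp (c * (norm v + 1))) / 1 ^ k" for k v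
  proof (rule Cauchy_inequality)
    show "\<Psi> holomorphic_on ball v 1" "continuous_on (cball v 1) \<Psi>"
      using hol holomorphic_on_subset holomorphic_on_imp_continuous_on by blast+
    show "norm (\<Psi> u) \<le> C * exp (c * (norm v + 1))" if "norm (v - u) = 1" for u
    proof -
      have "norm u \<le> norm v + 1" using that norm_triangle_ineq2[of u v] by (simp add: norm_minus_commute)
      hence "c * norm u \<le> c * (norm v + 1)" using c by (rule mult_left_mono)
      hence "C * exp (c * norm u) \<le> C * exp (c * (norm v + 1))" using C by (intro mult_left_mono) simp
      thus ?thesis using bd[of u] by linarith
    qed
  qed simp
  show "norm (deriv \<Psi> x) \<le> C * exp (c * (norm x + 1))" using Cauchy[of 1 x] by simp
  define f where "f = (\<lambda>i. (deriv ^^ i) \<Psi>)"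
  let ?S = "cball (0::complex) (norm x + norm y)"
  let ?B = "2 * C * exp (c * (norm x + norm y + 1))"
  have der: "(f i has_field_derivative f (Suc i) v) (at v within ?S)" for i v
  proof -
    have "f i holomorphic_on UNIV" unfolding f_def using hol by (intro holomorphic_higher_deriv) auto
    hence "(f i has_field_derivative deriv (f i) v) (at v)" by (rule holomorphic_derivI) auto
    thus ?thesis by (simp add: f_def has_field_derivative_at_within)
  qed
  have B: "norm (f (Suc 1) v) \<le> ?B" if "v \<in> ?S" for v
  proof -
    have "norm (f (Suc 1) v) \<le> 2 * (C * exp (c * (norm v + 1)))"
      using Cauchy[of 2 v] by (simp add: f_def numeral_2_eq_2)
    also have "\<dots> \<le> 2 * (C * exp (c * (norm x + norm y + 1)))"
    proof -
      have "c * (norm v + 1) \<le> c * (norm x + norm y + 1)" using that c by (intro mult_left_mono) auto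
      thus ?thesis using C by (intro mult_left_mono) auto
    qed
    finally show ?thesis by simp
  qed
  have xS: "x \<in> ?S" by simp
  have yS: "x + y \<in> ?S" by (simp add: norm_triangle_ineq)
  have "norm (f 0 (x + y) - (\<Sum>i\<le>1. f i x * ((x + y) - x) ^ i / fact i)) \<le> ?B * norm ((x + y) - x) ^ Suc 1 / fact 1"
    by (rule complex_Taylor[OF convex_cball der B xS yS])
  thus "norm (\<Psi> (x + y) - \<Psi> x - deriv \<Psi> x * y) \<le> ?B * (norm y)\<^sup>2"
    by (simp add: f_def power2_eq_square diff_diff_eq)
qed

text \<open>Differentiation under L: the first-order Taylor remainder of z \<mapsto>
  \<open>dual_kernel K \<kappa> z\<close> has norm O(|h|^2) in the space. The kernel is conjugate
  holomorphic in z, and the outer conjugation restores complex linearity of the derivative.\<close>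

lemma entire_functional_kernel:
  fixes L :: "(complex^'n \<Rightarrow> complex) \<Rightarrow> complex"
  assumes L: "linear_on_fock \<beta> L C" and K: "real (K + CARD('n)) > \<kappa>"
  shows "entire (\<lambda>z. cnj (L (dual_kernel K \<kappa> z)))"
proof -
  define \<Psi> where "\<Psi> = Psi CARD('n) K \<kappa>"
  have hol: "\<Psi> holomorphic_on UNIV" unfolding \<Psi>_def by (rule Psi_holomorphic[OF card_ge_1 K])
  hence hol': "deriv \<Psi> holomorphic_on UNIV" by (rule holomorphic_deriv) simp
  obtain A where A: "A > 0" "\<And>x. norm (\<Psi> x) \<le> A * exp (4 * norm x)"
    unfolding \<Psi>_def using Psi_bound[OF card_ge_1 K] by blast
  note T = holomorphic_exp_growth_Taylor[OF hol A(2)]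
  \<comment> \<open>The derivative of the kernel with respect to z in direction h, as a function of
    w.\<close>
  define d where "d = (\<lambda>(z::complex^'n) h w. deriv \<Psi> (hip w z) * hip w h)"
  have hipn: "norm (hip w z) \<le> norm z * norm w" for z w :: "complex^'n"
    using norm_hip_le[of w z] by (simp add: mult.commute)
  have dent: "entire (d z h)" for z h
    unfolding d_def by (intro entire_mult entire_compose[OF hol' entire_hip] entire_hip)
  have dbound: "norm (d z h w) \<le> norm h * (A * exp 4 * exp ((4 * norm z + 1) * norm w))" for z h w :: "complex^'n"
  proof -
    have "norm (deriv \<Psi> (hip w z)) \<le> A * exp (4 * (norm (hip w z) + 1))" by (rule T(1)) simp
    also have "\<dots> \<le> A * exp (4 * (norm z * norm w + 1))" using hipn[of w z] A(1) by simp
    finally have 1: "norm (deriv \<Psi> (hip w z)) \<le> A * exp (4 * (norm z * norm w + 1))" .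
    have "norm w \<le> exp (norm w)" using exp_ge_add_one_self[of "norm w"] by linarith
    hence 2: "norm (hip w h) \<le> norm h * exp (norm w)"
      using hipn[of w h] mult_left_mono[of "norm w" "exp (norm w)" "norm h"] by (meson norm_ge_zero order_trans)
    have "norm (d z h w) \<le> (A * exp (4 * (norm z * norm w + 1))) * (norm h * exp (norm w))"
      unfolding d_def norm_mult using 1 2 A(1) by (intro mult_mono) auto
    also have "\<dots> = norm h * (A * (exp (4 * (norm z * norm w + 1)) * exp (norm w)))" by (simp add: mult_ac)
    also have "exp (4 * (norm z * norm w + 1)) * exp (norm w) = exp 4 * exp ((4 * norm z + 1) * norm w)"
      by (simp add: algebra_simps flip: exp_add)
    finally show ?thesis by (simp add: mult_ac)
  qed
  have dX: "d z h \<in> fock_inf0 \<beta>" for z h :: "complex^'n"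
  proof (rule exp_growth_fock_inf0[OF dent])
    show "norm (d z h w) \<le> (norm h * (A * exp 4)) * exp ((4 * norm z + 1) * norm w)" for w
      using dbound[of z h w] by (simp add: mult.assoc)
  qed
  define D where "D = (\<lambda>z h. cnj (L (d z h)))"
  have D_add: "D z (h + h') = D z h + D z h'" for z h h'
  proof -
    have "d z (h + h') = (\<lambda>w. d z h w + d z h' w)" by (simp add: d_def hip_add_right distrib_left)
    thus ?thesis by (simp add: D_def linear_on_fockD(2)[OF L dX dX])
  qed
  have D_smult: "D z (c *s h) = c * D z h" for z c h
  proof -
    have "d z (c *s h) = (\<lambda>w. cnj c * d z h w)" by (simp add: d_def hip_smult_right mult_ac)
    thus ?thesis by (simp add: D_def linear_on_fockD(3)[OF L dX])
  qed
  have "((\<lambda>z. cnj (L (dual_kernel K \<kappa> z))) has_derivative D z) (at z)" for z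
  proof -
    obtain B1 where B1: "B1 > 0" "\<And>r. r \<ge> 0 \<Longrightarrow> (1 + r) powr 0 * exp ((4 * norm z + 1) * r) \<le> B1 * Phi \<beta> r"
      using powr_exp_le_Phi[of 0 "4 * norm z + 1" \<beta>] by blast
    obtain B2 where B2: "B2 > 0" "\<And>r. r \<ge> 0 \<Longrightarrow> (1 + r) powr 2 * exp (4 * (norm z + 1) * r) \<le> B2 * Phi \<beta> r"
      using powr_exp_le_Phi[of 2 "4 * (norm z + 1)" \<beta>] by blast
    have "dominated \<beta> (norm h * (A * exp 4 * B1)) (d z h)" for h
      unfolding dominated_def
    proof (intro conjI allI dent)
      fix w :: "complex^'n"
      have "1 + norm w \<noteq> 0" using norm_ge_zero[of w] by linarith
      hence "exp ((4 * norm z + 1) * norm w) \<le> B1 * Phi \<beta> (norm w)" using B1(2)[of "norm w"] by simp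
      hence "norm h * (A * exp 4 * exp ((4 * norm z + 1) * norm w)) \<le> norm h * (A * exp 4 * (B1 * Phi \<beta> (norm w)))"
        using A(1) by (intro mult_left_mono) auto
      thus "norm (d z h w) \<le> norm h * (A * exp 4 * B1) * Phi \<beta> (norm w)"
        using dbound[of z h w] by (simp add: mult.assoc)
    qed
    hence Db: "norm (D z h) \<le> norm h * (C * (A * exp 4 * B1))" for h
      using linear_on_fockD(4)[OF L dX, of "norm h * (A * exp 4 * B1)" z h] by (simp add: D_def mult_ac)
    have bl: "bounded_linear (D z)"
    proof (rule bounded_linear_intro[OF D_add _ Db])
      show "D z (r *\<^sub>R h) = r *\<^sub>R D z h" for r h
        by (simp add: scaleR_eq_smult D_smult scaleR_conv_of_real)
    qed
    let ?g = "\<lambda>z. cnj (L (dual_kernel K \<kappa> z))"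
    let ?M = "C * (2 * A * exp 4 * B2)"
    have rem: "norm (?g (z + h) - ?g z - D z h) \<le> ?M * (norm h)\<^sup>2" if h: "norm h \<le> 1" for h
    proof -
      let ?F = "\<lambda>w. dual_kernel K \<kappa> (z + h) w - dual_kernel K \<kappa> z w - d z h w"
      note QX = dual_kernel_fock_inf0[OF K, where \<beta> = \<beta>]
      have FX: "?F \<in> fock_inf0 \<beta>" by (intro fock_inf0_diff QX dX)
      have "dominated \<beta> (2 * A * exp 4 * B2 * (norm h)\<^sup>2) ?F"
        unfolding dominated_def
      proof (intro conjI allI)
        show "entire ?F" by (rule fock_inf0_entire[OF FX])
        fix w :: "complex^'n"
        let ?r = "norm w"
        have nh: "norm h * ?r \<le> 1 * ?r" using h by (intro mult_right_mono) auto
        have "norm (hip w z) + norm (hip w h) + 1 \<le> (norm z + 1) * ?r + 1"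
          using hipn[of w z] hipn[of w h] nh by (simp add: distrib_right)
        hence e: "exp (4 * (norm (hip w z) + norm (hip w h) + 1)) \<le> exp (4 * ((norm z + 1) * ?r + 1))" by simp
        have "(norm (hip w h))\<^sup>2 \<le> (norm h * ?r)\<^sup>2" using hipn[of w h] by (intro power_mono) auto
        also have "\<dots> = (norm h)\<^sup>2 * ?r\<^sup>2" by (simp add: power_mult_distrib)
        also have "\<dots> \<le> (norm h)\<^sup>2 * (1 + ?r)\<^sup>2" by (intro mult_left_mono power_mono) auto
        finally have q: "(norm (hip w h))\<^sup>2 \<le> (norm h)\<^sup>2 * (1 + ?r)\<^sup>2" .
        have "norm (?F w) = norm (\<Psi> (hip w z + hip w h) - \<Psi> (hip w z) - deriv \<Psi> (hip w z) * hip w h)"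
          by (simp add: dual_kernel_def \<Psi>_def d_def hip_add_right)
        also have "\<dots> \<le> 2 * A * exp (4 * (norm (hip w z) + norm (hip w h) + 1)) * (norm (hip w h))\<^sup>2"
          by (rule T(2)) simp
        also have "\<dots> \<le> 2 * A * exp (4 * ((norm z + 1) * ?r + 1)) * ((norm h)\<^sup>2 * (1 + ?r)\<^sup>2)"
          using e q A(1) by (intro mult_mono) auto
        also have "\<dots> = 2 * A * (norm h)\<^sup>2 * exp 4 * ((1 + ?r)\<^sup>2 * exp (4 * (norm z + 1) * ?r))"
        proof -
          have "exp (4 * ((norm z + 1) * ?r + 1)) = exp 4 * exp (4 * (norm z + 1) * ?r)"
            by (simp add: algebra_simps flip: exp_add)
          thus ?thesis by (simp only: mult_ac)
        qed
        also have "(1 + ?r)\<^sup>2 = (1 + ?r) powr 2"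
        proof -
          have "1 + ?r > 0" by (simp add: add_pos_nonneg)
          thus ?thesis using powr_realpow[of "1 + ?r" 2] by simp
        qed
        also have "2 * A * (norm h)\<^sup>2 * exp 4 * ((1 + ?r) powr 2 * exp (4 * (norm z + 1) * ?r)) \<le> 2 * A * (norm h)\<^sup>2 * exp 4 * (B2 * Phi \<beta> ?r)"
          using A(1) B2(2)[of ?r] by (intro mult_left_mono) auto
        also have "\<dots> = 2 * A * exp 4 * B2 * (norm h)\<^sup>2 * Phi \<beta> ?r" by (simp only: mult_ac)
        finally show "norm (?F w) \<le> 2 * A * exp 4 * B2 * (norm h)\<^sup>2 * Phi \<beta> ?r" .
      qed
      from linear_on_fockD(4)[OF L FX this]
      have "norm (L ?F) \<le> C * (2 * A * exp 4 * B2 * (norm h)\<^sup>2)" .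
      moreover have "L ?F = L (dual_kernel K \<kappa> (z + h)) - L (dual_kernel K \<kappa> z) - L (d z h)"
        by (simp only: linear_on_fock_diff[OF L fock_inf0_diff[OF QX QX] dX] linear_on_fock_diff[OF L QX QX])
      moreover have "?g (z + h) - ?g z - D z h = cnj (L (dual_kernel K \<kappa> (z + h)) - L (dual_kernel K \<kappa> z) - L (d z h))"
        by (simp add: D_def)
      ultimately show ?thesis by (simp only: complex_mod_cnj mult.assoc)
    qed
    have "((\<lambda>h. norm (?g (z + h) - ?g z - D z h) / norm h) \<longlongrightarrow> 0) (at 0)"
    proof (rule tendsto_sandwich[OF _ _ tendsto_const])
      show "\<forall>\<^sub>F h in at 0. 0 \<le> norm (?g (z + h) - ?g z - D z h) / norm h" by simp
      show "\<forall>\<^sub>F h in at 0. norm (?g (z + h) - ?g z - D z h) / norm h \<le> ?M * norm h"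
        unfolding eventually_at
      proof (intro exI[of _ 1] conjI ballI impI)
        fix h :: "complex^'n" assume "h \<noteq> 0 \<and> dist h 0 < 1"
        hence h: "norm h > 0" "norm h \<le> 1" by auto
        have "norm (?g (z + h) - ?g z - D z h) \<le> (?M * norm h) * norm h"
          using rem[OF h(2)] by (simp add: power2_eq_square mult.assoc)
        thus "norm (?g (z + h) - ?g z - D z h) / norm h \<le> ?M * norm h" using h(1) by (simp only: pos_divide_le_eq)
      qed simp
      have "((\<lambda>h::complex^'n. ?M * norm h) \<longlongrightarrow> ?M * norm (0::complex^'n)) (at 0)"
        by (intro tendsto_intros)
      thus "((\<lambda>h::complex^'n. ?M * norm h) \<longlongrightarrow> 0) (at 0)" by simp
    qed
    thus ?thesis unfolding has_derivative_at using bl by blast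
  qed
  thus ?thesis by (rule entireI[OF _ D_smult])
qed

section \<open>Combinations of kernels and integrability of the representing function\<close>

text \<open>On each complex line through the origin, the combination of kernels is the image under
  \<open>mu\<close> of the same combination of exponentials. The constants of the one-variable
  multiplier do not depend on the line, so the bound holds on the whole space and does not depend on
  the number of terms.\<close>

lemma kernel_combination_dominated:
  fixes x :: "'b \<Rightarrow> complex^'n" and u :: "'b \<Rightarrow> complex"
  assumes K: "real (K + CARD('n)) > \<kappa>" and J: "finite J"
    and A: "\<And>M a. grow a0 M a \<Longrightarrow> grow \<beta> (A * M) (\<lambda>k. of_real (mu CARD('n) K \<kappa> k) * a k)"
    and S: "\<And>v. norm (\<Sum>j\<in>J. u j * exp (hip v (x j))) \<le> S * Phi a0 (norm v)"
  shows "dominated \<beta> (A * S) (\<lambda>w. \<Sum>j\<in>J. u j * dual_kernel K \<kappa> (x j) w)"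
  unfolding dominated_def
proof (intro conjI allI)
  show "entire (\<lambda>w. \<Sum>j\<in>J. u j * dual_kernel K \<kappa> (x j) w)"
    by (rule fock_inf0_entire[of _ 0]) (intro fock_inf0_sum fock_inf0_cmult dual_kernel_fock_inf0[OF K])
  fix w :: "complex^'n"
  \<comment> \<open>The unit direction of the line through w; at w = 0 any direction will
    do.\<close>
  obtain e where e: "norm e = 1" "w = complex_of_real (norm w) *s e"
  proof (cases "w = 0")
    case True
    have "norm (axis undefined 1 :: complex^'n) = 1" by (simp add: norm_axis_1)
    moreover have "w = complex_of_real (norm w) *s axis undefined 1" using True by (simp add: vec_eq_iff)
    ultimately show ?thesis by (rule that)
  next
    case False
    have "norm (complex_of_real (1 / norm w) *s w) = 1" using False by (simp add: norm_smult_complex norm_divide)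
    moreover have "w = complex_of_real (norm w) *s (complex_of_real (1 / norm w) *s w)" using False by (simp add: vec_eq_iff)
    ultimately show ?thesis by (rule that)
  qed
  define a where "a = (\<lambda>k. \<Sum>j\<in>J. u j * (hip e (x j) ^ k / fact k))"
  have "grow a0 S a"
  proof (rule growI)
    fix \<zeta> :: complex
    have "(\<lambda>k. u j * ((\<zeta> * hip e (x j)) ^ k /\<^sub>R fact k)) sums (u j * exp (\<zeta> * hip e (x j)))" for j
      by (intro sums_mult exp_converges)
    hence "(\<lambda>k. \<Sum>j\<in>J. u j * ((\<zeta> * hip e (x j)) ^ k /\<^sub>R fact k)) sums (\<Sum>j\<in>J. u j * exp (\<zeta> * hip e (x j)))"
      by (rule sums_sum)
    moreover have "(\<Sum>j\<in>J. u j * ((\<zeta> * hip e (x j)) ^ k /\<^sub>R fact k)) = a k * \<zeta> ^ k" for k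
      unfolding a_def sum_distrib_right
      by (intro sum.cong refl) (simp add: power_mult_distrib scaleR_conv_of_real divide_inverse mult_ac)
    ultimately show "(\<lambda>k. a k * \<zeta> ^ k) sums (\<Sum>j\<in>J. u j * exp (\<zeta> * hip e (x j)))" by simp
    show "norm (\<Sum>j\<in>J. u j * exp (\<zeta> * hip e (x j))) \<le> S * Phi a0 (norm \<zeta>)"
      using S[of "\<zeta> *s e"] by (simp add: hip_smult_left norm_smult_complex e(1))
  qed
  from A[OF this] obtain \<phi> where
    \<phi>: "\<And>\<zeta>. (\<lambda>k. of_real (mu CARD('n) K \<kappa> k) * a k * \<zeta> ^ k) sums \<phi> \<zeta>" "\<And>\<zeta>. norm (\<phi> \<zeta>) \<le> A * S * Phi \<beta> (norm \<zeta>)"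
    by (elim growE) blast
  let ?t = "complex_of_real (norm w)"
  have "(\<lambda>k. \<Sum>j\<in>J. u j * (of_real (mu CARD('n) K \<kappa> k) / fact k * hip w (x j) ^ k)) sums (\<Sum>j\<in>J. u j * dual_kernel K \<kappa> (x j) w)"
    unfolding dual_kernel_def by (intro sums_sum sums_mult Psi_sums card_ge_1 K)
  moreover have "(\<Sum>j\<in>J. u j * (of_real (mu CARD('n) K \<kappa> k) / fact k * hip w (x j) ^ k)) = of_real (mu CARD('n) K \<kappa> k) * a k * ?t ^ k" for k
  proof -
    have "hip w (x j) = ?t * hip e (x j)" for j
      using e(2) hip_smult_left[of ?t e "x j"] by simp
    hence "u j * (of_real (mu CARD('n) K \<kappa> k) / fact k * hip w (x j) ^ k)
       = of_real (mu CARD('n) K \<kappa> k) * (u j * (hip e (x j) ^ k / fact k)) * ?t ^ k" for j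
      by (simp only:) (simp add: power_mult_distrib)
    thus ?thesis unfolding a_def by (simp only: sum_distrib_left sum_distrib_right)
  qed
  ultimately have "(\<lambda>k. of_real (mu CARD('n) K \<kappa> k) * a k * ?t ^ k) sums (\<Sum>j\<in>J. u j * dual_kernel K \<kappa> (x j) w)" by simp
  hence "(\<Sum>j\<in>J. u j * dual_kernel K \<kappa> (x j) w) = \<phi> ?t" using \<phi>(1)[of ?t] sums_unique2 by blast
  thus "norm (\<Sum>j\<in>J. u j * dual_kernel K \<kappa> (x j) w) \<le> A * S * Phi \<beta> (norm w)"
    using \<phi>(2)[of ?t] by simp
qed

text \<open>Unit balls around a countable dense set, made disjoint. Bounded diameter is what keeps
  the Gaussian weights within one cell comparable.\<close>

lemma small_partition:
  obtains c :: "nat \<Rightarrow> complex^'n" and Q where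
    "disjoint_family Q" "(\<Union>j. Q j) = UNIV" "\<And>j. Q j \<in> sets borel" "\<And>j. Q j \<subseteq> cball (c j) 1"
proof -
  obtain D :: "(complex^'n) set" where D: "countable D" "\<And>X. open X \<Longrightarrow> X \<noteq> {} \<Longrightarrow> \<exists>d\<in>D. d \<in> X"
    by (rule countable_dense_setE) blast
  have "D \<noteq> {}" using D(2)[of UNIV] by auto
  define c where "c = from_nat_into D"
  have c: "range c = D" unfolding c_def by (rule range_from_nat_into[OF \<open>D \<noteq> {}\<close> D(1)])
  define B where "B = (\<lambda>j. ball (c j) 1)"
  have U: "(\<Union>j. B j) = UNIV"
  proof -
    have "z \<in> (\<Union>j. B j)" for z
    proof -
      obtain d where d: "d \<in> D" "d \<in> ball z 1" using D(2)[of "ball z 1"] by auto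
      then obtain j where "d = c j" using c by auto
      thus ?thesis using d(2) by (auto simp: B_def dist_commute)
    qed
    thus ?thesis by blast
  qed
  show ?thesis
  proof (rule that)
    show "disjoint_family (disjointed B)" by (rule disjoint_family_disjointed)
    show "(\<Union>j. disjointed B j) = UNIV" by (simp add: UN_disjointed_eq U)
    have "range B \<subseteq> sets borel" by (auto simp: B_def)
    hence "range (disjointed B) \<subseteq> sets borel" by (rule sets.range_disjointed_sets)
    thus "disjointed B j \<in> sets borel" for j by blast
    show "disjointed B j \<subseteq> cball (c j) 1" for j
      using disjointed_subset[of B j] ball_subset_cball unfolding B_def by blast
  qed
qed

text \<open>Completing the square leaves exp(-d^2/2) with d = |z - v|. Half of it pays for moving
  the polynomial weight from z to v. For the other half |y - v|^2 \<le> 8 + 2 d^2, so the sample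
  point z may be replaced by any y of the same cell, which gives the rate 1/8 and the factor exp
  1.\<close>

lemma weighted_exp_le:
  fixes v z y :: "complex^'n"
  assumes y: "norm (y - z) \<le> 2"
  shows "exp (- (norm z)\<^sup>2 / 2) * (1 + norm z) powr b * exp (v \<bullet> z)
    \<le> exp (b\<^sup>2) * exp 1 * Phi b (norm v) * exp (- (1/8) * (norm (y - v))\<^sup>2)"
proof -
  let ?d = "norm (z - v)"
  have e: "exp (- (norm z)\<^sup>2 / 2) * exp (v \<bullet> z) = exp ((norm v)\<^sup>2 / 2) * exp (- ?d\<^sup>2 / 2)"
  proof -
    have "- (norm z)\<^sup>2 / 2 + v \<bullet> z = (norm v)\<^sup>2 / 2 + - ?d\<^sup>2 / 2"
      by (simp add: norm_diff_power2 inner_commute field_simps)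
    thus ?thesis by (simp only: exp_add[symmetric])
  qed
  have "\<bar>norm z - norm v\<bar> \<le> ?d" by (rule norm_triangle_ineq3)
  hence "(1 + \<bar>norm z - norm v\<bar>) powr \<bar>b\<bar> \<le> (1 + ?d) powr \<bar>b\<bar>" by (intro powr_mono2) auto
  also have "\<dots> \<le> exp (b\<^sup>2) * exp (1/4 * ?d\<^sup>2)" using powr_exp_le_gauss[of ?d "1/4" "\<bar>b\<bar>" 0] by simp
  finally have p: "(1 + norm z) powr b \<le> (1 + norm v) powr b * (exp (b\<^sup>2) * exp (1/4 * ?d\<^sup>2))"
    using one_plus_powr_moderate[of "norm z" "norm v" b]
      mult_left_mono[of "(1 + \<bar>norm z - norm v\<bar>) powr \<bar>b\<bar>" "exp (b\<^sup>2) * exp (1/4 * ?d\<^sup>2)" "(1 + norm v) powr b"] by simp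
  have n: "norm (y - v) \<le> 2 + ?d" using norm_triangle_ineq[of "y - z" "z - v"] y by simp
  have "(norm (y - v))\<^sup>2 \<le> (2 + ?d)\<^sup>2" using n by (intro power_mono) auto
  also have "\<dots> \<le> 8 + 2 * ?d\<^sup>2"
  proof -
    have "0 \<le> (2 - ?d)\<^sup>2" by simp
    thus ?thesis by (simp add: power2_eq_square algebra_simps)
  qed
  finally have "1/4 * ?d\<^sup>2 + - ?d\<^sup>2 / 2 \<le> 1 + - (1/8) * (norm (y - v))\<^sup>2" by simp
  hence q: "exp (1/4 * ?d\<^sup>2) * exp (- ?d\<^sup>2 / 2) \<le> exp 1 * exp (- (1/8) * (norm (y - v))\<^sup>2)"
    by (simp only: exp_add[symmetric] exp_le_cancel_iff)
  have "exp (- (norm z)\<^sup>2 / 2) * (1 + norm z) powr b * exp (v \<bullet> z)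
     = (exp (- (norm z)\<^sup>2 / 2) * exp (v \<bullet> z)) * (1 + norm z) powr b" by (simp only: mult_ac)
  also have "\<dots> \<le> (exp ((norm v)\<^sup>2 / 2) * exp (- ?d\<^sup>2 / 2)) * ((1 + norm v) powr b * (exp (b\<^sup>2) * exp (1/4 * ?d\<^sup>2)))"
    unfolding e using p by (intro mult_left_mono) auto
  also have "\<dots> = exp (b\<^sup>2) * Phi b (norm v) * (exp (1/4 * ?d\<^sup>2) * exp (- ?d\<^sup>2 / 2))"
    by (simp only: Phi_def mult_ac)
  also have "\<dots> \<le> exp (b\<^sup>2) * Phi b (norm v) * (exp 1 * exp (- (1/8) * (norm (y - v))\<^sup>2))"
    by (intro mult_left_mono q) auto
  finally show ?thesis by (simp only: mult_ac)
qed

text \<open>The weighted mass of \<open>g\<close> over a finite union of cells is at most a value of \<open>L\<close> on a combination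
  of kernels. Its coefficients are bounded by the cell weights, so its norm is controlled by
  \<open>kernel_combination_dominated\<close> uniformly in the number of cells; this replaces Riesz representation.\<close>

lemma functional_kernel_fock_one:
  assumes \<sigma>: "2 * \<kappa> = \<alpha> + \<beta>" and K: "real (K + CARD('n)) > \<kappa>"
  shows "\<exists>A\<ge>0. \<forall>(L :: (complex^'n \<Rightarrow> complex) \<Rightarrow> complex) C. linear_on_fock \<beta> L C \<longrightarrow>
    (\<lambda>z. cnj (L (dual_kernel K \<kappa> z))) \<in> fock_one \<alpha> \<and>
    fock_one_norm \<alpha> (\<lambda>z. cnj (L (dual_kernel K \<kappa> z))) \<le> A * C"
proof -
  \<comment> \<open>The weight exponent of F^1; the multiplier takes growth b to growth b + 2
    \<kappa> = \<beta>.\<close>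
  define b where "b = - \<alpha>"
  have b: "b + 2 * \<kappa> = \<beta>" using \<sigma> by (simp add: b_def)
  obtain A0 where A0: "A0 \<ge> 0" "\<And>M a. grow b M a \<Longrightarrow> grow \<beta> (A0 * M) (\<lambda>k. of_real (mu CARD('n) K \<kappa> k) * a k)"
    using grow_mu[OF card_ge_1 K, of b] unfolding b by blast
  obtain c :: "nat \<Rightarrow> complex^'n" and Q where Q:
    "disjoint_family Q" "(\<Union>j. Q j) = UNIV" "\<And>j. Q j \<in> sets borel" "\<And>j. Q j \<subseteq> cball (c j) 1"
    by (rule small_partition) blast
  define m where "m = (\<lambda>j. measure gauss_volume (Q j))"
  have m0: "m j \<ge> 0" for j by (simp add: m_def)
  have Qfin: "emeasure gauss_volume (Q j) < \<infinity>" for j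
    using emeasure_mono[OF Q(4)[of j], of gauss_volume] emeasure_gauss_cball[of "c j" 1] by (simp add: order_le_less_trans)
  have Qm: "emeasure gauss_volume (Q j) = ennreal (m j)" for j
    using Qfin[of j] by (simp add: m_def emeasure_eq_ennreal_measure)
  define G where "G = (\<integral>y. exp (- (1/8) * (norm (y::complex^'n))\<^sup>2) \<partial>gauss_volume)"
  have Gi: "integrable gauss_volume (\<lambda>y::complex^'n. exp (- (1/8) * (norm y)\<^sup>2))" by (rule gaussian_integrable) simp
  have Gv: "integrable gauss_volume (\<lambda>y::complex^'n. exp (- (1/8) * (norm (y - v))\<^sup>2))"
     "(\<integral>y. exp (- (1/8) * (norm (y - v))\<^sup>2) \<partial>gauss_volume) = G" for v :: "complex^'n"
    using integrable_gauss_translate[OF Gi, of "- v"]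
      integral_gauss_translate[of "\<lambda>y::complex^'n. exp (- (1/8) * (norm y)\<^sup>2)" "- v"] by (simp_all add: G_def)
  define S where "S = exp (b\<^sup>2) * exp 1 * G"
  have S0: "S \<ge> 0" unfolding S_def G_def by (intro mult_nonneg_nonneg Bochner_Integration.integral_nonneg) auto
  define \<nu> where "\<nu> = (\<lambda>z::complex^'n. exp (- (norm z)\<^sup>2 / 2) * (1 + norm z) powr b)"
  have \<nu>0: "\<nu> z \<ge> 0" for z by (simp add: \<nu>_def)
  \<comment> \<open>A Riemann sum compared with its integral: each cell contributes at most the
    integral of a Gaussian around v over that cell, and the cells are disjoint. The bound is uniform
    in N and in the sample points.\<close>
  have kernel_sum: "(\<Sum>j<N. m j * (\<nu> (x j) * exp (v \<bullet> x j))) \<le> S * Phi b (norm v)"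
    if x: "\<And>j. x j \<in> cball (c j) 1" for x v and N :: nat
  proof -
    let ?e = "\<lambda>y. exp (- (1/8) * (norm (y - v))\<^sup>2)"
    let ?P = "exp (b\<^sup>2) * exp 1 * Phi b (norm v)"
    have ie: "integrable gauss_volume (\<lambda>y. indicator (Q j) y * ?e y)" for j
      using integrable_mult_indicator[OF _ Gv(1)[of v], of "Q j"] Q(3) by simp
    have ii: "integrable gauss_volume (indicator (Q j) :: _ \<Rightarrow> real)" for j
      using Q(3) Qfin by (intro integrable_real_indicator) auto
    have "m j * (\<nu> (x j) * exp (v \<bullet> x j)) \<le> ?P * (\<integral>y. indicator (Q j) y * ?e y \<partial>gauss_volume)" for j
    proof -
      have "m j * (\<nu> (x j) * exp (v \<bullet> x j)) = (\<integral>y. indicator (Q j) y * (\<nu> (x j) * exp (v \<bullet> x j)) \<partial>gauss_volume)"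
        using Q(3)[of j] by (simp add: m_def)
      also have "\<dots> \<le> (\<integral>y. ?P * (indicator (Q j) y * ?e y) \<partial>gauss_volume)"
      proof (rule integral_mono)
        show "integrable gauss_volume (\<lambda>y. indicator (Q j) y * (\<nu> (x j) * exp (v \<bullet> x j)))"
          by (intro integrable_mult_left ii)
        show "integrable gauss_volume (\<lambda>y. ?P * (indicator (Q j) y * ?e y))" by (intro integrable_mult_right ie)
        fix y :: "complex^'n"
        show "indicator (Q j) y * (\<nu> (x j) * exp (v \<bullet> x j)) \<le> ?P * (indicator (Q j) y * ?e y)"
        proof (cases "y \<in> Q j")
          case True
          hence "dist (c j) y \<le> 1" "dist (c j) (x j) \<le> 1" using Q(4)[of j] x[of j] by auto
          hence "dist y (x j) \<le> 2" using dist_triangle[of y "x j" "c j"] by (simp add: dist_commute)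
          hence "norm (y - x j) \<le> 2" by (simp add: dist_norm)
          from weighted_exp_le[OF this, of b v] show ?thesis using True by (simp add: \<nu>_def)
        qed simp
      qed
      finally show ?thesis by simp
    qed
    hence "(\<Sum>j<N. m j * (\<nu> (x j) * exp (v \<bullet> x j))) \<le> (\<Sum>j<N. ?P * (\<integral>y. indicator (Q j) y * ?e y \<partial>gauss_volume))"
      by (rule sum_mono)
    also have "\<dots> = ?P * (\<integral>y. (\<Sum>j<N. indicator (Q j) y * ?e y) \<partial>gauss_volume)"
      by (simp only: Bochner_Integration.integral_sum[OF ie] sum_distrib_left)
    also have "\<dots> \<le> ?P * (\<integral>y. ?e y \<partial>gauss_volume)"
    proof (intro mult_left_mono integral_mono Gv(1) Bochner_Integration.integrable_sum ie)
      fix y :: "complex^'n"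
      have "(\<Sum>j<N. indicator (Q j) y :: real) = indicator (\<Union>j<N. Q j) y"
        using Q(1) by (intro indicator_UN_disjoint[symmetric]) (auto simp: disjoint_family_on_def)
      also have "\<dots> \<le> 1" by (simp add: indicator_def)
      finally have "(\<Sum>j<N. indicator (Q j) y) * ?e y \<le> 1 * ?e y" by (intro mult_right_mono) auto
      thus "(\<Sum>j<N. indicator (Q j) y * ?e y) \<le> ?e y" by (simp add: sum_distrib_right)
    qed auto
    also have "\<dots> = S * Phi b (norm v)" by (simp only: Gv(2) S_def mult_ac)
    finally show ?thesis .
  qed
  show ?thesis
  proof (intro exI[of _ "A0 * S"] conjI allI impI)
    show "A0 * S \<ge> 0" using A0(1) S0 by simp
    fix L :: "(complex^'n \<Rightarrow> complex) \<Rightarrow> complex" and C assume L: "linear_on_fock \<beta> L C"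
    define g where "g = (\<lambda>z. cnj (L (dual_kernel K \<kappa> z)))"
    have eg: "entire g" unfolding g_def by (rule entire_functional_kernel[OF L K])
    define \<phi> where "\<phi> = (\<lambda>z. norm (g z) * \<nu> z)"
    have cont: "continuous_on UNIV \<phi>"
    proof -
      have "continuous_on UNIV (\<lambda>z::complex^'n. 1 + norm z)" by (intro continuous_intros)
      moreover have "1 + norm z \<noteq> 0" for z :: "complex^'n" using norm_ge_zero[of z] by linarith
      ultimately show ?thesis unfolding \<phi>_def \<nu>_def
        by (intro continuous_on_mult continuous_on_norm entire_continuous[OF eg] continuous_on_powr continuous_on_const)
           (auto intro!: continuous_intros)
    qed
    \<comment> \<open>Sampling at a maximum over the closed ball makes the sample sum an upper bound
      for the integral over the cells.\<close>
    have "\<exists>x\<in>cball (c j) 1. \<forall>y\<in>cball (c j) 1. \<phi> y \<le> \<phi> x" for j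
      by (rule continuous_attains_sup) (use cont continuous_on_subset in \<open>auto\<close>)
    then obtain x where x: "\<And>j. x j \<in> cball (c j) 1" "\<And>j y. y \<in> cball (c j) 1 \<Longrightarrow> \<phi> y \<le> \<phi> (x j)" by metis
    have fin: "(\<Sum>j<N. m j * \<phi> (x j)) \<le> C * (A0 * S)" for N
    proof -
      let ?q = "\<lambda>j. L (dual_kernel K \<kappa> (x j))"
      \<comment> \<open>The phase makes every term of the value of L nonnegative, so L of the
        combination is exactly the weighted sample sum of |g|.\<close>
      define u where "u = (\<lambda>j. complex_of_real (m j * \<nu> (x j)) * cnj (sgn (?q j)))"
      have un: "norm (u j) \<le> m j * \<nu> (x j)" for j
        using m0[of j] \<nu>0[of "x j"] by (simp add: u_def norm_mult norm_sgn)
      have uq: "u j * ?q j = of_real (m j * \<phi> (x j))" for j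
      proof -
        have "cnj (sgn (?q j)) * ?q j = of_real (norm (?q j))"
        proof (cases "?q j = 0")
          case False
          have "cnj (sgn (?q j)) * ?q j = (?q j * cnj (?q j)) / of_real (norm (?q j))"
            by (simp add: sgn_eq)
          also have "\<dots> = of_real (norm (?q j))"
            using False by (simp add: complex_norm_square[symmetric] power2_eq_square)
          finally show ?thesis .
        qed simp
        hence "u j * ?q j = of_real (m j * \<nu> (x j)) * of_real (norm (?q j))"
          unfolding u_def by (simp only: mult.assoc)
        thus ?thesis by (simp add: \<phi>_def g_def)
      qed
      let ?F = "\<lambda>w. \<Sum>j<N. u j * dual_kernel K \<kappa> (x j) w"
      have Fd: "dominated \<beta> (A0 * S) ?F"
      proof (rule kernel_combination_dominated[OF K finite_lessThan A0(2)])
        fix v :: "complex^'n"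
        have "norm (\<Sum>j<N. u j * exp (hip v (x j))) \<le> (\<Sum>j<N. m j * (\<nu> (x j) * exp (v \<bullet> x j)))"
        proof (intro order_trans[OF norm_sum] sum_mono)
          fix j
          show "norm (u j * exp (hip v (x j))) \<le> m j * (\<nu> (x j) * exp (v \<bullet> x j))"
            using mult_right_mono[OF un[of j], of "exp (v \<bullet> x j)"] by (simp add: norm_mult Re_hip mult.assoc)
        qed
        thus "norm (\<Sum>j<N. u j * exp (hip v (x j))) \<le> S * Phi b (norm v)"
          using kernel_sum[OF x(1), where N = N and v = v] by linarith
      qed
      have FX: "(\<lambda>w. u j * dual_kernel K \<kappa> (x j) w) \<in> fock_inf0 \<beta>" for j
        by (intro fock_inf0_cmult dual_kernel_fock_inf0[OF K])
      have "?F \<in> fock_inf0 \<beta>" by (rule fock_inf0_sum[OF FX])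
      hence "norm (L ?F) \<le> C * (A0 * S)" using Fd by (rule linear_on_fockD(4)[OF L])
      also have "L ?F = (\<Sum>j<N. L (\<lambda>w. u j * dual_kernel K \<kappa> (x j) w))"
        by (rule linear_on_fock_sum[OF L finite_lessThan FX])
      also have "\<dots> = (\<Sum>j<N. u j * ?q j)"
        by (simp only: linear_on_fockD(3)[OF L dual_kernel_fock_inf0[OF K]])
      also have "\<dots> = of_real (\<Sum>j<N. m j * \<phi> (x j))" by (simp only: uq of_real_sum)
      finally have "\<bar>\<Sum>j<N. m j * \<phi> (x j)\<bar> \<le> C * (A0 * S)" by (simp only: norm_of_real)
      thus ?thesis by linarith
    qed
    have phi0: "\<phi> z \<ge> 0" for z using \<nu>0 by (simp add: \<phi>_def)
    have [measurable]: "\<phi> \<in> borel_measurable borel" by (rule borel_measurable_continuous_onI[OF cont])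
    have "(\<integral>\<^sup>+z. ennreal (\<phi> z) \<partial>gauss_volume) = (\<integral>\<^sup>+z\<in>(\<Union>j. Q j). ennreal (\<phi> z) \<partial>gauss_volume)"
      by (simp add: Q(2))
    also have "\<dots> = (\<Sum>j. \<integral>\<^sup>+z\<in>Q j. ennreal (\<phi> z) \<partial>gauss_volume)"
      by (rule nn_integral_disjoint_family) (use Q in auto)
    also have "\<dots> \<le> ennreal (C * (A0 * S))"
    proof (rule suminf_le_const[OF summableI])
      fix N
      have "(\<integral>\<^sup>+z\<in>Q j. ennreal (\<phi> z) \<partial>gauss_volume) \<le> ennreal (m j * \<phi> (x j))" for j
      proof -
        have "(\<integral>\<^sup>+z\<in>Q j. ennreal (\<phi> z) \<partial>gauss_volume) \<le> (\<integral>\<^sup>+z. ennreal (\<phi> (x j)) * indicator (Q j) z \<partial>gauss_volume)"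
        proof (rule nn_integral_mono)
          fix z
          show "ennreal (\<phi> z) * indicator (Q j) z \<le> ennreal (\<phi> (x j)) * indicator (Q j) z"
          proof (cases "z \<in> Q j")
            case True
            hence "\<phi> z \<le> \<phi> (x j)" using Q(4)[of j] by (intro x(2)) blast
            thus ?thesis using True by (simp add: ennreal_leI)
          qed simp
        qed
        also have "\<dots> = ennreal (\<phi> (x j)) * emeasure gauss_volume (Q j)"
          using Q(3)[of j] by (subst nn_integral_cmult_indicator) auto
        also have "\<dots> = ennreal (m j * \<phi> (x j))"
          using m0[of j] phi0[of "x j"] by (simp add: Qm mult.commute flip: ennreal_mult)
        finally show ?thesis .
      qed
      hence "(\<Sum>j<N. \<integral>\<^sup>+z\<in>Q j. ennreal (\<phi> z) \<partial>gauss_volume) \<le> (\<Sum>j<N. ennreal (m j * \<phi> (x j)))"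
        by (rule sum_mono)
      also have "\<dots> = ennreal (\<Sum>j<N. m j * \<phi> (x j))"
        by (rule sum_ennreal) (use m0 phi0 in simp)
      also have "\<dots> \<le> ennreal (C * (A0 * S))" by (rule ennreal_leI[OF fin])
      finally show "(\<Sum>j<N. \<integral>\<^sup>+z\<in>Q j. ennreal (\<phi> z) \<partial>gauss_volume) \<le> ennreal (C * (A0 * S))" .
    qed
    finally have nn: "(\<integral>\<^sup>+z. ennreal (\<phi> z) \<partial>gauss_volume) \<le> ennreal (C * (A0 * S))" .
    have int: "integrable gauss_volume \<phi>"
    proof (rule integrableI_nonneg)
      show "(\<integral>\<^sup>+z. ennreal (\<phi> z) \<partial>gauss_volume) < \<infinity>" using nn by (simp add: order_le_less_trans)
    qed (use phi0 in auto)
    have phi_eq: "\<phi> = (\<lambda>z. norm (g z) * exp (- (norm z)\<^sup>2 / 2) * (1 + norm z) powr (- \<alpha>))"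
      by (simp add: \<phi>_def \<nu>_def b_def mult.assoc fun_eq_iff)
    show "(\<lambda>z. cnj (L (dual_kernel K \<kappa> z))) \<in> fock_one \<alpha>"
      using int eg by (simp add: fock_one_def g_def[symmetric] phi_eq)
    have "C * (A0 * S) \<ge> 0" using linear_on_fockD(1)[OF L] A0(1) S0 by simp
    hence "integral\<^sup>L gauss_volume \<phi> \<le> C * (A0 * S)"
      using nn phi0 by (subst (asm) nn_integral_eq_integral[OF int]) (auto simp: ennreal_le_iff)
    thus "fock_one_norm \<alpha> (\<lambda>z. cnj (L (dual_kernel K \<kappa> z))) \<le> A0 * S * C"
      unfolding fock_one_norm_def g_def[symmetric] phi_eq by (simp only: mult_ac)
  qed
qed

section \<open>Duality\<close>

lemma linear_on_fock_bounded_functional: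
  fixes L :: "(complex^'n \<Rightarrow> complex) \<Rightarrow> complex"
  assumes L: "linear_on_fock \<beta> L C"
  shows "bounded_functional (fock_inf0 \<beta>) (fock_inf_norm \<beta>) L"
    and "functional_norm (fock_inf0 \<beta>) (fock_inf_norm \<beta>) L \<le> C"
    and "f \<in> fock_inf0 \<beta> \<Longrightarrow> fock_inf_norm \<beta> f \<le> 1 \<Longrightarrow>
      norm (L f) \<le> functional_norm (fock_inf0 \<beta>) (fock_inf_norm \<beta>) L"
proof -
  have b: "norm (L f) \<le> C * fock_inf_norm \<beta> f" if "f \<in> fock_inf0 \<beta>" for f
    using that by (intro linear_on_fockD(4)[OF L] fock_inf0_dominated)
  show "bounded_functional (fock_inf0 \<beta>) (fock_inf_norm \<beta>) L"
    unfolding bounded_functional_def using b linear_on_fockD(2,3)[OF L] by blast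
  have le: "norm (L f) \<le> C" if f: "f \<in> fock_inf0 \<beta>" "fock_inf_norm \<beta> f \<le> 1" for f
    using b[OF f(1)] mult_left_mono[OF f(2) linear_on_fockD(1)[OF L]] by simp
  have "fock_inf_norm \<beta> (\<lambda>z::complex^'n. 0) \<le> 0" by (rule fock_inf_norm_le[OF dominated_zero])
  hence "(\<lambda>z::complex^'n. 0) \<in> {f \<in> fock_inf0 \<beta>. fock_inf_norm \<beta> f \<le> 1}" using fock_inf0_zero by simp
  hence ne: "{f :: complex^'n \<Rightarrow> complex. f \<in> fock_inf0 \<beta> \<and> fock_inf_norm \<beta> f \<le> 1} \<noteq> {}" by blast
  show "functional_norm (fock_inf0 \<beta>) (fock_inf_norm \<beta>) L \<le> C"
    unfolding functional_norm_def by (rule cSUP_least[OF ne]) (use le in simp)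
  have "bdd_above ((\<lambda>f. norm (L f)) ` {f \<in> fock_inf0 \<beta>. fock_inf_norm \<beta> f \<le> 1})"
    by (rule bdd_aboveI[of _ C]) (use le in auto)
  thus "norm (L f) \<le> functional_norm (fock_inf0 \<beta>) (fock_inf_norm \<beta>) L"
    if "f \<in> fock_inf0 \<beta>" "fock_inf_norm \<beta> f \<le> 1"
    unfolding functional_norm_def using that by (intro cSUP_upper) auto
qed

lemma bounded_functional_linear_on_fock:
  fixes L :: "(complex^'n \<Rightarrow> complex) \<Rightarrow> complex"
  assumes "bounded_functional (fock_inf0 \<beta>) (fock_inf_norm \<beta>) L"
  shows "\<exists>C. linear_on_fock \<beta> L C"
proof -
  obtain C where C: "\<And>f. f \<in> fock_inf0 \<beta> \<Longrightarrow> norm (L f) \<le> C * fock_inf_norm \<beta> f"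
    using assms unfolding bounded_functional_def by blast
  \<comment> \<open>The constant in \<open>bounded_functional\<close> carries no sign, whereas
    \<open>linear_on_fock\<close> asks for a nonnegative one.\<close>
  have "norm (L f) \<le> max C 0 * M" if f: "f \<in> fock_inf0 \<beta>" and M: "dominated \<beta> M f" for f M
  proof -
    have N0: "fock_inf_norm \<beta> f \<ge> 0" by (rule dominatedD(3)[OF fock_inf0_dominated[OF f]])
    have "norm (L f) \<le> C * fock_inf_norm \<beta> f" by (rule C[OF f])
    also have "\<dots> \<le> max C 0 * fock_inf_norm \<beta> f" using N0 by (intro mult_right_mono) auto
    also have "\<dots> \<le> max C 0 * M" by (intro mult_left_mono fock_inf_norm_le[OF M]) auto
    finally show ?thesis .
  qed
  hence "linear_on_fock \<beta> L (max C 0)"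
    using assms unfolding linear_on_fock_def bounded_functional_def by auto
  thus ?thesis by blast
qed

text \<open>Any admissible constant may be replaced by the functional norm, by scaling f to norm at
  most 1. This is what turns the bound of \<open>functional_kernel_fock_one\<close> into the lower
  norm estimate.\<close>

lemma linear_on_fock_functional_norm:
  fixes L :: "(complex^'n \<Rightarrow> complex) \<Rightarrow> complex"
  assumes L: "linear_on_fock \<beta> L C"
  shows "linear_on_fock \<beta> L (functional_norm (fock_inf0 \<beta>) (fock_inf_norm \<beta>) L)"
proof -
  let ?N = "functional_norm (fock_inf0 \<beta>) (fock_inf_norm \<beta>) L"
  note up = linear_on_fock_bounded_functional(3)[OF L]
  have "fock_inf_norm \<beta> (\<lambda>z::complex^'n. 0) \<le> 0" by (rule fock_inf_norm_le[OF dominated_zero])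
  hence N0: "?N \<ge> 0" using order_trans[OF norm_ge_zero up[OF fock_inf0_zero]] by simp
  have "norm (L f) \<le> ?N * M" if f: "f \<in> fock_inf0 \<beta>" and M: "dominated \<beta> M f" for f M
  proof (cases "M = 0")
    case True
    thus ?thesis using linear_on_fockD(4)[OF L f M] by simp
  next
    case False
    hence Mpos: "M > 0" using dominatedD(3)[OF M] by simp
    let ?f = "\<lambda>z. complex_of_real (1 / M) * f z"
    have fX: "?f \<in> fock_inf0 \<beta>" by (rule fock_inf0_cmult[OF f])
    have "dominated \<beta> (norm (complex_of_real (1 / M)) * M) ?f" by (rule dominated_cmult[OF M])
    hence "dominated \<beta> 1 ?f" using Mpos by (simp add: norm_divide)
    hence "norm (L ?f) \<le> ?N" by (intro up[OF fX] fock_inf_norm_le)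
    also have "L ?f = complex_of_real (1 / M) * L f" by (rule linear_on_fockD(3)[OF L f])
    finally show ?thesis using Mpos by (simp add: norm_mult norm_divide field_simps)
  qed
  thus ?thesis using N0 L unfolding linear_on_fock_def by blast
qed

lemma linear_on_fock_cong:
  fixes L :: "(complex^'n \<Rightarrow> complex) \<Rightarrow> complex"
  assumes L: "linear_on_fock \<beta> L C" and eq: "\<And>f. f \<in> fock_inf0 \<beta> \<Longrightarrow> L' f = L f"
  shows "linear_on_fock \<beta> L' C"
  using L unfolding linear_on_fock_def by (simp add: eq fock_inf0_add fock_inf0_cmult)

lemma linear_on_fock_subtract:
  fixes L L' :: "(complex^'n \<Rightarrow> complex) \<Rightarrow> complex"
  assumes "linear_on_fock \<beta> L C" "linear_on_fock \<beta> L' C'"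
  shows "linear_on_fock \<beta> (\<lambda>f. L f - L' f) (C + C')"
  unfolding linear_on_fock_def
proof (intro conjI ballI allI impI)
  show "0 \<le> C + C'" using linear_on_fockD(1)[OF assms(1)] linear_on_fockD(1)[OF assms(2)] by simp
  fix f :: "complex^'n \<Rightarrow> complex" assume f: "f \<in> fock_inf0 \<beta>"
  show "L (\<lambda>z. f z + h z) - L' (\<lambda>z. f z + h z) = L f - L' f + (L h - L' h)" if "h \<in> fock_inf0 \<beta>" for h :: "complex^'n \<Rightarrow> complex"
    using linear_on_fockD(2)[OF assms(1) f that] linear_on_fockD(2)[OF assms(2) f that] by simp
  show "L (\<lambda>z. c * f z) - L' (\<lambda>z. c * f z) = c * (L f - L' f)" for c
    using linear_on_fockD(3)[OF assms(1) f] linear_on_fockD(3)[OF assms(2) f] by (simp add: right_diff_distrib)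
  show "norm (L f - L' f) \<le> (C + C') * M" if "dominated \<beta> M f" for M
    using linear_on_fockD(4)[OF assms(1) f that] linear_on_fockD(4)[OF assms(2) f that]
      norm_triangle_ineq4[of "L f" "L' f"] by (simp add: distrib_right)
qed

theorem theorem5p8:
  fixes \<alpha> \<beta> :: real
  shows
    "(\<forall>g \<in> (fock_one \<alpha> :: (complex^'n \<Rightarrow> complex) set).
        (\<forall>f \<in> fock_inf0 \<beta>. pairing_well_defined (\<alpha> + \<beta>) f g) \<and>
        bounded_functional (fock_inf0 \<beta>) (fock_inf_norm \<beta>) (\<lambda>f. pairing (\<alpha> + \<beta>) f g)) \<and>
     (\<forall>L :: (complex^'n \<Rightarrow> complex) \<Rightarrow> complex.
        bounded_functional (fock_inf0 \<beta>) (fock_inf_norm \<beta>) L \<longrightarrow>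
        (\<exists>!g. g \<in> fock_one \<alpha> \<and> (\<forall>f \<in> fock_inf0 \<beta>. L f = pairing (\<alpha> + \<beta>) f g))) \<and>
     (\<exists>c > 0. \<exists>C > 0. \<forall>g \<in> (fock_one \<alpha> :: (complex^'n \<Rightarrow> complex) set).
        c * fock_one_norm \<alpha> g
          \<le> functional_norm (fock_inf0 \<beta>) (fock_inf_norm \<beta>) (\<lambda>f. pairing (\<alpha> + \<beta>) f g) \<and>
        functional_norm (fock_inf0 \<beta>) (fock_inf_norm \<beta>) (\<lambda>f. pairing (\<alpha> + \<beta>) f g)
          \<le> C * fock_one_norm \<alpha> g)"
proof -
  define \<kappa> where "\<kappa> = (\<alpha> + \<beta>) / 2"
  define K where "K = cutoff CARD('n) (\<alpha> + \<beta>)"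
  have \<kappa>: "2 * \<kappa> = \<alpha> + \<beta>" by (simp add: \<kappa>_def)
  have K: "real (K + CARD('n)) > \<kappa>" unfolding K_def \<kappa>_def by (rule cutoff_bound)
  obtain C where C: "C \<ge> 0" "\<And>g :: complex^'n \<Rightarrow> complex. g \<in> fock_one \<alpha> \<Longrightarrow>
     linear_on_fock \<beta> (\<lambda>f. split_pairing K \<kappa> f g) (C * fock_one_norm \<alpha> g)"
    using split_pairing_linear[OF \<kappa> K] by blast
  obtain A where A: "A \<ge> 0" "\<And>(L :: (complex^'n \<Rightarrow> complex) \<Rightarrow> complex) C. linear_on_fock \<beta> L C \<Longrightarrow>
    (\<lambda>z. cnj (L (dual_kernel K \<kappa> z))) \<in> fock_one \<alpha> \<and>
    fock_one_norm \<alpha> (\<lambda>z. cnj (L (dual_kernel K \<kappa> z))) \<le> A * C"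
    using functional_kernel_fock_one[OF \<kappa> K] by blast
  have QX: "(dual_kernel K \<kappa> z :: complex^'n \<Rightarrow> complex) \<in> fock_inf0 \<beta>" for z
    by (rule dual_kernel_fock_inf0[OF K])
  have gdom: "\<exists>M. dominated \<alpha> M g" if "g \<in> fock_one \<alpha>" for g :: "complex^'n \<Rightarrow> complex"
    using fock_one_dominated that by blast
  have peq: "pairing (\<alpha> + \<beta>) f g = split_pairing K \<kappa> f g"
    if "g \<in> fock_one \<alpha>" "f \<in> fock_inf0 \<beta>" for f g :: "complex^'n \<Rightarrow> complex"
    using pairing_eq_split(1)[OF fock_inf0_dominated[OF that(2)]] gdom[OF that(1)]
    unfolding K_def \<kappa>_def by blast
  have wd: "pairing_well_defined (\<alpha> + \<beta>) f g"
    if g: "g \<in> fock_one \<alpha>" and f: "f \<in> fock_inf0 \<beta>" for f g :: "complex^'n \<Rightarrow> complex"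
  proof -
    obtain M where "dominated \<alpha> M g" using gdom[OF g] by blast
    from pairing_eq_split(2)[OF fock_inf0_dominated[OF f] this, of "\<alpha> + \<beta>", folded K_def, folded \<kappa>_def]
    show ?thesis using split_pairing_bound[OF \<kappa> K] g fock_inf0_dominated[OF f] by blast
  qed
  have lin: "linear_on_fock \<beta> (\<lambda>f. pairing (\<alpha> + \<beta>) f g) (C * fock_one_norm \<alpha> g)"
    if "g \<in> fock_one \<alpha>" for g :: "complex^'n \<Rightarrow> complex"
    by (rule linear_on_fock_cong[OF C(2)[OF that]]) (rule peq[OF that])
  \<comment> \<open>This reproducing identity serves three times: for existence, for uniqueness, and
    for the lower norm bound.\<close>
  have repr: "pairing (\<alpha> + \<beta>) (dual_kernel K \<kappa> z) g = cnj (g z)"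
    if "g \<in> fock_one \<alpha>" for z and g :: "complex^'n \<Rightarrow> complex"
    using peq[OF that QX] split_pairing_dual_kernel[OF \<kappa> K that] by simp
  have part2: "\<exists>!g. g \<in> fock_one \<alpha> \<and> (\<forall>f \<in> fock_inf0 \<beta>. L f = pairing (\<alpha> + \<beta>) f g)"
    if bL: "bounded_functional (fock_inf0 \<beta>) (fock_inf_norm \<beta>) L" for L :: "(complex^'n \<Rightarrow> complex) \<Rightarrow> complex"
  proof -
    obtain D where L: "linear_on_fock \<beta> L D" using bounded_functional_linear_on_fock[OF bL] by blast
    define g where "g = (\<lambda>z. cnj (L (dual_kernel K \<kappa> z)))"
    have g: "g \<in> fock_one \<alpha>" unfolding g_def using A(2)[OF L] by blast
    \<comment> \<open>The difference of L and the pairing with g kills every kernel, so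
      \<open>functional_zero\<close> makes it vanish on the whole space.\<close>
    have zero: "L (dual_kernel K \<kappa> z) - pairing (\<alpha> + \<beta>) (dual_kernel K \<kappa> z) g = 0" for z
      by (simp add: repr[OF g]) (simp add: g_def)
    have "L f = pairing (\<alpha> + \<beta>) f g" if "f \<in> fock_inf0 \<beta>" for f
      using functional_zero[OF linear_on_fock_subtract[OF L lin[OF g]] K zero that] by simp
    moreover have "g' = g" if g': "g' \<in> fock_one \<alpha>" "\<forall>f \<in> fock_inf0 \<beta>. L f = pairing (\<alpha> + \<beta>) f g'" for g'
    proof
      fix z
      have "cnj (g' z) = L (dual_kernel K \<kappa> z)" using g'(2) QX[of z] repr[OF g'(1), of z] by simp
      thus "g' z = g z" unfolding g_def by (metis complex_cnj_cnj)
    qed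
    ultimately show ?thesis using g by blast
  qed
  \<comment> \<open>The function constructed from the functional f \<mapsto> <f, g> is g itself, so
    its norm estimate is the lower bound. A + 1 replaces A, which might be 0.\<close>
  have lower: "1 / (A + 1) * fock_one_norm \<alpha> g
      \<le> functional_norm (fock_inf0 \<beta>) (fock_inf_norm \<beta>) (\<lambda>f. pairing (\<alpha> + \<beta>) f g)"
    if g: "g \<in> fock_one \<alpha>" for g :: "complex^'n \<Rightarrow> complex"
  proof -
    let ?N = "functional_norm (fock_inf0 \<beta>) (fock_inf_norm \<beta>) (\<lambda>f. pairing (\<alpha> + \<beta>) f g)"
    note L = linear_on_fock_functional_norm[OF lin[OF g]]
    have "fock_one_norm \<alpha> (\<lambda>z. cnj (pairing (\<alpha> + \<beta>) (dual_kernel K \<kappa> z) g)) \<le> A * ?N"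
      using A(2)[OF L] by blast
    hence "fock_one_norm \<alpha> g \<le> A * ?N" by (simp add: repr[OF g])
    also have "\<dots> \<le> (A + 1) * ?N" using linear_on_fockD(1)[OF L] by (intro mult_right_mono) auto
    finally show ?thesis using A(1) by (simp add: field_simps)
  qed
  have upper: "functional_norm (fock_inf0 \<beta>) (fock_inf_norm \<beta>) (\<lambda>f. pairing (\<alpha> + \<beta>) f g) \<le> (C + 1) * fock_one_norm \<alpha> g"
    if g: "g \<in> fock_one \<alpha>" for g :: "complex^'n \<Rightarrow> complex"
    using linear_on_fock_bounded_functional(2)[OF lin[OF g]] fock_one_norm_nonneg[of \<alpha> g] by (simp add: distrib_right)
  show ?thesis
  proof (intro conjI)
    show "\<forall>g \<in> (fock_one \<alpha> :: (complex^'n \<Rightarrow> complex) set).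
        (\<forall>f \<in> fock_inf0 \<beta>. pairing_well_defined (\<alpha> + \<beta>) f g) \<and>
        bounded_functional (fock_inf0 \<beta>) (fock_inf_norm \<beta>) (\<lambda>f. pairing (\<alpha> + \<beta>) f g)"
      by (intro ballI conjI wd linear_on_fock_bounded_functional(1)[OF lin])
    show "\<forall>L :: (complex^'n \<Rightarrow> complex) \<Rightarrow> complex.
        bounded_functional (fock_inf0 \<beta>) (fock_inf_norm \<beta>) L \<longrightarrow>
        (\<exists>!g. g \<in> fock_one \<alpha> \<and> (\<forall>f \<in> fock_inf0 \<beta>. L f = pairing (\<alpha> + \<beta>) f g))"
      by (intro allI impI part2)
    show "\<exists>c > 0. \<exists>C > 0. \<forall>g \<in> (fock_one \<alpha> :: (complex^'n \<Rightarrow> complex) set).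
        c * fock_one_norm \<alpha> g
          \<le> functional_norm (fock_inf0 \<beta>) (fock_inf_norm \<beta>) (\<lambda>f. pairing (\<alpha> + \<beta>) f g) \<and>
        functional_norm (fock_inf0 \<beta>) (fock_inf_norm \<beta>) (\<lambda>f. pairing (\<alpha> + \<beta>) f g)
          \<le> C * fock_one_norm \<alpha> g"
    proof (rule exI[of _ "1 / (A + 1)"], rule conjI, goal_cases)
      case 1 show ?case using A(1) by simp
    next
      case 2
      have "C + 1 > 0" using C(1) by simp
      moreover have "\<forall>g \<in> (fock_one \<alpha> :: (complex^'n \<Rightarrow> complex) set).
        1 / (A + 1) * fock_one_norm \<alpha> g
          \<le> functional_norm (fock_inf0 \<beta>) (fock_inf_norm \<beta>) (\<lambda>f. pairing (\<alpha> + \<beta>) f g) \<and>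
        functional_norm (fock_inf0 \<beta>) (fock_inf_norm \<beta>) (\<lambda>f. pairing (\<alpha> + \<beta>) f g)
          \<le> (C + 1) * fock_one_norm \<alpha> g"
        by (intro ballI conjI lower upper)
      ultimately show ?case by (intro exI[of _ "C + 1"] conjI)
    qed
  qed
qed

end
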